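(* Let $\{A_i\}$ be an inverse system of torsion-free abelian groups indexed by $\mathbb{N}$ such that all the maps $A_{i+1} \to A_i$ are epimorphisms. Then for every $n \in \mathbb{N}$ the natural map $H_n(\varprojlim A_i) \to \varprojlim H_n(A_i)$ is injective and its cokernel is a cotorsion group.
   Context: $H_n(G) = H_n(G,\mathbb{Z})$ denotes the $n$-th group homology with integer coefficients. An abelian group $A$ is called a cotorsion group if $A \cong {\varprojlim}^1 B_i$ for some tower (inverse system indexed by $\mathbb{N}$) of abelian groups $B_i$; equivalently, if $\mathrm{Ext}(C,A)=0$ for every torsion-free abelian group $C$. *)

theory Defs
  imports "HOL-Algebra.Free_Abelian_Groups" "HOL-Algebra.Product_Groups" "HOL-Algebra.Weak_Morphisms" "HOL-Library.Countable"
begin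

section \<open>Group homology with integer coefficients\<close>

text \<open>
  The homology is that of the inhomogeneous (unnormalised) bar complex: degree \<open>n\<close> is the free
  abelian group on the symbols \<open>[g\<^sub>1|\<dots>|g\<^sub>n]\<close>, represented by lists of length \<open>n\<close>, i.e. the bar
  resolution of \<open>\<int>\<close> over \<open>\<int>[G]\<close> tensored over \<open>\<int>[G]\<close> with the trivial module \<open>\<int>\<close>.
\<close>

definition bar_chain_group :: "nat \<Rightarrow> ('a, 'm) monoid_scheme \<Rightarrow> ('a list \<Rightarrow>\<^sub>0 int) monoid"
  where "bar_chain_group n G = free_Abelian_group {xs. length xs = n \<and> set xs \<subseteq> carrier G}"

definition bar_face :: "('a, 'm) monoid_scheme \<Rightarrow> nat \<Rightarrow> 'a list \<Rightarrow> 'a list"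
  where "bar_face G i xs =
    (if i = 0 then tl xs
     else if i = length xs then butlast xs
     else take (i - 1) xs @ [xs ! (i - 1) \<otimes>\<^bsub>G\<^esub> xs ! i] @ drop (i + 1) xs)"

definition bar_boundary ::
    "nat \<Rightarrow> ('a, 'm) monoid_scheme \<Rightarrow> ('a list \<Rightarrow>\<^sub>0 int) \<Rightarrow> ('a list \<Rightarrow>\<^sub>0 int)"
  where "bar_boundary n G c =
    (if n = 0 then 0
     else frag_extend (\<lambda>xs. \<Sum>i\<le>n. frag_cmul ((-1) ^ i) (frag_of (bar_face G i xs))) c)"

definition bar_cycles :: "nat \<Rightarrow> ('a, 'm) monoid_scheme \<Rightarrow> ('a list \<Rightarrow>\<^sub>0 int) set"
  where "bar_cycles n G = {c \<in> carrier (bar_chain_group n G). bar_boundary n G c = 0}"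

definition bar_boundaries :: "nat \<Rightarrow> ('a, 'm) monoid_scheme \<Rightarrow> ('a list \<Rightarrow>\<^sub>0 int) set"
  where "bar_boundaries n G = bar_boundary (Suc n) G ` carrier (bar_chain_group (Suc n) G)"

definition group_homology :: "nat \<Rightarrow> ('a, 'm) monoid_scheme \<Rightarrow> ('a list \<Rightarrow>\<^sub>0 int) set monoid"
  where "group_homology n G =
    (bar_chain_group n G)\<lparr>carrier := bar_cycles n G\<rparr> Mod bar_boundaries n G"

definition bar_map :: "('a \<Rightarrow> 'b) \<Rightarrow> ('a list \<Rightarrow>\<^sub>0 int) \<Rightarrow> ('b list \<Rightarrow>\<^sub>0 int)"
  where "bar_map f = frag_extend (\<lambda>xs. frag_of (map f xs))"

text \<open>
  The map induced on homology by a homomorphism \<open>f\<close> into \<open>H\<close>. A homology class is a coset \<open>X\<close> of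
  cycles; for \<open>c \<in> X\<close> all the cosets in the union coincide, so that the union is the class of
  \<open>bar_map f c\<close>.
\<close>

definition group_homology_map ::
    "nat \<Rightarrow> ('b, 'm) monoid_scheme \<Rightarrow> ('a \<Rightarrow> 'b) \<Rightarrow> ('a list \<Rightarrow>\<^sub>0 int) set \<Rightarrow> ('b list \<Rightarrow>\<^sub>0 int) set"
  where "group_homology_map n H f X =
    (\<Union>c\<in>X. bar_boundaries n H #>\<^bsub>bar_chain_group n H\<^esub> bar_map f c)"


section \<open>Towers of abelian groups\<close>

definition tower :: "(nat \<Rightarrow> ('a, 'm) monoid_scheme) \<Rightarrow> (nat \<Rightarrow> 'a \<Rightarrow> 'a) \<Rightarrow> bool"
  where "tower A p \<longleftrightarrow> (\<forall>i. comm_group (A i) \<and> p i \<in> hom (A (Suc i)) (A i))"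

definition inverse_limit ::
    "(nat \<Rightarrow> ('a, 'm) monoid_scheme) \<Rightarrow> (nat \<Rightarrow> 'a \<Rightarrow> 'a) \<Rightarrow> (nat \<Rightarrow> 'a) monoid"
  where "inverse_limit A p = (product_group UNIV A)
    \<lparr>carrier := {x \<in> carrier (product_group UNIV A). \<forall>i. p i (x (Suc i)) = x i}\<rparr>"

definition cokernel ::
    "('a, 'm) monoid_scheme \<Rightarrow> ('b, 'k) monoid_scheme \<Rightarrow> ('a \<Rightarrow> 'b) \<Rightarrow> 'b set monoid"
  where "cokernel G H f = H Mod (f ` carrier G)"

definition tower_diff ::
    "(nat \<Rightarrow> ('a, 'm) monoid_scheme) \<Rightarrow> (nat \<Rightarrow> 'a \<Rightarrow> 'a) \<Rightarrow> (nat \<Rightarrow> 'a) \<Rightarrow> nat \<Rightarrow> 'a"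
  where "tower_diff A p x = (\<lambda>i. x i \<otimes>\<^bsub>A i\<^esub> inv\<^bsub>A i\<^esub> (p i (x (Suc i))))"

definition lim1 ::
    "(nat \<Rightarrow> ('a, 'm) monoid_scheme) \<Rightarrow> (nat \<Rightarrow> 'a \<Rightarrow> 'a) \<Rightarrow> (nat \<Rightarrow> 'a) set monoid"
  where "lim1 A p = cokernel (product_group UNIV A) (product_group UNIV A) (tower_diff A p)"

text \<open>
  A definition cannot quantify over the type of the groups \<open>B i\<close>. Taking the type \<open>nat \<Rightarrow> 'a\<close> loses
  nothing: by the lemma \<open>cotorsion_groupI\<close> below, a group that is isomorphic to \<open>lim\<^sup>1\<close> of a tower
  over any type whatsoever satisfies the definition.
\<close>

definition cotorsion_group :: "('a, 'm) monoid_scheme \<Rightarrow> bool"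
  where "cotorsion_group A \<longleftrightarrow> comm_group A \<and>
    (\<exists>(B :: nat \<Rightarrow> (nat \<Rightarrow> 'a) monoid) p. tower B p \<and> A \<cong> lim1 B p)"

definition torsion_free_group :: "('a, 'm) monoid_scheme \<Rightarrow> bool"
  where "torsion_free_group G \<longleftrightarrow>
    (\<forall>x\<in>carrier G. \<forall>n::nat. n > 0 \<longrightarrow> x [^]\<^bsub>G\<^esub> n = \<one>\<^bsub>G\<^esub> \<longrightarrow> x = \<one>\<^bsub>G\<^esub>)"

definition homology_limit_map ::
    "nat \<Rightarrow> (nat \<Rightarrow> ('a, 'm) monoid_scheme) \<Rightarrow> ((nat \<Rightarrow> 'a) list \<Rightarrow>\<^sub>0 int) set \<Rightarrow> nat \<Rightarrow> ('a list \<Rightarrow>\<^sub>0 int) set"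
  where "homology_limit_map n A X = (\<lambda>i. group_homology_map n (A i) (\<lambda>x. x i) X)"

subsection \<open>Independence of the type of the tower\<close>

lemma comm_group_product_group:
  assumes "\<And>i. comm_group (B i)"
  shows "comm_group (product_group UNIV B)"
proof (rule group.group_comm_groupI)
  show "group (product_group UNIV B)"
    using assms by (simp add: comm_group.axioms)
  fix x y
  assume "x \<in> carrier (product_group UNIV B)" "y \<in> carrier (product_group UNIV B)"
  then show "x \<otimes>\<^bsub>product_group UNIV B\<^esub> y = y \<otimes>\<^bsub>product_group UNIV B\<^esub> x"
    using assms by (auto simp: PiE_iff fun_eq_iff comm_monoid.m_comm comm_group.axioms)
qed

lemma tower_diff_hom:
  assumes "tower B f"
  shows "tower_diff B f \<in> hom (product_group UNIV B) (product_group UNIV B)"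
proof (rule homI)
  have B: "comm_group (B i)" and f: "f i \<in> hom (B (Suc i)) (B i)" for i
    using assms by (auto simp: tower_def)
  have G: "group (B i)" for i
    using B comm_group.axioms by blast
  {
    fix x assume "x \<in> carrier (product_group UNIV B)"
    then have x: "x i \<in> carrier (B i)" for i by auto
    show "tower_diff B f x \<in> carrier (product_group UNIV B)"
      using x f G by (auto simp: tower_diff_def hom_def Pi_iff intro!: group.is_monoid monoid.m_closed group.inv_closed)
  }
  fix x y
  assume "x \<in> carrier (product_group UNIV B)" "y \<in> carrier (product_group UNIV B)"
  then have x: "x i \<in> carrier (B i)" and y: "y i \<in> carrier (B i)" for i by auto
  have "tower_diff B f (x \<otimes>\<^bsub>product_group UNIV B\<^esub> y) i
      = (tower_diff B f x \<otimes>\<^bsub>product_group UNIV B\<^esub> tower_diff B f y) i" for i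
  proof -
    interpret comm_group "B i" by (rule B)
    have fx: "f i (x (Suc i)) \<in> carrier (B i)" and fy: "f i (y (Suc i)) \<in> carrier (B i)"
      using x y f[of i] by (auto simp: hom_def)
    have "f i (x (Suc i) \<otimes>\<^bsub>B (Suc i)\<^esub> y (Suc i)) = f i (x (Suc i)) \<otimes>\<^bsub>B i\<^esub> f i (y (Suc i))"
      using f[of i] x y by (auto simp: hom_def)
    then show ?thesis
      using x[of i] y[of i] fx fy by (simp add: tower_diff_def inv_mult m_ac)
  qed
  then show "tower_diff B f (x \<otimes>\<^bsub>product_group UNIV B\<^esub> y)
      = tower_diff B f x \<otimes>\<^bsub>product_group UNIV B\<^esub> tower_diff B f y" by (rule ext)
qed

lemma tower_diff_subgroup:
  assumes "tower B f"
  shows "subgroup (tower_diff B f ` carrier (product_group UNIV B)) (product_group UNIV B)"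
proof -
  have "group (product_group UNIV B)"
    using assms comm_group_product_group[of B] comm_group.axioms unfolding tower_def by blast
  then interpret group_hom "product_group UNIV B" "product_group UNIV B" "tower_diff B f"
    using tower_diff_hom[OF assms] by (simp add: group_hom_def group_hom_axioms_def)
  show ?thesis by (rule img_is_subgroup)
qed

lemma comm_group_lim1: "tower B f \<Longrightarrow> comm_group (lim1 B f)"
  unfolding lim1_def cokernel_def
  by (rule comm_group.abelian_FactGroup[OF comm_group_product_group tower_diff_subgroup])
     (auto simp: tower_def)

lemma lim1_iso_lim1:
  fixes B :: "nat \<Rightarrow> ('b, 'm) monoid_scheme" and C :: "nat \<Rightarrow> ('c, 'k) monoid_scheme"
  assumes B: "tower B f" and C: "tower C g"
    and m: "\<And>i. m i \<in> hom (C i) (B i)"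
    and comm: "\<And>i c. c \<in> carrier (C (Suc i)) \<Longrightarrow> m i (g i c) = f i (m (Suc i) c)"
    and surj: "\<And>X. X \<in> carrier (lim1 B f) \<Longrightarrow>
        \<exists>c \<in> carrier (product_group UNIV C).
          X = tower_diff B f ` carrier (product_group UNIV B) #>\<^bsub>product_group UNIV B\<^esub> (\<lambda>i. m i (c i))"
    and inj: "\<And>c. c \<in> carrier (product_group UNIV C) \<Longrightarrow>
        (\<lambda>i. m i (c i)) \<in> tower_diff B f ` carrier (product_group UNIV B) \<Longrightarrow>
        c \<in> tower_diff C g ` carrier (product_group UNIV C)"
  shows "lim1 C g \<cong> lim1 B f"
proof -
  define PB PC where "PB = product_group UNIV B" and "PC = product_group UNIV C"
  define IB IC where "IB = tower_diff B f ` carrier PB" and "IC = tower_diff C g ` carrier PC"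
  define h where "h c = IB #>\<^bsub>PB\<^esub> (\<lambda>i. m i (c i))" for c
  have Bi: "comm_group (B i)" and f: "f i \<in> hom (B (Suc i)) (B i)" for i
    using B by (auto simp: tower_def)
  have Ci: "comm_group (C i)" and g: "g i \<in> hom (C (Suc i)) (C i)" for i
    using C by (auto simp: tower_def)
  have mh: "group_hom (C i) (B i) (m i)" for i
    using Bi Ci m by (simp add: group_hom_def group_hom_axioms_def comm_group.axioms)
  interpret PB: comm_group PB unfolding PB_def by (rule comm_group_product_group[OF Bi])
  interpret PC: comm_group PC unfolding PC_def by (rule comm_group_product_group[OF Ci])
  have IB: "subgroup IB PB" unfolding IB_def PB_def by (rule tower_diff_subgroup[OF B])
  have NB: "IB \<lhd> PB" using IB by (rule PB.subgroup_imp_normal)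
  have L: "lim1 B f = PB Mod IB" "lim1 C g = PC Mod IC"
    by (simp_all add: lim1_def cokernel_def PB_def PC_def IB_def IC_def)
  have M: "(\<lambda>c i. m i (c i)) \<in> hom PC PB"
    using m by (auto simp: hom_def PB_def PC_def PiE_iff Pi_iff fun_eq_iff)
  have hh: "h \<in> hom PC (PB Mod IB)"
    using hom_compose[OF M normal.r_coset_hom_Mod[OF NB]] by (simp add: h_def[abs_def] comp_def)
  interpret h: group_hom PC "PB Mod IB" h
    using hh NB by (simp add: group_hom_def group_hom_axioms_def normal.factorgroup_is_group PC.is_group)
  have "kernel PC (PB Mod IB) h = IC"
  proof (intro equalityI subsetI)
    fix c assume "c \<in> kernel PC (PB Mod IB) h"
    then have c: "c \<in> carrier PC" and "h c = IB" by (auto simp: kernel_def)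
    moreover have mc: "(\<lambda>i. m i (c i)) \<in> carrier PB" using M c by (auto simp: hom_def)
    ultimately have "(\<lambda>i. m i (c i)) \<in> IB"
      using PB.rcos_self[OF mc IB] by (simp add: h_def)
    with c show "c \<in> IC" using inj by (simp add: IB_def IC_def PB_def PC_def)
  next
    fix c assume "c \<in> IC"
    then obtain d where d: "d \<in> carrier PC" "c = tower_diff C g d" by (auto simp: IC_def)
    have c: "c \<in> carrier PC"
      using d tower_diff_hom[OF C] by (auto simp: hom_def PC_def)
    have di: "d i \<in> carrier (C i)" for i using d by (auto simp: PC_def)
    have "(\<lambda>i. m i (c i)) = tower_diff B f (\<lambda>i. m i (d i))"
    proof
      fix i
      interpret mi: group_hom "C i" "B i" "m i" by (rule mh)
      have gd: "g i (d (Suc i)) \<in> carrier (C i)" using g[of i] di by (auto simp: hom_def)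
      show "m i (c i) = tower_diff B f (\<lambda>i. m i (d i)) i"
        using di[of i] gd comm[OF di] d by (simp add: tower_diff_def)
    qed
    then have "(\<lambda>i. m i (c i)) \<in> IB" using M d(1) by (auto simp: IB_def hom_def)
    then have "h c = IB" unfolding h_def
      using IB M c by (intro PB.coset_join2) (auto simp: hom_def)
    with c show "c \<in> kernel PC (PB Mod IB) h" by (simp add: kernel_def)
  qed
  moreover have "h ` carrier PC = carrier (PB Mod IB)"
  proof
    show "h ` carrier PC \<subseteq> carrier (PB Mod IB)" using h.hom_closed by blast
    show "carrier (PB Mod IB) \<subseteq> h ` carrier PC"
      using surj unfolding L h_def IB_def PB_def PC_def by blast
  qed
  ultimately show ?thesis using h.FactGroup_iso L by simp
qed

text \<open>Countably branching trees, which name the elements of a small subtower.\<close>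

datatype 'a ctree = Leaf 'a | Node nat "nat \<Rightarrow> 'a ctree"

primrec ctree_code :: "'a ctree \<Rightarrow> nat list \<Rightarrow> 'a + nat" where
  "ctree_code (Leaf a) = (\<lambda>l. Inl a)"
| "ctree_code (Node k T) = (\<lambda>l. case l of [] \<Rightarrow> Inr k | j # l' \<Rightarrow> ctree_code (T j) l')"

lemma inj_ctree_code: "inj ctree_code"
proof (rule injI)
  fix s t :: "'a ctree"
  show "ctree_code s = ctree_code t \<Longrightarrow> s = t"
  proof (induction s arbitrary: t)
    case (Leaf a)
    from fun_cong[OF Leaf, of "[]"] show ?case by (cases t) auto
  next
    case (Node k T)
    show ?case
    proof (cases t)
      case (Leaf b)
      with fun_cong[OF Node.prems, of "[]"] show ?thesis by simp
    next
      case (Node k' T')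
      have "k = k'" using fun_cong[OF Node.prems, of "[]"] Node by simp
      moreover have "T j = T' j" for j
      proof (rule Node.IH)
        show "ctree_code (T j) = ctree_code (T' j)"
        proof
          fix l show "ctree_code (T j) l = ctree_code (T' j) l"
            using fun_cong[OF Node.prems, of "j # l"] Node by simp
        qed
      qed simp
      ultimately show ?thesis using Node by auto
    qed
  qed
qed

lemma ex_inj_ctree:
  fixes x y :: 'a
  assumes "x \<noteq> y"
  shows "\<exists>e :: 'a ctree \<Rightarrow> nat \<Rightarrow> 'a. inj e"
proof -
  define u :: "'a + nat \<Rightarrow> nat \<Rightarrow> 'a" where
    "u s n = (case s of Inl a \<Rightarrow> (if n = 0 then x else a)
              | Inr k \<Rightarrow> (if n = 0 then y else if n = Suc k then x else y))" for s n
  have u: "inj u"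
  proof (rule injI)
    fix s t assume "u s = u t"
    then have *: "u s n = u t n" for n by simp
    show "s = t"
    proof (cases s; cases t)
      fix a b assume "s = Inl a" "t = Inl b"
      then show ?thesis using *[of 1] by (simp add: u_def)
    next
      fix a b assume "s = Inl a" "t = Inr b"
      then show ?thesis using *[of 0] assms by (simp add: u_def)
    next
      fix a b assume "s = Inr a" "t = Inl b"
      then show ?thesis using *[of 0] assms by (simp add: u_def)
    next
      fix a b assume "s = Inr a" "t = Inr b"
      then show ?thesis using *[of "Suc a"] assms by (simp add: u_def split: if_splits)
    qed
  qed
  define v :: "(nat list \<Rightarrow> 'a + nat) \<Rightarrow> nat \<Rightarrow> 'a" where
    "v c n = (case from_nat n of (l, j) \<Rightarrow> u (c l) j)" for c n
  have "inj v"
  proof (rule injI)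
    fix c d assume "v c = v d"
    then have "v c (to_nat (l, j)) = v d (to_nat (l, j))" for l :: "nat list" and j :: nat by simp
    then have "u (c l) j = u (d l) j" for l j by (simp add: v_def)
    then have "u (c l) = u (d l)" for l by (rule ext)
    then show "c = d" using u by (auto dest: injD)
  qed
  then have "inj (v \<circ> ctree_code)" using inj_ctree_code by (rule inj_compose)
  then show ?thesis by blast
qed

lemma cotorsion_groupI:
  fixes A :: "('a, 'm) monoid_scheme" and B :: "nat \<Rightarrow> ('b, 'k) monoid_scheme"
  assumes A: "comm_group A" and B: "tower B f" and iso: "A \<cong> lim1 B f"
  shows "cotorsion_group A"
proof -
  define PB where "PB = product_group UNIV B"
  define IB where "IB = tower_diff B f ` carrier PB"
  have Bi: "comm_group (B i)" and f: "f i \<in> hom (B (Suc i)) (B i)" for i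
    using B by (auto simp: tower_def)
  have Gi: "group (B i)" for i using Bi comm_group.axioms by blast
  interpret PB: comm_group PB unfolding PB_def by (rule comm_group_product_group[OF Bi])
  have IB: "subgroup IB PB" unfolding IB_def PB_def by (rule tower_diff_subgroup[OF B])
  have L: "lim1 B f = PB Mod IB" by (simp add: lim1_def cokernel_def PB_def IB_def)
  obtain \<phi> where \<phi>: "\<phi> \<in> iso A (PB Mod IB)" using iso L by (auto simp: is_iso_def)
  have one: "(\<lambda>i. \<one>\<^bsub>B i\<^esub>) \<in> carrier PB" using PB.one_closed by (simp add: PB_def PiE_iff)
  have "\<exists>(C :: nat \<Rightarrow> (nat \<Rightarrow> 'a) monoid) g. tower C g \<and> lim1 C g \<cong> lim1 B f"
  proof (cases "\<forall>x y :: 'a. x = y")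
    case True
    define C :: "nat \<Rightarrow> (nat \<Rightarrow> 'a) monoid" where "C = (\<lambda>i. singleton_group undefined)"
    define g :: "nat \<Rightarrow> (nat \<Rightarrow> 'a) \<Rightarrow> (nat \<Rightarrow> 'a)" where "g = (\<lambda>i x. undefined)"
    have C: "tower C g"
      by (auto simp: tower_def C_def g_def hom_def singleton_group_def intro!: comm_groupI)
    have all_one: "X = IB" if "X \<in> carrier (lim1 B f)" for X
    proof -
      have *: "carrier (PB Mod IB) = \<phi> ` carrier A"
        using \<phi> by (auto simp: iso_def bij_betw_def)
      have "group (PB Mod IB)"
        by (rule normal.factorgroup_is_group[OF PB.subgroup_imp_normal[OF IB]])
      from monoid.one_closed[OF group.is_monoid[OF this]] have "IB \<in> \<phi> ` carrier A"
        unfolding * by simp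
      moreover have "X \<in> \<phi> ` carrier A" using that unfolding L * .
      ultimately obtain a b where "X = \<phi> a" "IB = \<phi> b" by blast
      moreover have "a = b" using True by blast
      ultimately show ?thesis by simp
    qed
    have "lim1 C g \<cong> lim1 B f"
    proof (rule lim1_iso_lim1[OF B C, where m = "\<lambda>i c. \<one>\<^bsub>B i\<^esub>"])
      show "(\<lambda>c. \<one>\<^bsub>B i\<^esub>) \<in> hom (C i) (B i)" for i
        using Gi[of i] by (auto simp: hom_def group.is_monoid)
      show "\<one>\<^bsub>B i\<^esub> = f i \<one>\<^bsub>B (Suc i)\<^esub>" for i
        using hom_one[OF f Gi Gi] by simp
    next
      fix X assume "X \<in> carrier (lim1 B f)"
      then have "X = IB" by (rule all_one)
      also have "IB = IB #>\<^bsub>PB\<^esub> \<one>\<^bsub>PB\<^esub>"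
        using subgroup.subset[OF IB] by (simp add: PB.coset_mult_one)
      finally have "X = IB #>\<^bsub>PB\<^esub> (\<lambda>i. \<one>\<^bsub>B i\<^esub>)" by (simp add: PB_def restrict_def)
      then show "\<exists>c\<in>carrier (product_group UNIV C). X = tower_diff B f ` carrier (product_group UNIV B)
            #>\<^bsub>product_group UNIV B\<^esub> (\<lambda>i. \<one>\<^bsub>B i\<^esub>)"
        by (auto simp: PB_def IB_def C_def PiE_iff intro!: exI[of _ "\<lambda>i. undefined"])
    next
      fix c assume "c \<in> carrier (product_group UNIV C)"
      then have "tower_diff C g c = c"
        by (auto simp: tower_diff_def C_def PiE_iff fun_eq_iff singleton_group_def)
      with \<open>c \<in> carrier (product_group UNIV C)\<close>
      show "c \<in> tower_diff C g ` carrier (product_group UNIV C)" by force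
    qed
    with C show ?thesis by blast
  next
    case False
    then obtain code :: "'a ctree \<Rightarrow> nat \<Rightarrow> 'a" where code: "inj code"
      using ex_inj_ctree by metis
    define rep where "rep a = (if a \<in> carrier A then (SOME r. r \<in> carrier PB \<and> \<phi> a = IB #>\<^bsub>PB\<^esub> r)
                               else (\<lambda>i. \<one>\<^bsub>B i\<^esub>))" for a
    have rep: "rep a \<in> carrier PB \<and> \<phi> a = IB #>\<^bsub>PB\<^esub> rep a" if "a \<in> carrier A" for a
    proof -
      have "\<phi> a \<in> carrier (PB Mod IB)" using \<phi> that by (auto simp: iso_def hom_def)
      then have "\<exists>r. r \<in> carrier PB \<and> \<phi> a = IB #>\<^bsub>PB\<^esub> r"
        by (auto simp: FactGroup_def RCOSETS_def)
      from someI_ex[OF this] show ?thesis using that by (simp add: rep_def)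
    qed
    have rep_closed: "rep a \<in> carrier PB" for a
      using rep[of a] one by (cases "a \<in> carrier A") (auto simp: rep_def)
    define pre where "pre s = (if s \<in> IB then (SOME x. x \<in> carrier PB \<and> tower_diff B f x = s)
                               else (\<lambda>i. \<one>\<^bsub>B i\<^esub>))" for s
    have pre: "pre s \<in> carrier PB \<and> tower_diff B f (pre s) = s" if "s \<in> IB" for s
    proof -
      have "\<exists>x. x \<in> carrier PB \<and> tower_diff B f x = s" using that by (auto simp: IB_def)
      from someI_ex[OF this] show ?thesis using that by (simp add: pre_def)
    qed
    have pre_closed: "pre s \<in> carrier PB" for s
      using pre[of s] one by (cases "s \<in> IB") (auto simp: pre_def)
    define ev where "ev = rec_ctree rep (\<lambda>k T. let E = snd \<circ> T in
        if k = 0 then (\<lambda>i. E 0 i \<otimes>\<^bsub>B i\<^esub> E 1 i)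
        else if k = 1 then (\<lambda>i. inv\<^bsub>B i\<^esub> E 0 i)
        else if k = 2 then (\<lambda>i. f i (E 0 (Suc i)))
        else pre (\<lambda>j. E j j))"
    have ev_Leaf: "ev (Leaf a) = rep a" for a by (simp add: ev_def)
    have ev_mult: "ev (Node 0 T) = (\<lambda>i. ev (T 0) i \<otimes>\<^bsub>B i\<^esub> ev (T 1) i)" for T
      by (simp add: ev_def)
    have ev_inv: "ev (Node 1 T) = (\<lambda>i. inv\<^bsub>B i\<^esub> ev (T 0) i)" for T
      by (simp add: ev_def)
    have ev_map: "ev (Node 2 T) = (\<lambda>i. f i (ev (T 0) (Suc i)))" for T
      by (simp add: ev_def)
    have ev_pre: "ev (Node k T) = pre (\<lambda>j. ev (T j) j)" if "k \<noteq> 0" "k \<noteq> 1" "k \<noteq> 2" for k T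
      using that by (simp add: ev_def)
    have ev_closed: "ev t i \<in> carrier (B i)" for t i
    proof (induction t arbitrary: i)
      case (Leaf a)
      then show ?case using rep_closed[of a] by (auto simp: ev_Leaf PB_def)
    next
      case (Node k T)
      have IH: "ev (T j) i \<in> carrier (B i)" for j i using Node by simp
      interpret Bi: group "B i" by (rule Gi)
      have 0: "ev (Node 0 T) i \<in> carrier (B i)" using IH by (simp add: ev_mult)
      have 1: "ev (Node 1 T) i \<in> carrier (B i)" using IH by (simp only: ev_inv Bi.inv_closed)
      have 2: "ev (Node 2 T) i \<in> carrier (B i)" using IH f[of i] by (auto simp: ev_map hom_def)
      have "pre s i \<in> carrier (B i)" for s using pre_closed[of s] by (auto simp: PB_def)
      then show ?case using 0 1 2 ev_pre[of k T] by metis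
    qed
    define D where "D i = range (\<lambda>t. ev t i)" for i
    have D_sub: "D i \<subseteq> carrier (B i)" for i using ev_closed by (auto simp: D_def)
    have D_mult: "x \<otimes>\<^bsub>B i\<^esub> y \<in> D i" if xy: "x \<in> D i" "y \<in> D i" for x y i
    proof -
      obtain s t where "x = ev s i" "y = ev t i" using xy by (auto simp: D_def)
      then have "x \<otimes>\<^bsub>B i\<^esub> y = ev (Node 0 (\<lambda>j. if j = 0 then s else t)) i"
        by (simp add: ev_mult)
      then show ?thesis unfolding D_def by (metis rangeI)
    qed
    have D_inv: "inv\<^bsub>B i\<^esub> x \<in> D i" if x: "x \<in> D i" for x i
    proof -
      obtain s where "x = ev s i" using x by (auto simp: D_def)
      then have "inv\<^bsub>B i\<^esub> x = ev (Node 1 (\<lambda>j. s)) i" by (simp only: ev_inv)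
      then show ?thesis unfolding D_def by (metis rangeI)
    qed
    have D_map: "f i x \<in> D i" if x: "x \<in> D (Suc i)" for x i
    proof -
      obtain s where "x = ev s (Suc i)" using x by (auto simp: D_def)
      then have "f i x = ev (Node 2 (\<lambda>j. s)) i" by (simp add: ev_map)
      then show ?thesis unfolding D_def by (metis rangeI)
    qed
    have D_pre: "pre s i \<in> D i" if s: "\<And>j. s j \<in> D j" for s i
    proof -
      have "\<exists>t. s j = ev t j" for j using s[of j] by (auto simp: D_def)
      then obtain T where "s j = ev (T j) j" for j by metis
      then have "s = (\<lambda>j. ev (T j) j)" by auto
      then have "pre s i = ev (Node 3 T) i" by (simp add: ev_pre)
      then show ?thesis unfolding D_def by (metis rangeI)
    qed
    have D_rep: "rep a i \<in> D i" for a i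
      unfolding D_def by (metis ev_Leaf rangeI)
    have D: "subgroup (D i) (B i)" for i
      using D_sub[of i] D_mult[of _ i] D_inv[of _ i] D_rep[of undefined i]
      by (intro group.subgroupI[OF Gi]) auto
    define e where "e i b = code (SOME t. ev t i = b)" for i b
    have e: "inj_on (e i) (D i)" for i
    proof (rule inj_onI)
      fix b c assume bc: "b \<in> D i" "c \<in> D i" "e i b = e i c"
      have ev_some: "ev (SOME t. ev t i = x) i = x" if "x \<in> D i" for x
        by (rule someI_ex[of "\<lambda>t. ev t i = x"]) (use that in \<open>auto simp: D_def\<close>)
      have "b = ev (SOME t. ev t i = b) i" by (rule sym[OF ev_some[OF bc(1)]])
      also have "\<dots> = ev (SOME t. ev t i = c) i"
        by (simp only: injD[OF code bc(3)[unfolded e_def]])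
      also have "\<dots> = c" by (rule ev_some[OF bc(2)])
      finally show "b = c" .
    qed
    define C where "C i = image_group (e i) ((B i)\<lparr>carrier := D i\<rparr>)" for i
    define dec where "dec i = inv_into (D i) (e i)" for i
    define g where "g i c = e i (f i (dec (Suc i) c))" for i c
    have carrier_C: "carrier (C i) = e i ` D i" for i
      by (simp add: C_def image_group_def)
    have mult_C: "x \<otimes>\<^bsub>C i\<^esub> y = e i (dec i x \<otimes>\<^bsub>B i\<^esub> dec i y)" for i x y
      by (simp add: C_def image_group_def dec_def)
    have dec_e [simp]: "dec i (e i b) = b" if "b \<in> D i" for i b
      using that e by (simp add: dec_def)
    have dec_D: "dec i c \<in> D i" if "c \<in> carrier (C i)" for i c
      using that by (auto simp: carrier_C)
    have e_dec: "e i (dec i c) = c" if "c \<in> carrier (C i)" for i c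
      using that by (auto simp: carrier_C)
    have comm_C: "comm_group (C i)" for i
    proof -
      have sub: "group ((B i)\<lparr>carrier := D i\<rparr>)"
        using subgroup.subgroup_is_group[OF D Gi] .
      have "group (C i)"
        unfolding C_def using e by (intro group.inj_imp_image_group_is_group[OF sub]) simp
      moreover have "x \<otimes>\<^bsub>C i\<^esub> y = y \<otimes>\<^bsub>C i\<^esub> x" if "x \<in> carrier (C i)" "y \<in> carrier (C i)" for x y
        using dec_D[OF that(1)] dec_D[OF that(2)] D_sub[of i] Bi[of i]
        by (metis (no_types) comm_group_def comm_monoid.m_comm mult_C subsetD)
      ultimately show ?thesis by (rule group.group_comm_groupI)
    qed
    have g_hom: "g i \<in> hom (C (Suc i)) (C i)" for i
    proof (rule homI)
      fix x y assume x: "x \<in> carrier (C (Suc i))" and y: "y \<in> carrier (C (Suc i))"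
      show "g i x \<in> carrier (C i)" using dec_D[OF x] D_map by (auto simp: g_def carrier_C)
      have "f i (dec (Suc i) x \<otimes>\<^bsub>B (Suc i)\<^esub> dec (Suc i) y)
          = f i (dec (Suc i) x) \<otimes>\<^bsub>B i\<^esub> f i (dec (Suc i) y)"
        using f[of i] dec_D[OF x] dec_D[OF y] D_sub[of "Suc i"] by (auto simp: hom_def)
      then show "g i (x \<otimes>\<^bsub>C (Suc i)\<^esub> y) = g i x \<otimes>\<^bsub>C i\<^esub> g i y"
        using dec_D[OF x] dec_D[OF y] D_mult D_map by (simp add: g_def mult_C)
    qed
    have C: "tower C g" using comm_C g_hom by (simp add: tower_def)
    have "lim1 C g \<cong> lim1 B f"
    proof (rule lim1_iso_lim1[OF B C, where m = dec])
      show "dec i \<in> hom (C i) (B i)" for i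
        using dec_D[of _ i] D_sub[of i] D_mult[of _ i] by (auto simp: hom_def mult_C)
      show "dec i (g i c) = f i (dec (Suc i) c)" if "c \<in> carrier (C (Suc i))" for i c
        using dec_D[OF that] D_map by (simp add: g_def)
    next
      fix X assume "X \<in> carrier (lim1 B f)"
      then have "X \<in> \<phi> ` carrier A" using \<phi> L by (auto simp: iso_def bij_betw_def)
      then obtain a where a: "X = IB #>\<^bsub>PB\<^esub> rep a" using rep by auto
      have "(\<lambda>i. e i (rep a i)) \<in> carrier (product_group UNIV C)"
        using D_rep by (auto simp: carrier_C)
      moreover have "(\<lambda>i. dec i (e i (rep a i))) = rep a" using D_rep by simp
      ultimately show "\<exists>c\<in>carrier (product_group UNIV C). X = tower_diff B f ` carrier (product_group UNIV B)
            #>\<^bsub>product_group UNIV B\<^esub> (\<lambda>i. dec i (c i))"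
        using a by (intro bexI[of _ "\<lambda>i. e i (rep a i)"]) (simp_all add: IB_def PB_def)
    next
      fix c assume c: "c \<in> carrier (product_group UNIV C)"
        and "(\<lambda>i. dec i (c i)) \<in> tower_diff B f ` carrier (product_group UNIV B)"
      then have s: "(\<lambda>i. dec i (c i)) \<in> IB" by (simp add: IB_def PB_def)
      have ci: "c i \<in> carrier (C i)" for i using c by auto
      define x where "x = pre (\<lambda>i. dec i (c i))"
      have xD: "x i \<in> D i" for i unfolding x_def using dec_D[OF ci] by (rule D_pre)
      have x: "tower_diff B f x = (\<lambda>i. dec i (c i))" using pre[OF s] by (simp add: x_def)
      define d where "d = (\<lambda>i. e i (x i))"
      have di: "d i \<in> carrier (C i)" for i using xD by (simp add: d_def carrier_C)
      have "tower_diff C g d i = c i" for i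
      proof -
        interpret Ci: comm_group "C i" by (rule comm_C)
        have dec_hom: "dec i \<in> hom (C i) (B i)"
          using dec_D[of _ i] D_sub[of i] D_mult[of _ i] by (auto simp: hom_def mult_C)
        interpret m: group_hom "C i" "B i" "dec i"
          using dec_hom Gi by (simp add: group_hom_def group_hom_axioms_def Ci.is_group)
        have gd: "g i (d (Suc i)) \<in> carrier (C i)" using g_hom[of i] di by (auto simp: hom_def)
        then have cl: "tower_diff C g d i \<in> carrier (C i)"
          using di[of i] by (simp add: tower_diff_def)
        have "dec i (tower_diff C g d i) = tower_diff B f x i"
          using di[of i] gd xD D_map by (simp add: tower_diff_def d_def g_def)
        then have "dec i (tower_diff C g d i) = dec i (c i)" using x by simp
        then show ?thesis using e_dec[OF cl] e_dec[OF ci] by metis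
      qed
      then have "tower_diff C g d = c" by auto
      moreover have "d \<in> carrier (product_group UNIV C)" using di by (simp add: PiE_iff)
      ultimately show "c \<in> tower_diff C g ` carrier (product_group UNIV C)" by blast
    qed
    with C show ?thesis by blast
  qed
  then obtain C :: "nat \<Rightarrow> (nat \<Rightarrow> 'a) monoid" and g
    where C: "tower C g" and CB: "lim1 C g \<cong> lim1 B f"
    by (elim exE conjE)
  have "group (lim1 C g)" using comm_group_lim1[OF C] by (rule comm_group.axioms)
  then have "lim1 B f \<cong> lim1 C g" using CB by (rule group.iso_sym)
  with iso have "A \<cong> lim1 C g" by (rule iso_trans)
  with A C show ?thesis unfolding cotorsion_group_def by (intro conjI exI)
qed

end

theory Submission
  imports Defs
begin

text \<open>
  Write \<open>A\<close> for the limit of the tower. A cycle of the bar complex of a torsion-free abelian group involves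
  finitely many group elements, hence lives on a finitely generated free subgroup \<open>F\<close>. Since \<open>F\<close> lifts along
  epimorphisms, the maps \<open>H\<^sub>n(A) \<rightarrow> H\<^sub>n(A\<^sub>i)\<close> are surjective, so that the cokernel of
  \<open>H\<^sub>n(A) \<rightarrow> lim H\<^sub>n(A\<^sub>i)\<close> is \<open>lim\<^sup>1\<close> of the tower of kernels. For the injectivity, a finitely generated
  subgroup \<open>F\<close> of \<open>A\<close> embeds in some \<open>A\<^sub>i\<close>, because its intersections with the kernels of
  \<open>A \<rightarrow> A\<^sub>i\<close> form a decreasing sequence of pure subgroups with trivial intersection. Homology classes of \<open>F\<close>
  are detected by products of \<open>n\<close> coordinate functions \<open>F \<rightarrow> \<int>\<close> (the Wang sequence, by induction on the rank),
  and a nonzero multiple of every coordinate function extends to each finitely generated subgroup of \<open>A\<^sub>i\<close>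
  that contains the image of \<open>F\<close>.
\<close>

subsection \<open>Linear maps of free abelian groups\<close>

text \<open>The chains that bound the images of a cycle in the various \<open>A_i\<close> need not
  be compatible, so they yield no bounding chain in the limit. Detection by integer-valued cocycles
  on \<open>F\<close> avoids them: one index at which \<open>F\<close> embeds decides. There the
  bounding chain lives on a finitely generated group \<open>E\<close> in which the image of
  \<open>F\<close> need not be a direct summand. A retraction of \<open>E\<close> onto
  \<open>F\<close> may fail to exist, and coordinate functions extend only after multiplication by a
  nonzero integer. This is harmless because cocycles are evaluated in the torsion-free group of
  integers. The Wang sequence is made explicit. For \<open>G = N x Z\<close> the chains modulo
  \<open>N\<close> form a complex with a shift \<open>t\<close>; a prism homotopy deforms it onto
  the words over \<open>N\<close>, and the connecting map arises on dividing the boundary of a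
  lifted cycle by \<open>t - 1\<close>. The consequence needed is that a cycle of positive degree
  bounds as soon as its projection to \<open>N\<close> and its projected cap product with the
  coordinate of \<open>Z\<close> bound.\<close>

lemma frag_extend_frag_extend:
  "frag_extend f (frag_extend g c) = frag_extend (\<lambda>x. frag_extend f (g x)) c"
  using subset_UNIV by (induction c rule: frag_induction) (auto simp: frag_extend_diff)

lemma frag_extend_fun_add: "frag_extend (\<lambda>x. f x + g x) c = frag_extend f c + frag_extend g c"
  by (simp add: frag_extend_def frag_cmul_distrib2 sum.distrib)

lemma frag_extend_fun_minus: "frag_extend (\<lambda>x. - f x) c = - frag_extend f c"
  using subset_UNIV by (induction c rule: frag_induction) (auto simp: frag_extend_diff)

lemma frag_extend_fun_diff: "frag_extend (\<lambda>x. f x - g x) c = frag_extend f c - frag_extend g c"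
  using frag_extend_fun_add[of f "\<lambda>x. - g x" c] by (simp add: frag_extend_fun_minus)

definition frag_map :: "('a \<Rightarrow> 'b) \<Rightarrow> ('a \<Rightarrow>\<^sub>0 int) \<Rightarrow> ('b \<Rightarrow>\<^sub>0 int)"
  where "frag_map f = frag_extend (\<lambda>x. frag_of (f x))"

lemma bar_map_eq: "bar_map f = frag_map (map f)"
  by (simp add: bar_map_def frag_map_def)

lemma frag_map_of [simp]: "frag_map f (frag_of x) = frag_of (f x)"
  by (simp add: frag_map_def)

lemma frag_map_0 [simp]: "frag_map f 0 = 0"
  by (simp add: frag_map_def)

lemma frag_extend_frag_map: "frag_extend f (frag_map g c) = frag_extend (\<lambda>x. f (g x)) c"
  by (simp add: frag_map_def frag_extend_frag_extend)

lemma frag_map_frag_extend: "frag_map f (frag_extend g c) = frag_extend (\<lambda>x. frag_map f (g x)) c"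
  by (simp add: frag_map_def frag_extend_frag_extend)

lemma frag_map_frag_map: "frag_map f (frag_map g c) = frag_map (\<lambda>x. f (g x)) c"
  by (simp add: frag_map_def frag_extend_frag_extend)

lemma frag_map_cong: "(\<And>x. x \<in> Poly_Mapping.keys c \<Longrightarrow> f x = g x) \<Longrightarrow> frag_map f c = frag_map g c"
  unfolding frag_map_def by (intro frag_extend_eq) auto

lemma frag_map_ident: "(\<And>x. x \<in> Poly_Mapping.keys c \<Longrightarrow> f x = x) \<Longrightarrow> frag_map f c = c"
proof -
  assume "\<And>x. x \<in> Poly_Mapping.keys c \<Longrightarrow> f x = x"
  then have "frag_map f c = frag_extend frag_of c"
    unfolding frag_map_def by (intro frag_extend_eq) auto
  then show ?thesis by (simp flip: frag_expansion)
qed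

lemma frag_map_add: "frag_map f (a + b) = frag_map f a + frag_map f b"
  and frag_map_diff: "frag_map f (a - b) = frag_map f a - frag_map f b"
  and frag_map_minus: "frag_map f (- a) = - frag_map f a"
  and frag_map_cmul: "frag_map f (frag_cmul n a) = frag_cmul n (frag_map f a)"
  by (simp_all add: frag_map_def frag_extend_add frag_extend_diff frag_extend_minus frag_extend_cmul)

lemmas frag_linear = frag_extend_add frag_extend_diff frag_extend_minus frag_extend_cmul
  frag_map_add frag_map_diff frag_map_minus frag_map_cmul

lemma keys_frag_map: "Poly_Mapping.keys (frag_map f c) \<subseteq> f ` Poly_Mapping.keys c"
  using keys_frag_extend[of "\<lambda>x. frag_of (f x)" c] by (auto simp: frag_map_def)

lemma keys_frag_extend_subset:
  assumes "\<And>x. x \<in> Poly_Mapping.keys c \<Longrightarrow> Poly_Mapping.keys (f x) \<subseteq> S"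
  shows "Poly_Mapping.keys (frag_extend f c) \<subseteq> S"
  using keys_frag_extend[of f c] assms by blast

lemma keys_add_subset:
  "Poly_Mapping.keys a \<subseteq> S \<Longrightarrow> Poly_Mapping.keys b \<subseteq> S \<Longrightarrow> Poly_Mapping.keys (a + b) \<subseteq> S"
  using keys_add[of a b] by blast

lemma keys_diff_subset:
  "Poly_Mapping.keys a \<subseteq> S \<Longrightarrow> Poly_Mapping.keys b \<subseteq> S \<Longrightarrow> Poly_Mapping.keys (a - b) \<subseteq> S"
  using keys_diff[of a b] by blast

subsection \<open>The bar boundary by recursion on words\<close>

definition bar_lists :: "nat \<Rightarrow> ('a, 'm) monoid_scheme \<Rightarrow> 'a list set"
  where "bar_lists n G = {xs. length xs = n \<and> set xs \<subseteq> carrier G}"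

text \<open>The value on \<open>[]\<close> makes the last face, which drops the last letter, an
  instance of the faces that merge two letters.\<close>

definition bar_act :: "('a, 'm) monoid_scheme \<Rightarrow> 'a \<Rightarrow> 'a list \<Rightarrow> 'a list"
  where "bar_act G x ys = (case ys of [] \<Rightarrow> [] | y # zs \<Rightarrow> (x \<otimes>\<^bsub>G\<^esub> y) # zs)"

lemma bar_act_simps [simp]:
  "bar_act G x [] = []"
  "bar_act G x (y # zs) = (x \<otimes>\<^bsub>G\<^esub> y) # zs"
  by (simp_all add: bar_act_def)

text \<open>The alternating sum of all faces but the zeroth one, which drops the first letter.\<close>

primrec bar_inner :: "('a, 'm) monoid_scheme \<Rightarrow> 'a list \<Rightarrow> ('a list \<Rightarrow>\<^sub>0 int)" where
  "bar_inner G [] = 0"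
| "bar_inner G (x # ys) = - frag_of (bar_act G x ys) - frag_map (Cons x) (bar_inner G ys)"

text \<open>The zeroth face. The value 0 on \<open>[]\<close>, together with
  \<open>bar_inner G [] = 0\<close>, makes the boundary vanish in degree 0.\<close>

definition bar_drop :: "'a list \<Rightarrow> ('a list \<Rightarrow>\<^sub>0 int)"
  where "bar_drop xs = (case xs of [] \<Rightarrow> 0 | x # ys \<Rightarrow> frag_of ys)"

lemma bar_drop_simps [simp]: "bar_drop [] = 0" "bar_drop (x # ys) = frag_of ys"
  by (simp_all add: bar_drop_def)

text \<open>The degree is read off from the length of each word, so a single linear map serves all
  degrees and inductions may shorten words.\<close>

definition bar_diff :: "('a, 'm) monoid_scheme \<Rightarrow> ('a list \<Rightarrow>\<^sub>0 int) \<Rightarrow> ('a list \<Rightarrow>\<^sub>0 int)"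
  where "bar_diff G = frag_extend (\<lambda>xs. bar_drop xs + bar_inner G xs)"

lemma bar_diff_of [simp]: "bar_diff G (frag_of xs) = bar_drop xs + bar_inner G xs"
  by (simp add: bar_diff_def)

lemma bar_diff_0 [simp]: "bar_diff G 0 = 0"
  by (simp add: bar_diff_def)

lemma bar_diff_add: "bar_diff G (a + b) = bar_diff G a + bar_diff G b"
  and bar_diff_diff: "bar_diff G (a - b) = bar_diff G a - bar_diff G b"
  and bar_diff_minus: "bar_diff G (- a) = - bar_diff G a"
  by (simp_all add: bar_diff_def frag_linear)

lemma bar_face_Cons: "i < length ys \<Longrightarrow> bar_face G (Suc (Suc i)) (x # ys) = x # bar_face G (Suc i) ys"
  by (auto simp: bar_face_def)

lemma bar_inner_eq_sum:
  "(\<Sum>i<length xs. frag_cmul ((-1) ^ Suc i) (frag_of (bar_face G (Suc i) xs))) = bar_inner G xs"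
proof (induction xs)
  case (Cons x ys)
  have face1: "bar_face G (Suc 0) (x # ys) = bar_act G x ys"
    by (cases ys) (auto simp: bar_face_def)
  have "(\<Sum>i<length ys. frag_cmul ((-1) ^ Suc (Suc i)) (frag_of (bar_face G (Suc (Suc i)) (x # ys))))
      = (\<Sum>i<length ys. - frag_map (Cons x) (frag_cmul ((-1) ^ Suc i) (frag_of (bar_face G (Suc i) ys))))"
    by (intro sum.cong refl) (simp add: bar_face_Cons frag_map_cmul)
  also have "\<dots> = - frag_map (Cons x) (bar_inner G ys)"
    unfolding Cons.IH[symmetric] by (simp add: frag_map_def frag_extend_sum sum_negf comp_def)
  finally show ?case
    by (simp del: power_Suc sum.lessThan_Suc add: sum.lessThan_Suc_shift face1)
qed simp

lemma bar_boundary_eq_bar_diff: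
  assumes "Poly_Mapping.keys c \<subseteq> bar_lists n G"
  shows "bar_boundary n G c = bar_diff G c"
proof (cases n)
  case 0
  have "bar_diff G c = 0" unfolding bar_diff_def
    by (rule frag_extend_eq_0) (use assms 0 in \<open>auto simp: bar_lists_def\<close>)
  then show ?thesis by (simp add: bar_boundary_def 0)
next
  case (Suc m)
  have "(\<Sum>i\<le>n. frag_cmul ((-1) ^ i) (frag_of (bar_face G i xs))) = bar_drop xs + bar_inner G xs"
    if "xs \<in> Poly_Mapping.keys c" for xs
  proof -
    have n: "length xs = n" using that assms by (auto simp: bar_lists_def)
    have "bar_face G 0 xs = tl xs" by (simp add: bar_face_def)
    then show ?thesis using n Suc
      unfolding sum.atMost_shift bar_inner_eq_sum[symmetric]
      by (cases xs) simp_all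
  qed
  then show ?thesis unfolding bar_boundary_def bar_diff_def using Suc
    by (simp cong: frag_extend_eq)
qed

lemma keys_bar_inner:
  assumes "monoid G" "set xs \<subseteq> carrier G"
  shows "Poly_Mapping.keys (bar_inner G xs) \<subseteq> {ys. Suc (length ys) = length xs \<and> set ys \<subseteq> carrier G}"
  using assms(2)
proof (induction xs)
  case (Cons x ys)
  have "Suc (length (bar_act G x ys)) = length (x # ys) \<and> set (bar_act G x ys) \<subseteq> carrier G"
    if "ys \<noteq> []" using that Cons.prems monoid.m_closed[OF assms(1)] by (cases ys) auto
  moreover have "Poly_Mapping.keys (frag_map (Cons x) (bar_inner G ys))
      \<subseteq> {zs. Suc (length zs) = length (x # ys) \<and> set zs \<subseteq> carrier G}"
    using keys_frag_map[of "Cons x" "bar_inner G ys"] Cons by fastforce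
  ultimately show ?case
    unfolding bar_inner.simps by (intro keys_diff_subset) (cases ys; auto)+
qed simp

lemma keys_bar_diff:
  assumes "monoid G" "Poly_Mapping.keys c \<subseteq> bar_lists (Suc n) G"
  shows "Poly_Mapping.keys (bar_diff G c) \<subseteq> bar_lists n G"
  unfolding bar_diff_def
proof (intro keys_frag_extend_subset keys_add_subset)
  fix xs assume "xs \<in> Poly_Mapping.keys c"
  then have xs: "length xs = Suc n" "set xs \<subseteq> carrier G" using assms(2) by (auto simp: bar_lists_def)
  then show "Poly_Mapping.keys (bar_drop xs) \<subseteq> bar_lists n G"
    by (cases xs) (auto simp: bar_lists_def)
  show "Poly_Mapping.keys (bar_inner G xs) \<subseteq> bar_lists n G"
    using keys_bar_inner[OF assms(1) xs(2)] xs(1) by (auto simp: bar_lists_def)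
qed

text \<open>By associativity, multiplying the first letter from the left commutes with every face
  that keeps or merges that letter.\<close>

lemma (in monoid) bar_inner_bar_act:
  assumes "x \<in> carrier G" "set ys \<subseteq> carrier G"
  shows "bar_inner G (bar_act G x ys) = frag_map (bar_act G x) (bar_inner G ys)"
proof (cases ys)
  case (Cons y zs)
  with assms have "bar_act G x (bar_act G y zs) = bar_act G (x \<otimes> y) zs"
    by (cases zs) (auto simp: m_assoc)
  then show ?thesis using Cons
    by (simp add: frag_linear frag_map_frag_map)
qed simp

text \<open>The terms in which \<open>x\<close> is absorbed by the next letter arise twice with
  opposite signs, once through \<open>bar_act\<close> and once through prefixing \<open>x\<close>;
  the rest is \<open>x\<close> prefixed to the induction hypothesis.\<close>

lemma (in monoid) bar_inner_bar_inner:
  "set xs \<subseteq> carrier G \<Longrightarrow> frag_extend (bar_inner G) (bar_inner G xs) = 0"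
proof (induction xs)
  case (Cons x ys)
  then show ?case
    by (simp add: frag_linear frag_extend_frag_map bar_inner_bar_act frag_extend_fun_diff
        frag_extend_fun_minus frag_map_frag_extend[symmetric] frag_map_def[symmetric])
qed simp

text \<open>For a word \<open>x # ys\<close>, the zeroth face taken first contributes
  \<open>bar_drop ys + bar_inner G ys\<close>, taken second the negative of it. The inner part
  squares to zero by itself.\<close>

lemma (in monoid) bar_diff_bar_diff:
  assumes "Poly_Mapping.keys c \<subseteq> {xs. set xs \<subseteq> carrier G}"
  shows "bar_diff G (bar_diff G c) = 0"
proof -
  have drop_act: "bar_drop (bar_act G x ys) = bar_drop ys" for x ys
    by (cases ys) auto
  have "bar_diff G (bar_drop xs + bar_inner G xs) = 0" if "set xs \<subseteq> carrier G" for xs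
  proof (cases xs)
    case (Cons x ys)
    have "frag_extend bar_drop (bar_inner G xs) = - bar_drop ys - bar_inner G ys"
      using Cons by (simp add: frag_linear frag_extend_frag_map drop_act flip: frag_expansion)
    then show ?thesis using bar_inner_bar_inner[OF that] Cons
      by (simp add: bar_diff_def frag_extend_fun_add frag_linear del: bar_inner.simps)
  qed simp
  then show ?thesis unfolding bar_diff_def[of G] frag_extend_frag_extend
    by (rule frag_extend_eq_0) (use assms in \<open>auto simp: bar_diff_def\<close>)
qed

lemma bar_inner_map:
  assumes "f \<in> hom G H" "set xs \<subseteq> carrier G"
  shows "bar_inner H (map f xs) = frag_map (map f) (bar_inner G xs)"
  using assms(2)
proof (induction xs)
  case (Cons x ys)
  have "bar_act H (f x) (map f ys) = map f (bar_act G x ys)"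
    using Cons.prems assms(1) by (cases ys) (auto simp: hom_def)
  with Cons show ?case by (simp add: frag_linear frag_map_frag_map)
qed simp

lemma bar_diff_bar_map:
  assumes "f \<in> hom G H" "Poly_Mapping.keys c \<subseteq> {xs. set xs \<subseteq> carrier G}"
  shows "bar_diff H (bar_map f c) = bar_map f (bar_diff G c)"
proof -
  have "bar_drop (map f xs) = frag_map (map f) (bar_drop xs)" for xs
    by (cases xs) auto
  then show ?thesis
    unfolding bar_map_eq bar_diff_def frag_extend_frag_map frag_map_frag_extend
    by (intro frag_extend_eq) (use assms in \<open>auto simp: bar_inner_map frag_linear\<close>)
qed

lemma keys_bar_map:
  assumes "f ` carrier G \<subseteq> carrier H" "Poly_Mapping.keys c \<subseteq> bar_lists n G"
  shows "Poly_Mapping.keys (bar_map f c) \<subseteq> bar_lists n H"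
  unfolding bar_map_eq using keys_frag_map[of "map f" c] assms by (fastforce simp: bar_lists_def)

subsection \<open>Splitting off an infinite cyclic factor\<close>

text \<open>The discrete antiderivative of \<open>f\<close> that vanishes at 0. The sign for
  negative \<open>m\<close> is the one for which the powers of \<open>t\<close> sum to
  \<open>(t^m - 1)/(t - 1)\<close> for every integer \<open>m\<close>.\<close>

definition int_sum :: "(int \<Rightarrow> 'b::ab_group_add) \<Rightarrow> int \<Rightarrow> 'b"
  where "int_sum f m = (if 0 \<le> m then \<Sum>j\<in>{0..<m}. f j else - (\<Sum>j\<in>{m..<0}. f j))"

lemma int_sum_0 [simp]: "int_sum f 0 = 0"
  by (simp add: int_sum_def)

lemma int_sum_step: "int_sum f (m + 1) = int_sum f m + f m"
proof -
  consider "0 \<le> m" | "m = -1" | "m < -1" by linarith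
  then show ?thesis
  proof cases
    case 1
    then have "{0..<m + 1} = insert m {0..<m}" by auto
    then show ?thesis using 1 by (simp add: int_sum_def)
  next
    case 2
    then have "{m..<0} = {-1}" by auto
    then show ?thesis using 2 by (simp add: int_sum_def)
  next
    case 3
    then have "{m..<0} = insert m {m + 1..<0}" by auto
    then show ?thesis using 3 by (simp add: int_sum_def)
  qed
qed

text \<open>Induction from 0 in both directions. The identities for \<open>int_sum\<close> below are
  obtained from this uniqueness, without a case distinction on the sign.\<close>

lemma int_sum_unique:
  assumes "g 0 = 0" "\<And>m. g (m + 1) = g m + f m"
  shows "int_sum f m = g m"
proof (induction m rule: int_induct[of _ 0])
  case (step2 i)
  have "int_sum f i = int_sum f (i - 1) + f (i - 1)" "g i = g (i - 1) + f (i - 1)"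
    using int_sum_step[of f "i - 1"] assms(2)[of "i - 1"] by simp_all
  with step2 show ?case by simp
qed (simp_all add: assms int_sum_step)

lemma int_sum_shift: "int_sum (\<lambda>j. f (j + b)) a = int_sum f (a + b) - int_sum f b"
proof (rule int_sum_unique)
  fix m show "int_sum f (m + 1 + b) - int_sum f b = int_sum f (m + b) - int_sum f b + f (m + b)"
    using int_sum_step[of f "m + b"] by (simp add: algebra_simps)
qed simp

lemma int_sum_fun_add: "int_sum (\<lambda>j. f j + g j) a = int_sum f a + int_sum g a"
  by (rule int_sum_unique) (simp_all add: int_sum_step)

lemma frag_extend_int_sum: "frag_extend h (int_sum f m) = int_sum (\<lambda>j. frag_extend h (f j)) m"
  by (rule sym, rule int_sum_unique) (simp_all add: int_sum_step frag_linear)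

text \<open>
  Here \<open>\<phi>\<close> is the coordinate of the cyclic factor, \<open>\<pi>\<close> the projection to the complement and
  \<open>\<tau> m\<close> the \<open>m\<close>-th power of a generator of the cyclic factor.
\<close>

locale cyclic_splitting = group G for G :: "('a, 'm) monoid_scheme" (structure) +
  fixes \<phi> :: "'a \<Rightarrow> int" and \<pi> :: "'a \<Rightarrow> 'a" and \<tau> :: "int \<Rightarrow> 'a"
  assumes \<phi>_mult: "\<lbrakk>x \<in> carrier G; y \<in> carrier G\<rbrakk> \<Longrightarrow> \<phi> (x \<otimes> y) = \<phi> x + \<phi> y"
    and \<pi>_hom: "\<pi> \<in> hom G G"
    and \<phi>_\<pi>: "x \<in> carrier G \<Longrightarrow> \<phi> (\<pi> x) = 0"
    and \<pi>_\<pi>: "x \<in> carrier G \<Longrightarrow> \<pi> (\<pi> x) = \<pi> x"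
    and \<tau>_closed: "\<tau> m \<in> carrier G"
    and \<phi>_\<tau>: "\<phi> (\<tau> m) = m"
    and \<tau>_mult: "x \<in> carrier G \<Longrightarrow> \<tau> m \<otimes> x = \<pi> x \<otimes> \<tau> (m + \<phi> x)"
begin

lemma \<pi>_closed: "x \<in> carrier G \<Longrightarrow> \<pi> x \<in> carrier G"
  using \<pi>_hom by (auto simp: hom_def)

text \<open>
  The free abelian group on the pairs \<open>(m, [x\<^sub>1|\<dots>|x\<^sub>n])\<close> is the degree \<open>n\<close> part of the coinvariants of
  the bar resolution of \<open>G\<close> under the complement of the cyclic factor; the pair stands for the orbit of
  the simplex with vertices \<open>\<tau> m, \<tau> m x\<^sub>1, \<tau> m x\<^sub>1 x\<^sub>2, \<dots>\<close>.
\<close>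

definition cover_face :: "int \<Rightarrow> 'a list \<Rightarrow> (int \<times> 'a list \<Rightarrow>\<^sub>0 int)"
  where "cover_face m xs = (case xs of [] \<Rightarrow> 0 | x # ys \<Rightarrow> frag_of (m + \<phi> x, ys))"

lemma cover_face_simps [simp]:
  "cover_face m [] = 0" "cover_face m (x # ys) = frag_of (m + \<phi> x, ys)"
  by (simp_all add: cover_face_def)

text \<open>The zeroth face alone moves the base vertex, from \<open>\<tau> m\<close> to
  \<open>\<tau> m \<otimes> x\<close>; all other faces keep the level \<open>m\<close>.\<close>

definition cover_diff :: "(int \<times> 'a list \<Rightarrow>\<^sub>0 int) \<Rightarrow> (int \<times> 'a list \<Rightarrow>\<^sub>0 int)"
  where "cover_diff = frag_extend (\<lambda>(m, xs). cover_face m xs + frag_map (Pair m) (bar_inner G xs))"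

text \<open>The prism between a simplex and its projection to the complement: the alternating sum of
  the words \<open>[\<pi> x1|...|\<pi> xk|\<tau> l|x(k+1)|...|xn]\<close> with
  \<open>l = m + \<phi> x1 + ... + \<phi> xk\<close>. Such a path starts in the complement and jumps
  once to the given simplex.\<close>

fun prism :: "int \<Rightarrow> 'a list \<Rightarrow> ('a list \<Rightarrow>\<^sub>0 int)" where
  "prism m [] = frag_of [\<tau> m]"
| "prism m (x # xs) = frag_of (\<tau> m # x # xs) - frag_map (Cons (\<pi> x)) (prism (m + \<phi> x) xs)"

definition cover_prism :: "(int \<times> 'a list \<Rightarrow>\<^sub>0 int) \<Rightarrow> ('a list \<Rightarrow>\<^sub>0 int)"
  where "cover_prism = frag_extend (\<lambda>(m, xs). prism m xs)"

lemma keys_prism: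
  "set xs \<subseteq> carrier G \<Longrightarrow> Poly_Mapping.keys (prism m xs) \<subseteq> bar_lists (Suc (length xs)) G"
proof (induction xs arbitrary: m)
  case (Cons x xs)
  have "Poly_Mapping.keys (frag_map (Cons (\<pi> x)) (prism (m + \<phi> x) xs)) \<subseteq> bar_lists (Suc (length (x # xs))) G"
    using keys_frag_map[of "Cons (\<pi> x)" "prism (m + \<phi> x) xs"] Cons \<pi>_closed
    by (fastforce simp: bar_lists_def)
  then show ?case using Cons.prems \<tau>_closed unfolding prism.simps
    by (intro keys_diff_subset) (auto simp: bar_lists_def)
qed (auto simp: bar_lists_def \<tau>_closed)

text \<open>Neighbouring terms of the prism share the face that merges the jump with a letter,
  because \<open>\<tau> m \<otimes> x = \<pi> x \<otimes> \<tau> (m + \<phi> x)\<close>, and these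
  faces cancel. The word \<open>map \<pi> xs\<close> is the last face of the last term, which drops
  the jump.\<close>

lemma bar_inner_prism:
  assumes "set xs \<subseteq> carrier G"
  shows "frag_extend (bar_inner G) (prism m xs) = - frag_of (map \<pi> xs) - frag_extend (prism m) (bar_inner G xs)"
  using assms
proof (induction xs arbitrary: m)
  case (Cons x xs)
  let ?k = "prism (m + \<phi> x) xs"
  have x: "x \<in> carrier G" using Cons.prems by simp
  have IH: "frag_extend (bar_inner G) ?k = - frag_of (map \<pi> xs) - frag_extend (prism (m + \<phi> x)) (bar_inner G xs)"
    using Cons by simp
  have eq: "frag_map (bar_act G (\<pi> x)) ?k
    = frag_of ((\<tau> m \<otimes> x) # xs) - frag_of (\<tau> m # bar_act G x xs) + prism m (bar_act G x xs)"
  proof (cases xs)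
    case Nil
    then show ?thesis using \<tau>_mult[OF x, of m] by simp
  next
    case (Cons y zs)
    then have y: "y \<in> carrier G" using Cons.prems by simp
    have "\<pi> (x \<otimes> y) = \<pi> x \<otimes> \<pi> y" using \<pi>_hom x y by (auto simp: hom_def)
    then show ?thesis using Cons x y
      by (simp add: frag_linear frag_map_frag_map \<tau>_mult[OF x] \<phi>_mult add.assoc)
  qed
  have "frag_extend (prism m) (frag_map (Cons x) (bar_inner G xs))
     = frag_map (Cons (\<tau> m)) (frag_map (Cons x) (bar_inner G xs))
       - frag_map (Cons (\<pi> x)) (frag_extend (prism (m + \<phi> x)) (bar_inner G xs))"
    by (simp add: frag_extend_frag_map frag_map_frag_map frag_extend_fun_diff frag_map_frag_extend frag_map_def
        frag_extend_frag_extend)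
  then have R: "frag_extend (prism m) (bar_inner G (x # xs)) = - prism m (bar_act G x xs)
      - frag_map (Cons (\<tau> m)) (frag_map (Cons x) (bar_inner G xs))
      + frag_map (Cons (\<pi> x)) (frag_extend (prism (m + \<phi> x)) (bar_inner G xs))"
    by (simp add: frag_linear)
  have "frag_extend (bar_inner G) (frag_map (Cons (\<pi> x)) ?k)
      = - frag_map (bar_act G (\<pi> x)) ?k - frag_map (Cons (\<pi> x)) (frag_extend (bar_inner G) ?k)"
    by (simp add: frag_extend_frag_map frag_extend_fun_diff frag_extend_fun_minus frag_map_frag_extend frag_map_def
        frag_extend_frag_extend)
  then have L: "frag_extend (bar_inner G) (prism m (x # xs))
    = - frag_of ((\<tau> m \<otimes> x) # xs)
      + frag_of (\<tau> m # bar_act G x xs) + frag_map (Cons (\<tau> m)) (frag_map (Cons x) (bar_inner G xs))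
      + frag_map (bar_act G (\<pi> x)) ?k + frag_map (Cons (\<pi> x)) (frag_extend (bar_inner G) ?k)"
    by (simp add: frag_linear algebra_simps)
  show ?case unfolding L R IH eq by (simp add: frag_linear algebra_simps)
qed simp

text \<open>A chain homotopy on the cover between the identity and the projection to words over the
  complement at level 0.\<close>

lemma cover_diff_prism:
  assumes "set xs \<subseteq> carrier G"
  shows "cover_diff (frag_map (Pair 0) (prism m xs)) = frag_of (m, xs) - frag_of (0, map \<pi> xs)
     - frag_map (Pair 0) (cover_prism (cover_diff (frag_of (m, xs))))"
proof -
  have split: "cover_diff (frag_map (Pair 0) c)
      = frag_extend (cover_face 0) c + frag_map (Pair 0) (frag_extend (bar_inner G) c)" for c
    by (simp add: cover_diff_def frag_extend_frag_map frag_extend_fun_add frag_map_frag_extend)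
  have inner: "cover_prism (frag_map (Pair m) c) = frag_extend (prism m) c" for c
    by (simp add: cover_prism_def frag_extend_frag_map)
  \<comment> \<open>Dropping the letter \<open>\<tau> m\<close> moves level 0 to level
    \<open>m\<close> and returns the original simplex. Every other word of the prism starts with
    some \<open>\<pi> x\<close>, which has coordinate 0, so dropping it leaves the level at
    0.\<close>
  have "frag_extend (cover_face 0) (prism m xs)
      = frag_of (m, xs) - frag_map (Pair 0) (cover_prism (cover_face m xs))"
  proof (cases xs)
    case Nil
    then show ?thesis by (simp add: cover_prism_def \<phi>_\<tau>)
  next
    case (Cons x ys)
    then have "frag_extend (\<lambda>zs. cover_face 0 (\<pi> x # zs)) c = frag_map (Pair 0) c" for c
      using assms by (simp add: frag_map_def \<phi>_\<pi>)
    then show ?thesis using Cons by (simp add: frag_linear frag_extend_frag_map \<phi>_\<tau> cover_prism_def)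
  qed
  moreover have "cover_prism (cover_diff (frag_of (m, xs)))
      = cover_prism (cover_face m xs) + frag_extend (prism m) (bar_inner G xs)"
    by (simp add: cover_diff_def cover_prism_def frag_linear frag_extend_frag_map)
  ultimately show ?thesis
    unfolding split bar_inner_prism[OF assms] by (simp add: frag_linear)
qed

lemma cover_diff_cover_prism:
  assumes "Poly_Mapping.keys d \<subseteq> UNIV \<times> {xs. set xs \<subseteq> carrier G}"
  shows "cover_diff (frag_map (Pair 0) (cover_prism d))
    = d - frag_map (\<lambda>(m, xs). (0, map \<pi> xs)) d - frag_map (Pair 0) (cover_prism (cover_diff d))"
  using assms
proof (induction d rule: frag_induction)
  case (one x)
  then show ?case using cover_diff_prism by (cases x) (auto simp: cover_prism_def)
next
  case (diff a b)
  then show ?case by (simp add: cover_prism_def cover_diff_def frag_linear)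
qed (simp_all add: cover_prism_def cover_diff_def)

lemma bar_diff_snd: "bar_diff G (frag_map snd d) = frag_map snd (cover_diff d)"
proof -
  have "bar_drop xs = frag_map snd (cover_face m xs)" for m xs by (cases xs) auto
  then show ?thesis
    by (simp add: bar_diff_def cover_diff_def frag_extend_frag_map frag_map_frag_extend case_prod_unfold
        frag_linear frag_map_frag_map frag_map_ident)
qed

lemma bar_diff_cover_prism:
  assumes "Poly_Mapping.keys d \<subseteq> UNIV \<times> {xs. set xs \<subseteq> carrier G}"
  shows "bar_diff G (cover_prism d)
    = frag_map snd d - frag_map (\<lambda>(m, xs). map \<pi> xs) d - cover_prism (cover_diff d)"
  using arg_cong[OF cover_diff_cover_prism[OF assms], of "frag_map snd"] bar_diff_snd[of "frag_map (Pair 0) (cover_prism d)"]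
  by (simp add: frag_linear frag_map_frag_map frag_map_ident case_prod_unfold)

section \<open>The shift of the cyclic cover and the connecting map\<close>

definition cover_shift :: "(int \<times> 'a list \<Rightarrow>\<^sub>0 int) \<Rightarrow> (int \<times> 'a list \<Rightarrow>\<^sub>0 int)"
  where "cover_shift = frag_map (\<lambda>(m, xs). (m + 1, xs))"

lemma cover_diff_shift: "cover_diff (cover_shift d) = cover_shift (cover_diff d)"
proof -
  have "cover_face (m + 1) xs = cover_shift (cover_face m xs)" for m xs
    by (cases xs) (auto simp: cover_shift_def algebra_simps)
  then show ?thesis
    unfolding cover_diff_def cover_shift_def frag_extend_frag_map frag_map_frag_extend
    by (intro frag_extend_eq) (auto simp: frag_linear frag_map_frag_map cover_shift_def)
qed

text \<open>Once the level is forgotten, both ends of the prism homotopy are invariant under the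
  shift \<open>t\<close>. They cancel in the difference, so the prism after \<open>t - 1\<close>
  commutes with the boundaries up to sign.\<close>

lemma bar_diff_prism_shift:
  assumes "Poly_Mapping.keys d \<subseteq> UNIV \<times> {xs. set xs \<subseteq> carrier G}"
  shows "bar_diff G (cover_prism (cover_shift d - d)) = - cover_prism (cover_shift (cover_diff d) - cover_diff d)"
proof -
  have "Poly_Mapping.keys (cover_shift d) \<subseteq> UNIV \<times> {xs. set xs \<subseteq> carrier G}"
    unfolding cover_shift_def
    by (rule order_trans[OF keys_frag_map]) (use assms in auto)
  then have "bar_diff G (cover_prism (cover_shift d)) - bar_diff G (cover_prism d)
      = - (cover_prism (cover_shift (cover_diff d)) - cover_prism (cover_diff d))"
    using assms by (simp add: bar_diff_cover_prism cover_diff_shift)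
      (simp add: cover_shift_def frag_map_frag_map case_prod_unfold)
  then show ?thesis by (simp add: cover_prism_def frag_linear bar_diff_diff)
qed

text \<open>
  On the chain level the connecting map of the Wang sequence is
  \<open>[x|y\<^sub>1|\<dots>|y\<^sub>n] \<mapsto> (1 + t + \<dots> + t\<^bsup>\<phi> x - 1\<^esup>) [y\<^sub>1|\<dots>|y\<^sub>n]\<close>, where \<open>t\<close> is the shift of the first component.
\<close>

definition wang :: "'a list \<Rightarrow> (int \<times> 'a list \<Rightarrow>\<^sub>0 int)"
  where "wang xs = (case xs of [] \<Rightarrow> 0 | x # ys \<Rightarrow> int_sum (\<lambda>j. frag_of (j, ys)) (\<phi> x))"

lemma wang_simps [simp]: "wang [] = 0" "wang (x # ys) = int_sum (\<lambda>j. frag_of (j, ys)) (\<phi> x)"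
  by (simp_all add: wang_def)

lemma frag_extend_int_sum_Pair:
  "frag_extend (\<lambda>ys. int_sum (\<lambda>j. frag_of (j, ys)) m) c = int_sum (\<lambda>j. frag_map (Pair j) c) m"
  by (rule sym, rule int_sum_unique)
     (simp_all add: int_sum_step frag_extend_fun_add frag_map_def frag_extend_eq_0)

text \<open>With \<open>s a = 1 + ... + t^(a-1)\<close>, the cocycle identity
  \<open>s (a + b) = s b + t^b * s a\<close> handles the zeroth face and the merging of the first
  two letters; the remaining faces do not touch the level.\<close>

lemma cover_diff_wang:
  assumes "set xs \<subseteq> carrier G"
  shows "cover_diff (wang xs) = - frag_extend wang (bar_diff G (frag_of xs))"
proof (cases xs)
  case (Cons x ys)
  have "int_sum (\<lambda>j. cover_face j ys) (\<phi> x) = wang (bar_act G x ys) - wang ys"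
  proof (cases ys)
    case Nil
    have "int_sum (\<lambda>j. 0::(int \<times> 'a list) \<Rightarrow>\<^sub>0 int) (\<phi> x) = 0" by (rule int_sum_unique) auto
    then show ?thesis using Nil by simp
  next
    case (Cons y zs)
    then show ?thesis
      using assms \<open>xs = x # ys\<close> int_sum_shift[of "\<lambda>j. frag_of (j, zs)" "\<phi> y" "\<phi> x"]
      by (simp add: \<phi>_mult)
  qed
  moreover have "cover_diff (wang xs) = int_sum (\<lambda>j. cover_face j ys) (\<phi> x)
      + int_sum (\<lambda>j. frag_map (Pair j) (bar_inner G ys)) (\<phi> x)"
    using Cons by (simp add: cover_diff_def frag_extend_int_sum int_sum_fun_add)
  ultimately show ?thesis using Cons
    by (simp add: frag_linear frag_extend_frag_map frag_extend_int_sum_Pair)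
qed (simp add: cover_diff_def)

text \<open>The cap product with the one-cocycle \<open>\<phi>\<close>, evaluated on the first
  letter.\<close>

definition cap :: "('a list \<Rightarrow>\<^sub>0 int) \<Rightarrow> ('a list \<Rightarrow>\<^sub>0 int)"
  where "cap = frag_extend (\<lambda>xs. case xs of [] \<Rightarrow> 0 | x # ys \<Rightarrow> frag_cmul (\<phi> x) (frag_of ys))"

text \<open>A geometric sum has \<open>\<phi> x\<close> terms, counted with sign, and all of them
  have the same projection.\<close>

lemma wang_project:
  "frag_map (\<lambda>(m, xs). map \<pi> xs) (frag_extend wang c) = bar_map \<pi> (cap c)"
proof -
  have *: "frag_map (\<lambda>(m, xs). map \<pi> xs) (int_sum (\<lambda>j. frag_of (j, ys)) m) = frag_cmul m (frag_of (map \<pi> ys))"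
    for ys m
    unfolding frag_map_def frag_extend_int_sum
    by (rule int_sum_unique) (auto simp: frag_cmul_distrib)
  show ?thesis
    unfolding frag_map_frag_extend cap_def bar_map_eq
    by (intro frag_extend_eq) (auto split: list.split simp: * frag_linear)
qed

text \<open>This is \<open>(t - 1) * (1 + ... + t^(m-1)) = t^m - 1\<close> with
  \<open>m = \<phi> x\<close>, seen through the prism.\<close>

lemma wang_telescope:
  "cover_prism (cover_shift (wang xs) - wang xs) = cover_prism (cover_face 0 xs) - frag_extend (prism 0) (bar_drop xs)"
proof (cases xs)
  case (Cons x ys)
  have "cover_shift (int_sum (\<lambda>j. frag_of (j, ys)) m) - int_sum (\<lambda>j. frag_of (j, ys)) m
      = frag_of (m, ys) - frag_of (0, ys)" for m
  proof -
    have "cover_shift (int_sum (\<lambda>j. frag_of (j, ys)) m) = int_sum (\<lambda>j. frag_of (j + 1, ys)) m"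
      by (simp add: cover_shift_def frag_map_def frag_extend_int_sum)
    also have "\<dots> = int_sum (\<lambda>j. frag_of (j, ys)) (m + 1) - int_sum (\<lambda>j. frag_of (j, ys)) 1"
      using int_sum_shift[of "\<lambda>j. frag_of (j, ys)" 1 m] by simp
    finally show ?thesis
      using int_sum_step[of "\<lambda>j. frag_of (j, ys)" m] int_sum_step[of "\<lambda>j. frag_of (j, ys)" 0] by simp
  qed
  then show ?thesis using Cons by (simp add: cover_prism_def frag_linear)
qed (simp add: cover_prism_def cover_shift_def)

lemma keys_wang:
  assumes "Poly_Mapping.keys c \<subseteq> bar_lists (Suc n) G"
  shows "Poly_Mapping.keys (frag_extend wang c) \<subseteq> UNIV \<times> bar_lists n G"
proof (rule keys_frag_extend_subset)
  fix xs assume "xs \<in> Poly_Mapping.keys c"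
  then have xs: "xs \<in> bar_lists (Suc n) G" using assms by auto
  then obtain x ys where [simp]: "xs = x # ys" by (cases xs) (auto simp: bar_lists_def)
  have ys: "ys \<in> bar_lists n G" using xs by (auto simp: bar_lists_def)
  have "Poly_Mapping.keys (\<Sum>j\<in>J. frag_of (j, ys)) \<subseteq> UNIV \<times> bar_lists n G" for J :: "int set"
    by (rule order_trans[OF keys_sum]) (use ys in auto)
  then show "Poly_Mapping.keys (wang xs) \<subseteq> UNIV \<times> bar_lists n G"
    by (simp add: int_sum_def)
qed

lemma keys_cover_prism:
  assumes "Poly_Mapping.keys d \<subseteq> UNIV \<times> bar_lists n G"
  shows "Poly_Mapping.keys (cover_prism d) \<subseteq> bar_lists (Suc n) G"
  unfolding cover_prism_def
proof (rule keys_frag_extend_subset)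
  fix z assume "z \<in> Poly_Mapping.keys d"
  then show "Poly_Mapping.keys (case z of (m, xs) \<Rightarrow> prism m xs) \<subseteq> bar_lists (Suc n) G"
    using assms keys_prism by (fastforce simp: bar_lists_def)
qed

lemma cover_diff_wang_cycle:
  assumes "Poly_Mapping.keys c \<subseteq> bar_lists n G" "bar_diff G c = 0"
  shows "cover_diff (frag_extend wang c) = 0"
proof -
  have "cover_diff (frag_extend wang c) = - frag_extend wang (bar_diff G c)"
    using assms(1)
  proof (induction c rule: frag_induction)
    case (one xs)
    then show ?case using cover_diff_wang by (auto simp: bar_lists_def)
  next
    case (diff a b)
    then show ?case by (simp add: cover_diff_def frag_linear bar_diff_diff)
  qed (simp add: cover_diff_def)
  then show ?thesis using assms by simp
qed

text \<open>The projected cap is the projection of the cover chain of \<open>wang\<close>, which is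
  a cycle because \<open>c\<close> is one, and the projection commutes with the boundaries since
  \<open>\<pi>\<close> is a homomorphism.\<close>

lemma cycle_project_cap:
  assumes "Poly_Mapping.keys c \<subseteq> bar_lists n G" "bar_diff G c = 0"
  shows "bar_diff G (bar_map \<pi> (cap c)) = 0"
proof -
  have "bar_diff G (frag_map (\<lambda>(m, xs). map \<pi> xs) d) = frag_map (\<lambda>(m, xs). map \<pi> xs) (cover_diff d)"
    if "Poly_Mapping.keys d \<subseteq> UNIV \<times> bar_lists k G" for d k
    using that
  proof (induction d rule: frag_induction)
    case (one z)
    obtain m xs where z: "z = (m, xs)" "set xs \<subseteq> carrier G" using one by (auto simp: bar_lists_def)
    have "bar_drop (map \<pi> xs) = frag_map (\<lambda>(m, xs). map \<pi> xs) (cover_face m xs)" by (cases xs) auto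
    with z show ?case by (simp add: cover_diff_def bar_inner_map[OF \<pi>_hom] frag_linear frag_map_frag_map)
  next
    case (diff a b)
    then show ?case by (simp add: cover_diff_def frag_linear bar_diff_diff)
  qed (simp add: cover_diff_def)
  moreover obtain k where "Poly_Mapping.keys (frag_extend wang c) \<subseteq> UNIV \<times> bar_lists k G"
  proof (cases n)
    case 0
    then have "frag_extend wang c = 0"
      using assms(1) by (intro frag_extend_eq_0) (auto simp: bar_lists_def)
    then show ?thesis using that by simp
  next
    case (Suc k)
    then show ?thesis using that keys_wang assms(1) by blast
  qed
  ultimately show ?thesis using cover_diff_wang_cycle[OF assms] wang_project[of c] by (metis frag_map_0)
qed

text \<open>Lifted to level 0, the cycle \<open>c\<close> has cover boundary
  \<open>(t - 1) b\<close>, where \<open>b\<close> is its image under \<open>wang\<close>. The prism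
  over \<open>b\<close> deforms \<open>b\<close> to its projected cap, which bounds, so
  \<open>b\<close> is the boundary of some \<open>d\<close>. The prism over the lift of
  \<open>c\<close>, corrected by the prism over \<open>(t - 1) d\<close>, then joins
  \<open>c\<close> to its projection, which is bounded by \<open>w1\<close>.\<close>

theorem boundary_if_project_and_cap:
  assumes c: "Poly_Mapping.keys c \<subseteq> bar_lists (Suc n) G" "bar_diff G c = 0"
    and w1: "Poly_Mapping.keys w1 \<subseteq> bar_lists (Suc (Suc n)) G" "bar_map \<pi> c = bar_diff G w1"
    and w0: "Poly_Mapping.keys w0 \<subseteq> bar_lists (Suc n) G" "bar_map \<pi> (cap c) = bar_diff G w0"
  shows "\<exists>w. Poly_Mapping.keys w \<subseteq> bar_lists (Suc (Suc n)) G \<and> c = bar_diff G w"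
proof -
  define b where "b = frag_extend wang c"
  \<comment> \<open>The chain \<open>w0\<close> may leave the complement. Its projection stays
    there, so all its faces remain at level 0, and its boundary is still the projected cap since
    \<open>\<pi>\<close> is idempotent.\<close>
  define v where "v = bar_map \<pi> w0"
  \<comment> \<open>The filling \<open>v\<close> of the projected cap and the prism from there to
    \<open>b\<close> together bound \<open>b\<close>.\<close>
  define d where "d = frag_map (Pair (0::int)) v + frag_map (Pair 0) (cover_prism b)"
  have kb: "Poly_Mapping.keys b \<subseteq> UNIV \<times> bar_lists n G" unfolding b_def using c(1) by (rule keys_wang)
  then have kb': "Poly_Mapping.keys b \<subseteq> UNIV \<times> {xs. set xs \<subseteq> carrier G}" by (auto simp: bar_lists_def)
  have kv: "Poly_Mapping.keys v \<subseteq> bar_lists (Suc n) G" unfolding v_def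
    using \<pi>_hom w0(1) by (intro keys_bar_map) (auto simp: hom_def)
  have kd: "Poly_Mapping.keys d \<subseteq> UNIV \<times> bar_lists (Suc n) G" unfolding d_def
    using kv keys_cover_prism[OF kb]
    by (intro keys_add_subset order_trans[OF keys_frag_map]) auto
  then have kd': "Poly_Mapping.keys d \<subseteq> UNIV \<times> {xs. set xs \<subseteq> carrier G}" by (auto simp: bar_lists_def)
  have b0: "cover_diff b = 0" unfolding b_def using c by (rule cover_diff_wang_cycle)
  have v: "cover_diff (frag_map (Pair 0) v) = frag_map (Pair 0) (bar_diff G v)"
    using w0(1) unfolding v_def bar_map_eq
  proof (induction w0 rule: frag_induction)
    case (one xs)
    have "cover_face 0 (map \<pi> xs) = frag_map (Pair 0) (bar_drop (map \<pi> xs))"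
      using one \<phi>_\<pi> by (cases xs) (auto simp: bar_lists_def)
    then show ?case by (simp add: cover_diff_def frag_linear)
  next
    case (diff a b)
    then show ?case by (simp add: cover_diff_def frag_linear bar_diff_diff)
  qed (simp add: cover_diff_def)
  have kcap: "Poly_Mapping.keys (cap c) \<subseteq> {xs. set xs \<subseteq> carrier G}"
    unfolding cap_def
    by (rule keys_frag_extend_subset)
       (use c(1) in \<open>fastforce simp: bar_lists_def split: list.splits if_splits\<close>)
  have "bar_diff G v = bar_map \<pi> (bar_map \<pi> (cap c))" unfolding v_def w0(2)
    by (rule bar_diff_bar_map[OF \<pi>_hom]) (use w0(1) in \<open>auto simp: bar_lists_def\<close>)
  also have "\<dots> = bar_map \<pi> (cap c)" unfolding bar_map_eq frag_map_frag_map
    by (rule frag_map_cong) (use kcap \<pi>_\<pi> in auto)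
  finally have v': "bar_diff G v = bar_map \<pi> (cap c)" .
  have "cover_diff d = frag_map (Pair 0) (bar_map \<pi> (cap c))
     + (b - frag_map (\<lambda>(m, xs). (0, map \<pi> xs)) b - frag_map (Pair 0) (cover_prism (cover_diff b)))"
    unfolding d_def using cover_diff_cover_prism[OF kb'] v v' by (simp add: cover_diff_def frag_linear)
  also have "\<dots> = b"
  proof -
    have "frag_map (Pair 0) (bar_map \<pi> (cap c)) = frag_map (\<lambda>(m, xs). (0, map \<pi> xs)) b"
      unfolding b_def wang_project[symmetric] frag_map_frag_map by (simp add: case_prod_unfold)
    then show ?thesis using b0 by (simp add: cover_prism_def)
  qed
  finally have d: "cover_diff d = b" .
  have kp: "Poly_Mapping.keys (frag_map (Pair (0::int)) c) \<subseteq> UNIV \<times> bar_lists (Suc n) G"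
    by (rule order_trans[OF keys_frag_map]) (use c(1) in auto)
  have "cover_prism (cover_diff (frag_map (Pair 0) c)) - frag_extend (prism 0) (bar_diff G c)
      = cover_prism (cover_shift b - b)"
  proof -
    have "cover_prism (cover_shift b - b) = frag_extend (\<lambda>xs. cover_prism (cover_shift (wang xs) - wang xs)) c"
      unfolding b_def
      by (simp add: cover_prism_def cover_shift_def frag_linear frag_extend_fun_diff frag_map_frag_extend
          frag_extend_frag_extend)
    also have "\<dots> = frag_extend (\<lambda>xs. cover_prism (cover_face 0 xs)) c - frag_extend (prism 0) (frag_extend bar_drop c)"
      by (simp add: wang_telescope frag_extend_fun_diff frag_extend_frag_extend)
    finally show ?thesis
      by (simp add: cover_prism_def cover_diff_def bar_diff_def frag_linear frag_extend_frag_map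
          frag_extend_fun_add frag_extend_frag_extend)
  qed
  then have "cover_prism (cover_diff (frag_map (Pair 0) c)) = cover_prism (cover_shift b - b)"
    using c(2) by simp
  moreover have "bar_diff G (cover_prism (frag_map (Pair 0) c))
      = c - bar_map \<pi> c - cover_prism (cover_diff (frag_map (Pair 0) c))"
    using bar_diff_cover_prism[of "frag_map (Pair 0) c"] kp
    by (auto simp: frag_map_frag_map frag_map_ident bar_map_eq bar_lists_def)
  moreover have "bar_diff G (cover_prism (cover_shift d - d)) = - cover_prism (cover_shift b - b)"
    using bar_diff_prism_shift[OF kd'] d by simp
  ultimately have "c = bar_diff G (w1 + cover_prism (frag_map (Pair 0) c) - cover_prism (cover_shift d - d))"
    using w1(2) by (simp add: bar_diff_add bar_diff_diff)
  moreover have "Poly_Mapping.keys (cover_shift d) \<subseteq> UNIV \<times> bar_lists (Suc n) G"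
    unfolding cover_shift_def by (rule order_trans[OF keys_frag_map]) (use kd in auto)
  then have "Poly_Mapping.keys (w1 + cover_prism (frag_map (Pair 0) c) - cover_prism (cover_shift d - d))
      \<subseteq> bar_lists (Suc (Suc n)) G"
    using w1(1) kp kd by (intro keys_diff_subset keys_add_subset keys_cover_prism)
  ultimately show ?thesis by blast
qed

end

subsection \<open>Cup products of one-dimensional classes\<close>

definition frag_sum :: "('b \<Rightarrow> int) \<Rightarrow> ('b \<Rightarrow>\<^sub>0 int) \<Rightarrow> int"
  where "frag_sum w c = (\<Sum>x\<in>Poly_Mapping.keys c. Poly_Mapping.lookup c x * w x)"

text \<open>Rewriting the evaluation as a linear map into a free group of rank one transfers the
  linearity of \<open>frag_extend\<close>.\<close>

lemma frag_sum_eq_lookup: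
  "frag_sum w c = Poly_Mapping.lookup (frag_extend (\<lambda>x. frag_cmul (w x) (frag_of ())) c) ()"
  by (simp add: frag_sum_def frag_extend_def lookup_sum)

lemma frag_sum_0 [simp]: "frag_sum w 0 = 0"
  and frag_sum_of [simp]: "frag_sum w (frag_of x) = w x"
  and frag_sum_add: "frag_sum w (a + b) = frag_sum w a + frag_sum w b"
  and frag_sum_diff: "frag_sum w (a - b) = frag_sum w a - frag_sum w b"
  and frag_sum_minus: "frag_sum w (- a) = - frag_sum w a"
  and frag_sum_cmul: "frag_sum w (frag_cmul n a) = n * frag_sum w a"
  by (simp_all add: frag_sum_eq_lookup frag_linear lookup_add lookup_minus)

lemma frag_sum_frag_extend: "frag_sum w (frag_extend f c) = frag_sum (\<lambda>x. frag_sum w (f x)) c"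
  using subset_UNIV by (induction c rule: frag_induction) (auto simp: frag_linear frag_sum_diff)

lemma frag_sum_frag_map: "frag_sum w (frag_map f c) = frag_sum (\<lambda>x. w (f x)) c"
  by (simp add: frag_map_def frag_sum_frag_extend)

lemma frag_sum_cong: "(\<And>x. x \<in> Poly_Mapping.keys c \<Longrightarrow> v x = w x) \<Longrightarrow> frag_sum v c = frag_sum w c"
  by (simp add: frag_sum_def)

lemma frag_sum_scale: "frag_sum (\<lambda>x. a * w x) c = a * frag_sum w c"
  by (simp add: frag_sum_def sum_distrib_left algebra_simps)

primrec cup :: "('a \<Rightarrow> int) list \<Rightarrow> 'a list \<Rightarrow> int" where
  "cup [] xs = 1"
| "cup (f # fs) xs = (case xs of [] \<Rightarrow> 0 | y # ys \<Rightarrow> f y * cup fs ys)"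

definition additive_on :: "('a, 'm) monoid_scheme \<Rightarrow> ('a \<Rightarrow> int) \<Rightarrow> bool"
  where "additive_on G f \<longleftrightarrow> (\<forall>x\<in>carrier G. \<forall>y\<in>carrier G. f (x \<otimes>\<^bsub>G\<^esub> y) = f x + f y)"

text \<open>Additivity splits \<open>f (x \<otimes> y)\<close>; the part with \<open>f x\<close>
  cancels against the longer faces by induction, and the part with \<open>f y\<close> is the
  negative of the value on the zeroth face. Hence the cup product is a cocycle.\<close>

lemma cup_bar_inner:
  assumes "\<forall>f\<in>set fs. additive_on G f" "set (x # ys) \<subseteq> carrier G" "length ys = length fs"
  shows "frag_sum (cup fs) (bar_inner G (x # ys)) = - cup fs ys"
  using assms
proof (induction fs arbitrary: x ys)
  case Nil
  then show ?case by (simp add: frag_sum_diff frag_sum_minus)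
next
  case (Cons f fs)
  then obtain y zs where ys: "ys = y # zs" by (cases ys) auto
  have "frag_sum (cup fs) (bar_inner G (y # zs)) = - cup fs zs"
    using Cons.IH[of y zs] Cons.prems ys by simp
  moreover have "f (x \<otimes>\<^bsub>G\<^esub> y) = f x + f y"
    using Cons.prems ys by (simp add: additive_on_def)
  ultimately show ?case unfolding ys bar_inner.simps(2)[of G x "y # zs"]
    by (simp add: frag_sum_diff frag_sum_minus frag_sum_frag_map frag_sum_scale algebra_simps
        del: bar_inner.simps)
qed

lemma cup_bar_diff:
  assumes "\<forall>f\<in>set fs. additive_on G f" "Poly_Mapping.keys w \<subseteq> bar_lists (Suc (length fs)) G"
  shows "frag_sum (cup fs) (bar_diff G w) = 0"
  using assms(2)
proof (induction w rule: frag_induction)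
  case (one xs)
  then obtain x ys where xs: "xs = x # ys" "set (x # ys) \<subseteq> carrier G" "length ys = length fs"
    by (cases xs) (auto simp: bar_lists_def)
  then show ?case using cup_bar_inner[OF assms(1) xs(2,3)]
    by (simp add: frag_sum_add del: bar_inner.simps)
qed (simp_all add: bar_diff_diff frag_sum_diff)

section \<open>Detecting homology classes of free abelian groups of finite rank\<close>

lemma frag_eq_cmul: "Poly_Mapping.keys c \<subseteq> {x} \<Longrightarrow> c = frag_cmul (Poly_Mapping.lookup c x) (frag_of x)"
  by (rule poly_mapping_eqI) (auto simp: in_keys_iff)

lemma bar_inner_replicate:
  assumes "monoid G"
  shows "bar_inner G (replicate n \<one>\<^bsub>G\<^esub>) = (if odd n then - frag_of (replicate (n - 1) \<one>\<^bsub>G\<^esub>) else 0)"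
proof (induction n)
  case (Suc n)
  have "bar_act G \<one>\<^bsub>G\<^esub> (replicate n \<one>\<^bsub>G\<^esub>) = replicate n \<one>\<^bsub>G\<^esub>"
    using assms by (cases n) (auto simp: monoid.l_one monoid.one_closed)
  moreover have "\<one>\<^bsub>G\<^esub> # replicate (n - 1) \<one>\<^bsub>G\<^esub> = replicate n \<one>\<^bsub>G\<^esub>" if "odd n"
    using that by (cases n) auto
  ultimately show ?case using Suc by (simp add: frag_linear)
qed simp

text \<open>Each degree has a single word, and the boundary maps are alternately 0 and the identity:
  a cycle of even positive degree is 0, one of odd degree is the boundary of the same multiple of
  the next word.\<close>

lemma trivial_group_cycle_is_boundary:
  assumes "monoid G" "carrier G = {\<one>\<^bsub>G\<^esub>}" "Poly_Mapping.keys c \<subseteq> bar_lists (Suc n) G" "bar_diff G c = 0"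
  shows "\<exists>w. Poly_Mapping.keys w \<subseteq> bar_lists (Suc (Suc n)) G \<and> c = bar_diff G w"
proof -
  have L: "bar_lists k G = {replicate k \<one>\<^bsub>G\<^esub>}" for k
    unfolding bar_lists_def assms(2) by (auto intro: replicate_eqI)
  define a where "a = Poly_Mapping.lookup c (replicate (Suc n) \<one>\<^bsub>G\<^esub>)"
  have c: "c = frag_cmul a (frag_of (replicate (Suc n) \<one>\<^bsub>G\<^esub>))"
    unfolding a_def by (rule frag_eq_cmul) (use assms(3) L in simp)
  have diff: "bar_diff G (frag_cmul a (frag_of (replicate (Suc k) \<one>\<^bsub>G\<^esub>)))
      = frag_cmul a (if even (Suc k) then frag_of (replicate k \<one>\<^bsub>G\<^esub>) else 0)" for k
    using bar_inner_replicate[OF assms(1), of "Suc k"]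
    by (auto simp: bar_diff_def frag_linear simp del: bar_inner.simps)
  show ?thesis
  proof (cases "even (Suc n)")
    case True
    then have "c = 0" using assms(4) diff[of n] c by (auto split: if_splits)
    then show ?thesis by (intro exI[of _ 0]) simp
  next
    case False
    then have "c = bar_diff G (frag_cmul a (frag_of (replicate (Suc (Suc n)) \<one>\<^bsub>G\<^esub>)))"
      unfolding diff using c by simp
    moreover have "Poly_Mapping.keys (frag_cmul a (frag_of (replicate (Suc (Suc n)) \<one>\<^bsub>G\<^esub>)))
        \<subseteq> bar_lists (Suc (Suc n)) G"
      unfolding L by (rule order_trans[OF keys_cmul]) simp
    ultimately show ?thesis by blast
  qed
qed

lemma bar_diff_free_Abelian_group: "bar_diff (free_Abelian_group S) = bar_diff (free_Abelian_group T)"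
proof -
  have "bar_act (free_Abelian_group S) = bar_act (free_Abelian_group T)"
    by (intro ext) (simp add: bar_act_def split: list.split)
  then have "bar_inner (free_Abelian_group S) xs = bar_inner (free_Abelian_group T) xs" for xs
    by (induction xs) auto
  then show ?thesis by (simp add: bar_diff_def)
qed

lemma cup_map:
  assumes "\<And>f x. f \<in> set fs \<Longrightarrow> x \<in> set xs \<Longrightarrow> f (h x) = f x"
  shows "cup fs (map h xs) = cup fs xs"
  using assms by (induction fs arbitrary: xs) (auto split: list.split)

lemma free_Abelian_group_splitting:
  assumes "t \<notin> S"
  shows "cyclic_splitting (free_Abelian_group (insert t S)) (\<lambda>v. Poly_Mapping.lookup v t)
    (\<lambda>v. v - frag_cmul (Poly_Mapping.lookup v t) (frag_of t)) (\<lambda>m. frag_cmul m (frag_of t))"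
proof -
  have keys: "Poly_Mapping.keys (v - frag_cmul (Poly_Mapping.lookup v t) (frag_of t)) \<subseteq> insert t S"
    if "Poly_Mapping.keys v \<subseteq> insert t S" for v
    using that keys_cmul by (intro keys_diff_subset) fastforce+
  show ?thesis
    unfolding cyclic_splitting_def cyclic_splitting_axioms_def
    using keys
    by (auto simp: hom_def lookup_add lookup_minus frag_cmul_distrib in_keys_iff algebra_simps
        intro!: keys_diff_subset dest: subsetD[OF keys_add] split: if_splits)
qed

text \<open>The degree varies in the induction because the cap lowers it by one. Products of
  coordinates in \<open>S\<close> control the projection of \<open>c\<close>; products starting with
  the new coordinate \<open>t\<close> control the cap. Since \<open>ss\<close> ranges over all words
  in \<open>S\<close>, no order on the basis has to be chosen.\<close>

theorem free_Abelian_group_cycle_is_boundary: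
  assumes "finite S" "Poly_Mapping.keys c \<subseteq> bar_lists n (free_Abelian_group S)"
    "bar_diff (free_Abelian_group S) c = 0"
    "\<And>ss. length ss = n \<Longrightarrow> set ss \<subseteq> S \<Longrightarrow>
      frag_sum (cup (map (\<lambda>s v. Poly_Mapping.lookup v s) ss)) c = 0"
  shows "\<exists>w. Poly_Mapping.keys w \<subseteq> bar_lists (Suc n) (free_Abelian_group S)
    \<and> c = bar_diff (free_Abelian_group S) w"
  using assms
proof (induction S arbitrary: n c rule: finite_induct)
  case empty
  show ?case
  proof (cases n)
    case 0
    \<comment> \<open>In degree 0 the empty product reads off the coefficient of the only
      word.\<close>
    have "c = frag_cmul (Poly_Mapping.lookup c []) (frag_of [])"
      by (rule frag_eq_cmul) (use empty 0 in \<open>auto simp: bar_lists_def\<close>)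
    moreover have "frag_sum (\<lambda>_. 1) c = 0" using empty(3)[of "[]"] 0 by (simp add: fun_eq_iff[of "cup []"] cong: frag_sum_cong)
    ultimately have "c = 0" by (metis frag_cmul_zero frag_sum_cmul frag_sum_of mult.right_neutral)
    then show ?thesis by (intro exI[of _ 0]) simp
  next
    case (Suc m)
    show ?thesis unfolding Suc
      by (rule trivial_group_cycle_is_boundary) (use empty Suc in \<open>auto simp: group.is_monoid\<close>)
  qed
next
  case (insert t S)
  let ?G = "free_Abelian_group (insert t S)" and ?H = "free_Abelian_group S"
  show ?case
  proof (cases n)
    case 0
    have "c = frag_cmul (Poly_Mapping.lookup c []) (frag_of [])"
      by (rule frag_eq_cmul) (use insert 0 in \<open>auto simp: bar_lists_def\<close>)
    moreover have "frag_sum (\<lambda>_. 1) c = 0" using insert(6)[of "[]"] 0 by (simp add: fun_eq_iff[of "cup []"] cong: frag_sum_cong)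
    ultimately have "c = 0" by (metis frag_cmul_zero frag_sum_cmul frag_sum_of mult.right_neutral)
    then show ?thesis by (intro exI[of _ 0]) simp
  next
    case (Suc m)
    define \<pi> :: "('a \<Rightarrow>\<^sub>0 int) \<Rightarrow> ('a \<Rightarrow>\<^sub>0 int)"
      where "\<pi> = (\<lambda>v. v - frag_cmul (Poly_Mapping.lookup v t) (frag_of t))"
    interpret cyclic_splitting ?G "\<lambda>v. Poly_Mapping.lookup v t" \<pi> "\<lambda>m. frag_cmul m (frag_of t)"
      unfolding \<pi>_def by (rule free_Abelian_group_splitting) (rule insert)
    have \<pi>: "\<pi> ` carrier ?G \<subseteq> carrier ?H"
      by (auto simp: \<pi>_def in_keys_iff lookup_minus subset_iff split: if_splits)
    have \<pi>_hom': "\<pi> \<in> hom ?G ?H" using \<pi> \<pi>_hom by (auto simp: hom_def)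
    have lists: "bar_lists k ?H \<subseteq> bar_lists k ?G" for k
      unfolding bar_lists_def by (auto simp: subset_iff)
    \<comment> \<open>The projection changes only the coordinate \<open>t\<close>, which does not
      occur in \<open>ss\<close>.\<close>
    have invariant: "frag_sum (cup (map (\<lambda>s v. Poly_Mapping.lookup v s) ss)) (bar_map \<pi> d)
        = frag_sum (cup (map (\<lambda>s v. Poly_Mapping.lookup v s) ss)) d" if "set ss \<subseteq> S" for ss d
      unfolding bar_map_eq frag_sum_frag_map
      by (intro frag_sum_cong cup_map) (use that insert.hyps in \<open>auto simp: \<pi>_def lookup_minus\<close>)
    have kc: "Poly_Mapping.keys c \<subseteq> bar_lists (Suc m) ?G" using insert Suc by simp
    have cyc: "bar_diff ?G c = 0" by (rule insert)
    have "\<exists>w. Poly_Mapping.keys w \<subseteq> bar_lists (Suc (Suc m)) ?H \<and> bar_map \<pi> c = bar_diff ?H w"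
    proof (rule insert.IH)
      show "Poly_Mapping.keys (bar_map \<pi> c) \<subseteq> bar_lists (Suc m) ?H"
        using \<pi> kc by (rule keys_bar_map)
      show "bar_diff ?H (bar_map \<pi> c) = 0"
        using bar_diff_bar_map[OF \<pi>_hom', of c] cyc kc by (auto simp: bar_lists_def bar_map_eq)
      show "frag_sum (cup (map (\<lambda>s v. Poly_Mapping.lookup v s) ss)) (bar_map \<pi> c) = 0"
        if "length ss = Suc m" "set ss \<subseteq> S" for ss
        unfolding invariant[OF that(2)] using insert.prems(3)[of ss] that Suc by auto
    qed
    then obtain w1 where w1: "Poly_Mapping.keys w1 \<subseteq> bar_lists (Suc (Suc m)) ?G" "bar_map \<pi> c = bar_diff ?G w1"
      using lists bar_diff_free_Abelian_group by (metis order_trans)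
    have kcap: "Poly_Mapping.keys (cap c) \<subseteq> bar_lists m ?G"
      unfolding cap_def
      by (rule keys_frag_extend_subset)
         (use kc in \<open>fastforce simp: bar_lists_def split: list.splits if_splits\<close>)
    have "\<exists>w. Poly_Mapping.keys w \<subseteq> bar_lists (Suc m) ?H \<and> bar_map \<pi> (cap c) = bar_diff ?H w"
    proof (rule insert.IH)
      show "Poly_Mapping.keys (bar_map \<pi> (cap c)) \<subseteq> bar_lists m ?H"
        using \<pi> kcap by (rule keys_bar_map)
      show "bar_diff ?H (bar_map \<pi> (cap c)) = 0"
        using cycle_project_cap[OF kc cyc] bar_diff_free_Abelian_group by metis
      show "frag_sum (cup (map (\<lambda>s v. Poly_Mapping.lookup v s) ss)) (bar_map \<pi> (cap c)) = 0"
        if "length ss = m" "set ss \<subseteq> S" for ss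
      proof -
        \<comment> \<open>Capping removes the first letter and multiplies by its coordinate
          \<open>t\<close>, exactly as a leading factor \<open>t\<close> of the cup product
          does.\<close>
        have "frag_sum (cup (map (\<lambda>s v. Poly_Mapping.lookup v s) ss)) (cap c)
            = frag_sum (cup (map (\<lambda>s v. Poly_Mapping.lookup v s) (t # ss))) c"
          unfolding cap_def frag_sum_frag_extend
          by (rule frag_sum_cong) (auto split: list.split simp: frag_sum_cmul)
        then show ?thesis
          unfolding invariant[OF that(2)] using insert.prems(3)[of "t # ss"] that Suc
          by (auto simp del: cup.simps)
      qed
    qed
    then obtain w0 where w0: "Poly_Mapping.keys w0 \<subseteq> bar_lists (Suc m) ?G" "bar_map \<pi> (cap c) = bar_diff ?G w0"
      using lists bar_diff_free_Abelian_group by (metis order_trans)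
    show ?thesis unfolding Suc by (rule boundary_if_project_and_cap[OF kc cyc w1 w0])
  qed
qed

subsection \<open>Finitely generated subgroups of torsion-free abelian groups\<close>

lemma torsion_free_int_pow:
  assumes "group G" "torsion_free_group G" "x \<in> carrier G" "x [^]\<^bsub>G\<^esub> (m::int) = \<one>\<^bsub>G\<^esub>" "m \<noteq> 0"
  shows "x = \<one>\<^bsub>G\<^esub>"
proof -
  have "x [^]\<^bsub>G\<^esub> nat \<bar>m\<bar> = \<one>\<^bsub>G\<^esub>"
  proof (cases "0 \<le> m")
    case True
    then show ?thesis using assms(4) by (metis abs_of_nonneg int_nat_eq int_pow_int)
  next
    case False
    then have "x [^]\<^bsub>G\<^esub> (- m) = \<one>\<^bsub>G\<^esub>"
      using group.int_pow_neg[OF assms(1,3), of m] assms(1,4) by (simp add: monoid.inv_one group.is_monoid)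
    then show ?thesis using False by (metis abs_of_neg int_nat_eq int_pow_int le_minus_iff linorder_linear minus_zero not_le)
  qed
  then show ?thesis using assms(2,3,5) unfolding torsion_free_group_def by (metis zero_less_abs_iff zero_less_nat_eq)
qed

lemma hom_frag_cmul:
  assumes "group G" "h \<in> hom (free_Abelian_group S) G" "Poly_Mapping.keys v \<subseteq> S"
  shows "h (frag_cmul m v) = h v [^]\<^bsub>G\<^esub> m"
proof -
  interpret group_hom "free_Abelian_group S" G h
    using assms by (simp add: group_hom_def group_hom_axioms_def)
  show ?thesis using hom_int_pow[of v m] assms(3) by simp
qed

lemma keys_add_cmul_of:
  "Poly_Mapping.keys v \<subseteq> S \<Longrightarrow> i \<in> S \<Longrightarrow> Poly_Mapping.keys (v + frag_cmul m (frag_of i)) \<subseteq> S"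
  using keys_cmul[of m "frag_of i"] by (intro keys_add_subset) auto

lemma keys_diff_cmul_of:
  "Poly_Mapping.keys v \<subseteq> S \<Longrightarrow> i \<in> S \<Longrightarrow> Poly_Mapping.keys (v - frag_cmul m (frag_of i)) \<subseteq> S"
  using keys_cmul[of m "frag_of i"] by (intro keys_diff_subset) auto

text \<open>
  The Euclidean algorithm on a relation \<open>v\<close>: changing the generators by elementary operations shortens
  \<open>v\<close> until it is a multiple of a single generator, which then vanishes by torsion-freeness.
\<close>

lemma (in comm_group) drop_generator:
  assumes tf: "torsion_free_group G" and S: "finite S"
    and \<epsilon>: "\<epsilon> \<in> hom (free_Abelian_group S) G" "X \<subseteq> \<epsilon> ` carrier (free_Abelian_group S)"
    and v: "Poly_Mapping.keys v \<subseteq> S" "v \<noteq> 0" "\<epsilon> v = \<one>"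
  shows "\<exists>i \<epsilon>'. i \<in> S \<and> \<epsilon>' \<in> hom (free_Abelian_group (S - {i})) G
    \<and> X \<subseteq> \<epsilon>' ` carrier (free_Abelian_group (S - {i}))"
  using \<epsilon> v
proof (induction "nat (\<Sum>s\<in>S. \<bar>Poly_Mapping.lookup v s\<bar>)" arbitrary: v \<epsilon> rule: less_induct)
  case (less v \<epsilon>)
  interpret E: group_hom "free_Abelian_group S" G \<epsilon>
    using less.prems by (simp add: group_hom_def group_hom_axioms_def)
  obtain i where i: "i \<in> Poly_Mapping.keys v" using less.prems by (metis equals0I keys_eq_empty)
  show ?case
  proof (cases "Poly_Mapping.keys v \<subseteq> {i}")
    case True
    have iS: "i \<in> S" using i less.prems by blast
    have "\<epsilon> (frag_of i) [^] Poly_Mapping.lookup v i = \<one>"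
      using frag_eq_cmul[OF True] less.prems iS hom_frag_cmul[OF is_group less.prems(1)]
      by (metis empty_subsetI insert_subset keys_frag_of)
    then have e1: "\<epsilon> (frag_of i) = \<one>"
      using torsion_free_int_pow[OF is_group tf] iS i by (simp add: in_keys_iff)
    have "X \<subseteq> \<epsilon> ` carrier (free_Abelian_group (S - {i}))"
    proof
      fix x assume "x \<in> X"
      then obtain u where u: "x = \<epsilon> u" "Poly_Mapping.keys u \<subseteq> S" using less.prems by auto
      define u' where "u' = u - frag_cmul (Poly_Mapping.lookup u i) (frag_of i)"
      have k': "Poly_Mapping.keys u' \<subseteq> S - {i}"
        using keys_diff_cmul_of[OF u(2) iS] by (auto simp: u'_def in_keys_iff lookup_minus)
      have "\<epsilon> (frag_cmul (Poly_Mapping.lookup u i) (frag_of i)) = \<one>"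
        using hom_frag_cmul[OF is_group less.prems(1), of "frag_of i"] iS e1 by simp
      moreover have "\<epsilon> (u' + frag_cmul (Poly_Mapping.lookup u i) (frag_of i))
          = \<epsilon> u' \<otimes> \<epsilon> (frag_cmul (Poly_Mapping.lookup u i) (frag_of i))"
        by (rule hom_mult[OF less.prems(1), unfolded mult_free_Abelian_group])
           (use k' iS keys_cmul[of _ "frag_of i"] in fastforce)+
      moreover have "\<epsilon> u' \<in> carrier G"
        by (rule E.hom_closed) (use k' in auto)
      ultimately have "\<epsilon> u' = x" using u by (simp add: u'_def)
      then show "x \<in> \<epsilon> ` carrier (free_Abelian_group (S - {i}))" using k' by auto
    qed
    moreover have "\<epsilon> \<in> hom (free_Abelian_group (S - {i})) G"
    proof (rule homI)
      fix x y assume "x \<in> carrier (free_Abelian_group (S - {i}))" "y \<in> carrier (free_Abelian_group (S - {i}))"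
      then have "x \<in> carrier (free_Abelian_group S)" "y \<in> carrier (free_Abelian_group S)" by auto
      then show "\<epsilon> x \<in> carrier G"
        "\<epsilon> (x \<otimes>\<^bsub>free_Abelian_group (S - {i})\<^esub> y) = \<epsilon> x \<otimes> \<epsilon> y"
        using E.hom_closed E.hom_mult by simp_all
    qed
    ultimately show ?thesis using iS by blast
  next
    case False
    then obtain i' where i': "i' \<in> Poly_Mapping.keys v" "i' \<noteq> i" by blast
    have "\<bar>Poly_Mapping.lookup v i'\<bar> \<le> \<bar>Poly_Mapping.lookup v i\<bar>
        \<or> \<bar>Poly_Mapping.lookup v i\<bar> \<le> \<bar>Poly_Mapping.lookup v i'\<bar>" by linarith
    then obtain i j where ij: "i \<in> Poly_Mapping.keys v" "j \<in> Poly_Mapping.keys v" "i \<noteq> j"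
        "\<bar>Poly_Mapping.lookup v j\<bar> \<le> \<bar>Poly_Mapping.lookup v i\<bar>"
      using i i' by blast
    have iS: "i \<in> S" and jS: "j \<in> S" using ij less.prems by blast+
    \<comment> \<open>With this sign, subtracting \<open>s * v j\<close> moves the larger
      coefficient \<open>v i\<close> towards 0 by the absolute value of \<open>v j\<close>. Since
      \<open>\<alpha>\<close> undoes \<open>\<beta>\<close>, the relation \<open>\<beta> v\<close>
      holds for the new generators given by \<open>\<epsilon> \<circ> \<alpha>\<close>.\<close>
    define s where "s = sgn (Poly_Mapping.lookup v i) * sgn (Poly_Mapping.lookup v j)"
    define \<alpha> where "\<alpha> w = w + frag_cmul (s * Poly_Mapping.lookup w j) (frag_of i)" for w
    define \<beta> where "\<beta> w = w - frag_cmul (s * Poly_Mapping.lookup w j) (frag_of i)" for w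
    have \<alpha>\<beta>: "\<alpha> (\<beta> w) = w" for w using ij(3) by (simp add: \<alpha>_def \<beta>_def lookup_minus)
    have k\<alpha>: "Poly_Mapping.keys (\<alpha> w) \<subseteq> S" if "Poly_Mapping.keys w \<subseteq> S" for w
      unfolding \<alpha>_def using that iS by (rule keys_add_cmul_of)
    have k\<beta>: "Poly_Mapping.keys (\<beta> w) \<subseteq> S" if "Poly_Mapping.keys w \<subseteq> S" for w
      unfolding \<beta>_def using that iS by (rule keys_diff_cmul_of)
    have "\<alpha> \<in> hom (free_Abelian_group S) (free_Abelian_group S)"
      using k\<alpha> by (auto simp: hom_def) (auto simp: \<alpha>_def lookup_add frag_cmul_distrib algebra_simps)
    then have hom: "\<epsilon> \<circ> \<alpha> \<in> hom (free_Abelian_group S) G" using less.prems(1) by (rule Group.hom_compose)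
    have img: "X \<subseteq> (\<epsilon> \<circ> \<alpha>) ` carrier (free_Abelian_group S)"
    proof
      fix x assume "x \<in> X"
      then obtain u where "x = \<epsilon> u" "Poly_Mapping.keys u \<subseteq> S" using less.prems by auto
      then have "x = (\<epsilon> \<circ> \<alpha>) (\<beta> u)" "Poly_Mapping.keys (\<beta> u) \<subseteq> S" by (simp_all add: \<alpha>\<beta> k\<beta>)
      then show "x \<in> (\<epsilon> \<circ> \<alpha>) ` carrier (free_Abelian_group S)" by auto
    qed
    have "(\<Sum>s\<in>S - {i}. \<bar>Poly_Mapping.lookup (\<beta> v) s\<bar>) = (\<Sum>s\<in>S - {i}. \<bar>Poly_Mapping.lookup v s\<bar>)"
      by (rule sum.cong) (auto simp: \<beta>_def lookup_minus)
    moreover have "\<bar>Poly_Mapping.lookup (\<beta> v) i\<bar> < \<bar>Poly_Mapping.lookup v i\<bar>"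
      using ij by (auto simp: \<beta>_def lookup_minus s_def in_keys_iff sgn_if abs_if split: if_splits)
    ultimately have "(\<Sum>s\<in>S. \<bar>Poly_Mapping.lookup (\<beta> v) s\<bar>) < (\<Sum>s\<in>S. \<bar>Poly_Mapping.lookup v s\<bar>)"
      by (simp add: sum.remove[OF S iS])
    moreover have "0 \<le> (\<Sum>s\<in>S. \<bar>Poly_Mapping.lookup (\<beta> v) s\<bar>)" by (rule sum_nonneg) simp
    ultimately have "nat (\<Sum>s\<in>S. \<bar>Poly_Mapping.lookup (\<beta> v) s\<bar>) < nat (\<Sum>s\<in>S. \<bar>Poly_Mapping.lookup v s\<bar>)"
      by linarith
    moreover have "\<beta> v \<noteq> 0"
    proof
      assume "\<beta> v = 0"
      then have "Poly_Mapping.lookup (\<beta> v) j = 0" by simp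
      then show False using ij by (simp add: \<beta>_def lookup_minus in_keys_iff)
    qed
    ultimately show ?thesis using less.hyps[of "\<beta> v" "\<epsilon> \<circ> \<alpha>"] hom img less.prems k\<beta> by (simp add: \<alpha>\<beta>)
  qed
qed

text \<open>Starting from the free group on \<open>X\<close>, a generator is dropped as long as some
  relation is left. The set \<open>S\<close> merely names the basis, whose elements are the
  \<open>\<epsilon> (frag_of s)\<close>.\<close>

theorem (in comm_group) torsion_free_basis:
  assumes tf: "torsion_free_group G" and X: "finite X" "X \<subseteq> carrier G"
  obtains S :: "'a set" and \<epsilon> where "finite S" "\<epsilon> \<in> hom (free_Abelian_group S) G"
    "inj_on \<epsilon> (carrier (free_Abelian_group S))" "X \<subseteq> \<epsilon> ` carrier (free_Abelian_group S)"
proof -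
  have *: "\<exists>(S' :: 'a set) \<epsilon>'. finite S' \<and> \<epsilon>' \<in> hom (free_Abelian_group S') G
      \<and> inj_on \<epsilon>' (carrier (free_Abelian_group S')) \<and> X \<subseteq> \<epsilon>' ` carrier (free_Abelian_group S')"
    if "finite S" "\<epsilon> \<in> hom (free_Abelian_group S) G" "X \<subseteq> \<epsilon> ` carrier (free_Abelian_group S)"
    for S :: "'a set" and \<epsilon>
    using that
  proof (induction "card S" arbitrary: S \<epsilon> rule: less_induct)
    case less
    interpret E: group_hom "free_Abelian_group S" G \<epsilon>
      using less.prems by (simp add: group_hom_def group_hom_axioms_def)
    show ?case
    proof (cases "inj_on \<epsilon> (carrier (free_Abelian_group S))")
      case False
      then obtain v where "Poly_Mapping.keys v \<subseteq> S" "v \<noteq> 0" "\<epsilon> v = \<one>"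
        using E.inj_on_one_iff by auto
      then obtain i \<epsilon>' where "i \<in> S" "\<epsilon>' \<in> hom (free_Abelian_group (S - {i})) G"
          "X \<subseteq> \<epsilon>' ` carrier (free_Abelian_group (S - {i}))"
        using drop_generator[OF tf less.prems] by blast
      moreover have "card (S - {i}) < card S" using \<open>i \<in> S\<close> less.prems(1) by (rule card_Diff1_less[rotated])
      ultimately show ?thesis using less.hyps[of "S - {i}" \<epsilon>'] less.prems(1) by blast
    next
      case True
      show ?thesis
        by (rule exI[of _ S], rule exI[of _ \<epsilon>]) (use True less.prems in simp)
    qed
  qed
  obtain h where h: "h \<in> hom (free_Abelian_group X) G" "\<And>x. x \<in> X \<Longrightarrow> h (frag_of x) = x"
    using free_Abelian_group_universal[of id X] X(2) by auto
  have "X \<subseteq> h ` carrier (free_Abelian_group X)"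
  proof
    fix x assume "x \<in> X"
    then show "x \<in> h ` carrier (free_Abelian_group X)"
      by (intro image_eqI[of _ _ "frag_of x"]) (auto simp: h)
  qed
  then show ?thesis using *[OF X(1) h(1)] that by blast
qed

text \<open>Induction on the set \<open>T\<close> of allowed coordinates. If stage \<open>j\<close>
  is injective on \<open>T\<close>, then any two elements of its kernel on \<open>insert t T\<close>
  are linearly dependent. A nonzero element of that kernel dies no longer at some later stage; were
  the kernel there nonzero, the element would have a nonzero multiple in it and would itself lie in
  it by torsion-freeness.\<close>

lemma eventually_injective:
  fixes h :: "nat \<Rightarrow> ('s \<Rightarrow>\<^sub>0 int) \<Rightarrow> 'a" and A :: "nat \<Rightarrow> ('a, 'm) monoid_scheme"
  assumes "finite S"
    and h: "\<And>i. h i \<in> hom (free_Abelian_group S) (A i)"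
    and A: "\<And>i. group (A i)" "\<And>i. torsion_free_group (A i)"
    and mono: "\<And>i v. Poly_Mapping.keys v \<subseteq> S \<Longrightarrow> h (Suc i) v = \<one>\<^bsub>A (Suc i)\<^esub> \<Longrightarrow> h i v = \<one>\<^bsub>A i\<^esub>"
    and sep: "\<And>v. Poly_Mapping.keys v \<subseteq> S \<Longrightarrow> (\<And>i. h i v = \<one>\<^bsub>A i\<^esub>) \<Longrightarrow> v = 0"
  shows "\<exists>i. inj_on (h i) (carrier (free_Abelian_group S))"
proof -
  have E: "group_hom (free_Abelian_group S) (A i) (h i)" for i
    using h A by (simp add: group_hom_def group_hom_axioms_def)
  have mono': "h i v = \<one>\<^bsub>A i\<^esub>" if "i \<le> k" "Poly_Mapping.keys v \<subseteq> S" "h k v = \<one>\<^bsub>A k\<^esub>" for i k v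
    using that by (induction rule: dec_induct) (auto dest: mono)
  have "\<exists>i. \<forall>v. Poly_Mapping.keys v \<subseteq> T \<longrightarrow> h i v = \<one>\<^bsub>A i\<^esub> \<longrightarrow> v = 0" if "T \<subseteq> S" for T
    using finite_subset[OF that assms(1)] that
  proof (induction T rule: finite_induct)
    case empty
    then show ?case by simp
  next
    case (insert t T)
    then obtain j where j: "\<And>v. Poly_Mapping.keys v \<subseteq> T \<Longrightarrow> h j v = \<one>\<^bsub>A j\<^esub> \<Longrightarrow> v = 0" by auto
    have keysT: "Poly_Mapping.keys v \<subseteq> T"
      if "Poly_Mapping.keys v \<subseteq> insert t T" "Poly_Mapping.lookup v t = 0" for v
      using that by (auto simp: in_keys_iff subset_iff)
    show ?case
    proof (rule ccontr)
      assume "\<not> ?thesis"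
      then have ex: "\<exists>y. Poly_Mapping.keys y \<subseteq> insert t T \<and> h i y = \<one>\<^bsub>A i\<^esub> \<and> y \<noteq> 0" for i by blast
      obtain y where y: "Poly_Mapping.keys y \<subseteq> insert t T" "h j y = \<one>\<^bsub>A j\<^esub>" "y \<noteq> 0" using ex by blast
      have yS: "Poly_Mapping.keys y \<subseteq> S" using y insert.prems by blast
      obtain i where i: "h i y \<noteq> \<one>\<^bsub>A i\<^esub>" using sep[OF yS] y by blast
      define k where "k = max i j"
      have hk: "h k y \<noteq> \<one>\<^bsub>A k\<^esub>" using i mono'[of i k y] yS by (auto simp: k_def)
      obtain z where z: "Poly_Mapping.keys z \<subseteq> insert t T" "h k z = \<one>\<^bsub>A k\<^esub>" "z \<noteq> 0" using ex by blast
      have zS: "Poly_Mapping.keys z \<subseteq> S" using z insert.prems by blast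
      have hjz: "h j z = \<one>\<^bsub>A j\<^esub>" using mono'[of j k z] zS z by (simp add: k_def)
      have zt: "Poly_Mapping.lookup z t \<noteq> 0" using j[OF keysT[OF z(1)]] hjz z by blast
      \<comment> \<open>The combination cancels the coordinate \<open>t\<close>, so \<open>u\<close>
        is supported on \<open>T\<close>, where stage \<open>j\<close> is injective.\<close>
      define u where "u = frag_cmul (Poly_Mapping.lookup z t) y - frag_cmul (Poly_Mapping.lookup y t) z"
      have ku: "Poly_Mapping.keys (frag_cmul (Poly_Mapping.lookup z t) y) \<subseteq> insert t T"
        "Poly_Mapping.keys (frag_cmul (Poly_Mapping.lookup y t) z) \<subseteq> insert t T"
        using y z keys_cmul by blast+
      then have uT: "Poly_Mapping.keys u \<subseteq> T"
        by (intro keysT) (auto simp: u_def lookup_minus dest!: subsetD[OF keys_diff])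
      have hcmul: "h l (frag_cmul m v) = h l v [^]\<^bsub>A l\<^esub> m" if "Poly_Mapping.keys v \<subseteq> S" for l m v
        by (rule hom_frag_cmul[OF A(1) h that])
      have "h j u = \<one>\<^bsub>A j\<^esub>"
      proof -
        interpret J: group_hom "free_Abelian_group S" "A j" "h j" by (rule E)
        have kS: "Poly_Mapping.keys (frag_cmul (Poly_Mapping.lookup z t) y) \<subseteq> S"
          "Poly_Mapping.keys (frag_cmul (Poly_Mapping.lookup y t) z) \<subseteq> S" "Poly_Mapping.keys u \<subseteq> S"
          using ku uT insert.prems by blast+
        have "h j (u + frag_cmul (Poly_Mapping.lookup y t) z) = h j u \<otimes>\<^bsub>A j\<^esub> h j (frag_cmul (Poly_Mapping.lookup y t) z)"
          by (rule hom_mult[OF h, unfolded mult_free_Abelian_group]) (use kS in auto)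
        then show ?thesis
          using hcmul yS zS y hjz J.hom_closed[of u] kS by (simp add: u_def)
      qed
      then have "u = 0" by (rule j[OF uT])
      then have eq: "frag_cmul (Poly_Mapping.lookup z t) y = frag_cmul (Poly_Mapping.lookup y t) z"
        by (simp add: u_def)
      interpret K: group_hom "free_Abelian_group S" "A k" "h k" by (rule E)
      have "h k y [^]\<^bsub>A k\<^esub> Poly_Mapping.lookup z t = \<one>\<^bsub>A k\<^esub>"
        using arg_cong[OF eq, of "h k"] hcmul yS zS z by simp
      moreover have "h k y \<in> carrier (A k)" by (rule K.hom_closed) (simp add: yS)
      ultimately show False using torsion_free_int_pow[OF A(1) A(2)] zt hk by blast
    qed
  qed
  then obtain i where i: "\<And>v. Poly_Mapping.keys v \<subseteq> S \<Longrightarrow> h i v = \<one>\<^bsub>A i\<^esub> \<Longrightarrow> v = 0" by blast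
  interpret I: group_hom "free_Abelian_group S" "A i" "h i" by (rule E)
  have "inj_on (h i) (carrier (free_Abelian_group S))" using I.inj_on_one_iff i by auto
  then show ?thesis by blast
qed

section \<open>Extending functionals up to a nonzero multiple\<close>

lemma frag_sum_fun_add: "frag_sum (\<lambda>x. v x + w x) c = frag_sum v c + frag_sum w c"
  by (simp add: frag_sum_def algebra_simps sum.distrib)

text \<open>An integral form of the injectivity of the group of rationals.\<close>

lemma extend_functional:
  fixes j :: "('s \<Rightarrow>\<^sub>0 int) \<Rightarrow> ('t \<Rightarrow>\<^sub>0 int)" and f :: "('s \<Rightarrow>\<^sub>0 int) \<Rightarrow> int"
  assumes "finite T"
    and "\<And>v. v \<in> V \<Longrightarrow> Poly_Mapping.keys (j v) \<subseteq> T"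
    and "\<And>a b u v. u \<in> V \<Longrightarrow> v \<in> V \<Longrightarrow> frag_cmul a u - frag_cmul b v \<in> V"
    and "\<And>a b u v. u \<in> V \<Longrightarrow> v \<in> V \<Longrightarrow>
      j (frag_cmul a u - frag_cmul b v) = frag_cmul a (j u) - frag_cmul b (j v)"
    and "\<And>a b u v. u \<in> V \<Longrightarrow> v \<in> V \<Longrightarrow> f (frag_cmul a u - frag_cmul b v) = a * f u - b * f v"
    and "\<And>v. v \<in> V \<Longrightarrow> j v = 0 \<Longrightarrow> f v = 0"
  shows "\<exists>N q. N \<noteq> 0 \<and> (\<forall>v\<in>V. N * f v = frag_sum q (j v))"
  using assms
proof (induction T arbitrary: V rule: finite_induct)
  case empty
  then show ?case by (intro exI[of _ 1] exI[of _ "\<lambda>_. 0"]) auto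
next
  case (insert t T)
  define W where "W = {v \<in> V. Poly_Mapping.lookup (j v) t = 0}"
  have "\<exists>N q. N \<noteq> 0 \<and> (\<forall>v\<in>W. N * f v = frag_sum q (j v))"
  proof (rule insert.IH)
    show "Poly_Mapping.keys (j v) \<subseteq> T" if "v \<in> W" for v
      using insert.prems(1)[of v] that by (auto simp: W_def in_keys_iff subset_iff)
    show "frag_cmul a u - frag_cmul b v \<in> W" if "u \<in> W" "v \<in> W" for a b u v
      using that insert.prems(2,3) by (auto simp: W_def lookup_minus)
  qed (use insert.prems in \<open>auto simp: W_def\<close>)
  then obtain N q where N: "N \<noteq> 0" and q: "\<And>v. v \<in> W \<Longrightarrow> N * f v = frag_sum q (j v)" by blast
  show ?case
  proof (cases "W = V")
    case True
    then show ?thesis using N q by blast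
  next
    case False
    then obtain u where u: "u \<in> V" "Poly_Mapping.lookup (j u) t \<noteq> 0" by (auto simp: W_def)
    define k where "k = Poly_Mapping.lookup (j u) t"
    \<comment> \<open>The value of the extension at \<open>t\<close> is forced by the equation for
      \<open>u\<close>; scaling \<open>q\<close> by \<open>k\<close> avoids the division by the
      coordinate of \<open>j u\<close>.\<close>
    define C where "C = N * f u - frag_sum q (j u)"
    define q' where "q' = (\<lambda>s. k * q s + (if s = t then C else 0))"
    have at: "frag_sum (\<lambda>s. if s = t then C else 0) v = Poly_Mapping.lookup v t * C" for v
    proof -
      have "frag_sum (\<lambda>s. if s = t then C else 0) v
          = (\<Sum>s\<in>Poly_Mapping.keys v. if s = t then Poly_Mapping.lookup v t * C else 0)"
        unfolding frag_sum_def by (rule sum.cong) auto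
      then show ?thesis by (simp add: in_keys_iff)
    qed
    have "(N * k) * f v = frag_sum q' (j v)" if v: "v \<in> V" for v
    proof -
      define l where "l = Poly_Mapping.lookup (j v) t"
      \<comment> \<open>This combination has coordinate 0 at \<open>t\<close>, so the functional
        found for \<open>T\<close> applies to it.\<close>
      have "frag_cmul k v - frag_cmul l u \<in> W"
        using insert.prems(2,3)[OF v u(1)] by (simp add: W_def lookup_minus k_def l_def)
      from q[OF this] have "N * (k * f v - l * f u) = k * frag_sum q (j v) - l * frag_sum q (j u)"
        using insert.prems(3,4)[OF v u(1)] by (simp add: frag_sum_diff frag_sum_cmul)
      moreover have "frag_sum q' (j v) = k * frag_sum q (j v) + l * C"
        unfolding q'_def frag_sum_fun_add frag_sum_scale at l_def ..
      ultimately show ?thesis by (simp add: C_def algebra_simps)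
    qed
    moreover have "N * k \<noteq> 0" using N u by (simp add: k_def)
    ultimately show ?thesis by blast
  qed
qed

subsection \<open>Lifting cycles and detecting boundaries\<close>

lemma bar_map_bar_map: "bar_map f (bar_map g c) = bar_map (\<lambda>x. f (g x)) c"
  by (simp add: bar_map_eq frag_map_frag_map comp_def)

lemma bar_map_cong:
  assumes "Poly_Mapping.keys c \<subseteq> {xs. set xs \<subseteq> X}" "\<And>x. x \<in> X \<Longrightarrow> f x = g x"
  shows "bar_map f c = bar_map g c"
  unfolding bar_map_eq by (rule frag_map_cong) (use assms in auto)

lemma bar_map_ident:
  assumes "Poly_Mapping.keys c \<subseteq> {xs. set xs \<subseteq> X}" "\<And>x. x \<in> X \<Longrightarrow> f x = x"
  shows "bar_map f c = c"
  unfolding bar_map_eq by (rule frag_map_ident) (use assms in \<open>auto intro!: map_idI\<close>)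

definition bar_support :: "('a list \<Rightarrow>\<^sub>0 int) \<Rightarrow> 'a set"
  where "bar_support c = \<Union> (set ` Poly_Mapping.keys c)"

lemma finite_bar_support: "finite (bar_support c)"
  by (simp add: bar_support_def)

lemma keys_subset_bar_support: "Poly_Mapping.keys c \<subseteq> {xs. set xs \<subseteq> bar_support c}"
  by (auto simp: bar_support_def)

lemma bar_support_subset: "Poly_Mapping.keys c \<subseteq> bar_lists n G \<Longrightarrow> bar_support c \<subseteq> carrier G"
  by (auto simp: bar_support_def bar_lists_def)

lemma bar_lists_subset: "bar_lists n G \<subseteq> {xs. set xs \<subseteq> carrier G}"
  by (auto simp: bar_lists_def)

lemma bar_map_injective:
  assumes "inj_on f (carrier F)" "Poly_Mapping.keys a \<subseteq> bar_lists n F" "Poly_Mapping.keys b \<subseteq> bar_lists n F"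
    "bar_map f a = bar_map f b"
  shows "a = b"
proof -
  have "bar_map (inv_into (carrier F) f) (bar_map f c) = c" if "Poly_Mapping.keys c \<subseteq> bar_lists n F" for c
    unfolding bar_map_bar_map
    by (rule bar_map_ident[OF order_trans[OF that bar_lists_subset]]) (use assms(1) in simp)
  then show ?thesis using assms by metis
qed

text \<open>Preimages are chosen letter by letter. The choice need not be multiplicative, as only
  chains and not their boundaries are concerned.\<close>

lemma bar_map_preimage:
  assumes "Poly_Mapping.keys c \<subseteq> bar_lists n G" "bar_support c \<subseteq> f ` carrier F"
  obtains c' where "Poly_Mapping.keys c' \<subseteq> bar_lists n F" "bar_map f c' = c"
proof
  let ?g = "inv_into (carrier F) f"
  have "Poly_Mapping.keys c \<subseteq> bar_lists n (G\<lparr>carrier := f ` carrier F\<rparr>)"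
    using assms by (auto simp: bar_lists_def bar_support_def)
  then show "Poly_Mapping.keys (bar_map ?g c) \<subseteq> bar_lists n F"
    by (intro keys_bar_map) (auto intro: inv_into_into)
  show "bar_map f (bar_map ?g c) = c"
    unfolding bar_map_bar_map
    by (rule bar_map_ident[OF keys_subset_bar_support]) (use assms(2) in \<open>auto intro: f_inv_into_f\<close>)
qed

lemma bar_diff_preimage:
  assumes "f \<in> hom F G" "inj_on f (carrier F)" "monoid F" "Poly_Mapping.keys c \<subseteq> bar_lists n F"
    "bar_diff G (bar_map f c) = 0"
  shows "bar_diff F c = 0"
proof -
  have eq: "bar_map f (bar_diff F c) = bar_map f 0"
    using bar_diff_bar_map[OF assms(1) order_trans[OF assms(4) bar_lists_subset]] assms(5)
    by (simp add: bar_map_eq)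
  show ?thesis
  proof (cases n)
    case 0
    have "Poly_Mapping.keys c \<subseteq> {[]}" using assms(4) 0 by (auto simp: bar_lists_def)
    then show ?thesis unfolding bar_diff_def by (intro frag_extend_eq_0) auto
  next
    case (Suc m)
    then show ?thesis
      using bar_map_injective[OF assms(2) keys_bar_diff[OF assms(3)] _ eq, of m] assms(4) by simp
  qed
qed

text \<open>Lifting the letters arbitrarily would give a chain but not a cycle. Lifting a basis
  instead defines a homomorphism \<open>\<sigma>\<close>, which carries the vanishing boundary
  along.\<close>

theorem cycle_lift:
  fixes A :: "('a, 'm) monoid_scheme" and B :: "('b, 'k) monoid_scheme"
  assumes A: "comm_group A" and B: "comm_group B" "torsion_free_group B" and f: "f \<in> epi A B"
    and c: "Poly_Mapping.keys c \<subseteq> bar_lists n B" "bar_diff B c = 0"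
  obtains c' where "Poly_Mapping.keys c' \<subseteq> bar_lists n A" "bar_diff A c' = 0" "bar_map f c' = c"
proof -
  interpret A: comm_group A by (rule A)
  interpret B: comm_group B by (rule B)
  have f': "f \<in> hom A B" "f ` carrier A = carrier B" using f by (auto simp: epi_def)
  obtain S :: "'b set" and \<epsilon> where S: "finite S" and \<epsilon>: "\<epsilon> \<in> hom (free_Abelian_group S) B"
    "inj_on \<epsilon> (carrier (free_Abelian_group S))" "bar_support c \<subseteq> \<epsilon> ` carrier (free_Abelian_group S)"
    using B.torsion_free_basis[OF B(2) finite_bar_support bar_support_subset[OF c(1)]] by blast
  have \<epsilon>_closed: "\<epsilon> v \<in> carrier B" if "Poly_Mapping.keys v \<subseteq> S" for v
    using hom_in_carrier[OF \<epsilon>(1)] that by simp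
  define l where "l s = inv_into (carrier A) f (\<epsilon> (frag_of s))" for s
  have l: "l s \<in> carrier A" "f (l s) = \<epsilon> (frag_of s)" if "s \<in> S" for s
    using \<epsilon>_closed[of "frag_of s"] that f' by (auto simp: l_def intro!: inv_into_into f_inv_into_f)
  obtain \<sigma> where \<sigma>: "\<sigma> \<in> hom (free_Abelian_group S) A" "\<And>s. s \<in> S \<Longrightarrow> \<sigma> (frag_of s) = l s"
    using A.free_Abelian_group_universal[of l S] l by blast
  interpret s: group_hom "free_Abelian_group S" B "f \<circ> \<sigma>"
    using Group.hom_compose[OF \<sigma>(1) f'(1)] by (simp add: group_hom_def group_hom_axioms_def)
  interpret e: group_hom "free_Abelian_group S" B \<epsilon>
    using \<epsilon> by (simp add: group_hom_def group_hom_axioms_def)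
  have f\<sigma>: "f (\<sigma> v) = \<epsilon> v" if "Poly_Mapping.keys v \<subseteq> S" for v
    using that
  proof (induction v rule: free_Abelian_group_induct[consumes 1, case_names zero diff gen])
    case zero
    then show ?case using s.hom_one e.hom_one by simp
  next
    case (diff x y)
    have "h (x - y) = h x \<otimes>\<^bsub>B\<^esub> inv\<^bsub>B\<^esub> h y" if "group_hom (free_Abelian_group S) B h" for h
      using group_hom.hom_mult[OF that, of x "- y"] group_hom.hom_inv[OF that, of y] diff by simp
    from this[OF s.group_hom_axioms] this[OF e.group_hom_axioms] diff show ?case by simp
  next
    case (gen a)
    then show ?case using \<sigma> l by simp
  qed
  obtain d where d: "Poly_Mapping.keys d \<subseteq> bar_lists n (free_Abelian_group S)" "bar_map \<epsilon> d = c"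
    using bar_map_preimage[OF c(1) \<epsilon>(3)] by blast
  have d0: "bar_diff (free_Abelian_group S) d = 0"
    using bar_diff_preimage[OF \<epsilon>(1,2) _ d(1)] c d by (simp add: group.is_monoid)
  show ?thesis
  proof
    show "Poly_Mapping.keys (bar_map \<sigma> d) \<subseteq> bar_lists n A"
      by (rule keys_bar_map[OF _ d(1)]) (rule hom_carrier[OF \<sigma>(1)])
    show "bar_diff A (bar_map \<sigma> d) = 0"
      using bar_diff_bar_map[OF \<sigma>(1) order_trans[OF d(1) bar_lists_subset]] d0 by (simp add: bar_map_eq)
    show "bar_map f (bar_map \<sigma> d) = c"
      unfolding bar_map_bar_map d(2)[symmetric]
      by (rule bar_map_cong[OF order_trans[OF d(1) bar_lists_subset]]) (simp add: f\<sigma>)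
  qed
qed

lemma cup_map_scaled:
  assumes "\<And>s x. s \<in> set ss \<Longrightarrow> x \<in> set xs \<Longrightarrow> N s * f s x = g s (h x)"
  shows "cup (map g ss) (map h xs) = prod_list (map N ss) * cup (map f ss) xs"
  using assms
proof (induction ss arbitrary: xs)
  case (Cons s ss)
  show ?case
  proof (cases xs)
    case (Cons y ys)
    with Cons.IH[of ys] Cons.prems have "cup (map g ss) (map h ys) = prod_list (map N ss) * cup (map f ss) ys"
      by auto
    moreover have "g s (h y) = N s * f s y" using Cons.prems Cons by auto
    ultimately show ?thesis using Cons by simp
  qed simp
qed simp

text \<open>
  The induced map of homology is injective for an injective homomorphism \<open>h\<close> from a finitely generated
  free group, because the cup products of the coordinate functions detect homology classes and a
  multiple of every coordinate function extends.
\<close>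

lemma injective_hom_boundary:
  fixes B :: "('b, 'k) monoid_scheme" and S :: "'s set"
  assumes B: "comm_group B" "torsion_free_group B" and S: "finite S"
    and h: "h \<in> hom (free_Abelian_group S) B" "inj_on h (carrier (free_Abelian_group S))"
    and c: "Poly_Mapping.keys c \<subseteq> bar_lists n (free_Abelian_group S)" "bar_diff (free_Abelian_group S) c = 0"
    and w: "Poly_Mapping.keys w \<subseteq> bar_lists (Suc n) B" "bar_map h c = bar_diff B w"
  shows "\<exists>w. Poly_Mapping.keys w \<subseteq> bar_lists (Suc n) (free_Abelian_group S)
    \<and> c = bar_diff (free_Abelian_group S) w"
proof -
  interpret B: comm_group B by (rule B)
  let ?F = "free_Abelian_group S"
  interpret h: group_hom ?F B h using h by (simp add: group_hom_def group_hom_axioms_def)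
  \<comment> \<open>The group on \<open>T\<close> has to contain the letters of the bounding chain
    as well as the image of \<open>h\<close>, so that the equation for \<open>w\<close> already
    holds over it.\<close>
  define Y where "Y = bar_support w \<union> (\<lambda>s. h (frag_of s)) ` S"
  have "finite Y" using S by (simp add: Y_def finite_bar_support)
  moreover have "Y \<subseteq> carrier B"
    using bar_support_subset[OF w(1)] h.hom_closed by (auto simp: Y_def)
  ultimately obtain T :: "'b set" and \<eta> where T: "finite T" and \<eta>: "\<eta> \<in> hom (free_Abelian_group T) B"
    "inj_on \<eta> (carrier (free_Abelian_group T))" "Y \<subseteq> \<eta> ` carrier (free_Abelian_group T)"
    using B.torsion_free_basis[OF B(2)] by blast
  let ?E = "free_Abelian_group T"
  interpret e: group_hom ?E B \<eta> using \<eta> by (simp add: group_hom_def group_hom_axioms_def)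
  define j where "j v = inv_into (carrier ?E) \<eta> (h v)" for v
  have im: "h v \<in> \<eta> ` carrier ?E" if "Poly_Mapping.keys v \<subseteq> S" for v
    using that
  proof (induction v rule: free_Abelian_group_induct[consumes 1, case_names zero diff gen])
    case zero
    then show ?case using h.hom_one e.hom_one by (metis e.G.one_closed imageI one_free_Abelian_group)
  next
    case (diff x y)
    have "h (x - y) = h x \<otimes>\<^bsub>B\<^esub> inv\<^bsub>B\<^esub> h y"
      using h.hom_mult[of x "- y"] h.hom_inv[of y] diff by simp
    then show ?case using diff e.img_is_subgroup by (simp add: subgroup.m_closed subgroup.m_inv_closed)
  next
    case (gen a)
    then show ?case using \<eta>(3) by (auto simp: Y_def)
  qed
  have j: "Poly_Mapping.keys (j v) \<subseteq> T" "\<eta> (j v) = h v" if "Poly_Mapping.keys v \<subseteq> S" for v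
    using im[OF that] inv_into_into[of "h v" \<eta> "carrier ?E"] by (auto simp: j_def f_inv_into_f)
  have j_hom: "j \<in> hom ?F ?E"
  proof (rule homI)
    fix x y assume x: "x \<in> carrier ?F" and y: "y \<in> carrier ?F"
    then have xy: "x + y \<in> carrier ?F" by (auto dest: subsetD[OF keys_add])
    show "j x \<in> carrier ?E" using j x by simp
    have "\<eta> (j (x + y)) = \<eta> (j x \<otimes>\<^bsub>?E\<^esub> j y)"
      using j x y xy h.hom_mult[OF x y] e.hom_mult[of "j x" "j y"] by simp
    then show "j (x \<otimes>\<^bsub>?F\<^esub> y) = j x \<otimes>\<^bsub>?E\<^esub> j y"
      using inj_onD[OF \<eta>(2), of "j (x + y)" "j x \<otimes>\<^bsub>?E\<^esub> j y"] j x y xy e.G.m_closed[of "j x" "j y"] by simp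
  qed
  interpret j: group_hom ?F ?E j using j_hom by (simp add: group_hom_def group_hom_axioms_def)
  have j_cmul: "j (frag_cmul a v) = frag_cmul a (j v)" if "Poly_Mapping.keys v \<subseteq> S" for a v
    using hom_frag_cmul[OF _ j_hom that] j(1)[OF that] by simp
  have kdiff: "Poly_Mapping.keys (frag_cmul a u - frag_cmul b v) \<subseteq> S"
    if "Poly_Mapping.keys u \<subseteq> S" "Poly_Mapping.keys v \<subseteq> S" for a b u v
    using that keys_cmul by (intro keys_diff_subset) blast+
  have j_diff: "j (frag_cmul a u - frag_cmul b v) = frag_cmul a (j u) - frag_cmul b (j v)"
    if "Poly_Mapping.keys u \<subseteq> S" "Poly_Mapping.keys v \<subseteq> S" for a b u v
    using hom_frag_diff[OF j_hom, of "frag_cmul a u" "frag_cmul b v"] that keys_cmul j_cmul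
    by (metis order_trans)
  have j_0: "v = 0" if "Poly_Mapping.keys v \<subseteq> S" "j v = 0" for v
  proof -
    have "h v = h 0" using j[OF that(1)] that(2) e.hom_one h.hom_one by simp
    then show ?thesis using inj_onD[OF h(2), of v 0] that by simp
  qed
  have "\<exists>N q. N \<noteq> 0 \<and> (\<forall>v\<in>carrier ?F. N * Poly_Mapping.lookup v s = frag_sum q (j v))" for s
  proof (rule extend_functional[OF T])
    fix v assume "v \<in> carrier ?F" "j v = 0"
    then have "v = 0" using j_0 by simp
    then show "Poly_Mapping.lookup v s = 0" by simp
  qed (use j(1) j_diff kdiff in \<open>auto simp: lookup_minus simp del: minus_frag_cmul\<close>)
  then obtain N q where N: "\<And>s. N s \<noteq> 0"
    and q: "\<And>s v. v \<in> carrier ?F \<Longrightarrow> N s * Poly_Mapping.lookup v s = frag_sum (q s) (j v)"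
    by metis
  obtain d where d: "Poly_Mapping.keys d \<subseteq> bar_lists (Suc n) ?E" "bar_map \<eta> d = w"
    using bar_map_preimage[OF w(1), of \<eta> ?E] \<eta>(3) by (auto simp: Y_def)
  have jc: "bar_map j c = bar_diff ?E d"
  proof (rule bar_map_injective[OF \<eta>(2)])
    show "Poly_Mapping.keys (bar_map j c) \<subseteq> bar_lists n ?E"
      by (rule keys_bar_map[OF _ c(1)]) (rule hom_carrier[OF j_hom])
    show "Poly_Mapping.keys (bar_diff ?E d) \<subseteq> bar_lists n ?E"
      using d(1) by (intro keys_bar_diff) (simp_all add: group.is_monoid)
    have "bar_map \<eta> (bar_map j c) = bar_map h c" unfolding bar_map_bar_map
      by (rule bar_map_cong[OF order_trans[OF c(1) bar_lists_subset]]) (simp add: j(2))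
    also have "\<dots> = bar_map \<eta> (bar_diff ?E d)"
      using bar_diff_bar_map[OF \<eta>(1) order_trans[OF d(1) bar_lists_subset]] d w by simp
    finally show "bar_map \<eta> (bar_map j c) = bar_map \<eta> (bar_diff ?E d)" .
  qed
  show ?thesis
  proof (rule free_Abelian_group_cycle_is_boundary[OF S c])
    fix ss :: "'s list" assume ss: "length ss = n"
    \<comment> \<open>The product of the extended functionals is a cocycle on the larger group and
      vanishes on boundaries. Pulled back along \<open>j\<close>, it is the product of coordinates
      times the nonzero product of the \<open>N s\<close>.\<close>
    have "frag_sum (cup (map (\<lambda>s. frag_sum (q s)) ss)) (bar_diff ?E d) = 0"
      by (rule cup_bar_diff) (use d ss in \<open>auto simp: additive_on_def frag_sum_add\<close>)
    moreover have "frag_sum (cup (map (\<lambda>s. frag_sum (q s)) ss)) (bar_map j c)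
      = frag_sum (\<lambda>xs. prod_list (map N ss) * cup (map (\<lambda>s v. Poly_Mapping.lookup v s) ss) xs) c"
      unfolding bar_map_eq frag_sum_frag_map
      by (intro frag_sum_cong cup_map_scaled q)
         (use c(1) in \<open>auto simp: bar_lists_def simp del: carrier_free_Abelian_group_iff\<close>)
    moreover have "prod_list (map N ss) \<noteq> 0" using N by (auto simp: prod_list_zero_iff image_iff eq_commute[of 0])
    ultimately show "frag_sum (cup (map (\<lambda>s v. Poly_Mapping.lookup v s) ss)) c = 0"
      unfolding jc by (simp add: frag_sum_scale)
  qed
qed

text \<open>A single stage decides: the letters of \<open>c\<close> lie in a free subgroup of finite
  rank, some \<open>q i\<close> is injective on it, and the boundary at that stage pulls back by
  \<open>injective_hom_boundary\<close>.\<close>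

theorem boundary_if_boundary_in_quotients:
  fixes L :: "('l, 'k) monoid_scheme" and A :: "nat \<Rightarrow> ('a, 'm) monoid_scheme"
  assumes L: "comm_group L" and A: "\<And>i. comm_group (A i)" "\<And>i. torsion_free_group (A i)"
    and q: "\<And>i. q i \<in> hom L (A i)"
    and mono: "\<And>i x. x \<in> carrier L \<Longrightarrow> q (Suc i) x = \<one>\<^bsub>A (Suc i)\<^esub> \<Longrightarrow> q i x = \<one>\<^bsub>A i\<^esub>"
    and sep: "\<And>x. x \<in> carrier L \<Longrightarrow> (\<And>i. q i x = \<one>\<^bsub>A i\<^esub>) \<Longrightarrow> x = \<one>\<^bsub>L\<^esub>"
    and c: "Poly_Mapping.keys c \<subseteq> bar_lists n L" "bar_diff L c = 0"
    and w: "\<And>i. \<exists>w. Poly_Mapping.keys w \<subseteq> bar_lists (Suc n) (A i) \<and> bar_map (q i) c = bar_diff (A i) w"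
  shows "\<exists>w. Poly_Mapping.keys w \<subseteq> bar_lists (Suc n) L \<and> c = bar_diff L w"
proof -
  interpret L: comm_group L by (rule L)
  have G: "group (A i)" for i using A(1) comm_group.axioms by blast
  have Q: "group_hom L (A i) (q i)" for i using q G by (simp add: group_hom_def group_hom_axioms_def)
  have "torsion_free_group L"
    unfolding torsion_free_group_def
  proof (intro ballI allI impI)
    fix x and k :: nat assume x: "x \<in> carrier L" and k: "0 < k" "x [^]\<^bsub>L\<^esub> k = \<one>\<^bsub>L\<^esub>"
    show "x = \<one>\<^bsub>L\<^esub>"
    proof (rule sep[OF x])
      fix i
      interpret group_hom L "A i" "q i" by (rule Q)
      have "q i x [^]\<^bsub>A i\<^esub> k = \<one>\<^bsub>A i\<^esub>" using hom_nat_pow[OF x, of k] k by simp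
      then show "q i x = \<one>\<^bsub>A i\<^esub>"
        using A(2)[of i] k x unfolding torsion_free_group_def by simp
    qed
  qed
  then obtain S :: "'l set" and \<epsilon> where S: "finite S" and \<epsilon>: "\<epsilon> \<in> hom (free_Abelian_group S) L"
    "inj_on \<epsilon> (carrier (free_Abelian_group S))" "bar_support c \<subseteq> \<epsilon> ` carrier (free_Abelian_group S)"
    using L.torsion_free_basis[OF _ finite_bar_support bar_support_subset[OF c(1)]] by blast
  interpret e: group_hom "free_Abelian_group S" L \<epsilon>
    using \<epsilon> by (simp add: group_hom_def group_hom_axioms_def)
  have h: "q i \<circ> \<epsilon> \<in> hom (free_Abelian_group S) (A i)" for i
    using \<epsilon>(1) q by (rule Group.hom_compose)
  have closed: "\<epsilon> v \<in> carrier L" if "Poly_Mapping.keys v \<subseteq> S" for v using e.hom_closed that by simp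
  have "\<exists>i. inj_on (q i \<circ> \<epsilon>) (carrier (free_Abelian_group S))"
  proof (rule eventually_injective[OF S h G A(2)])
    show "(q i \<circ> \<epsilon>) v = \<one>\<^bsub>A i\<^esub>"
      if "Poly_Mapping.keys v \<subseteq> S" "(q (Suc i) \<circ> \<epsilon>) v = \<one>\<^bsub>A (Suc i)\<^esub>" for i v
      using that mono[OF closed] by simp
    show "v = 0" if v: "Poly_Mapping.keys v \<subseteq> S" "\<And>i. (q i \<circ> \<epsilon>) v = \<one>\<^bsub>A i\<^esub>" for v
    proof -
      have "\<epsilon> v = \<epsilon> 0" using sep[OF closed[OF v(1)]] v(2) e.hom_one by simp
      then show ?thesis using inj_onD[OF \<epsilon>(2), of v 0] v by simp
    qed
  qed
  then obtain i where i: "inj_on (q i \<circ> \<epsilon>) (carrier (free_Abelian_group S))" ..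
  obtain d where d: "Poly_Mapping.keys d \<subseteq> bar_lists n (free_Abelian_group S)" "bar_map \<epsilon> d = c"
    using bar_map_preimage[OF c(1) \<epsilon>(3)] by blast
  have d0: "bar_diff (free_Abelian_group S) d = 0"
    using bar_diff_preimage[OF \<epsilon>(1,2) _ d(1)] c d by (simp add: group.is_monoid)
  obtain w where w: "Poly_Mapping.keys w \<subseteq> bar_lists (Suc n) (A i)" "bar_map (q i) c = bar_diff (A i) w"
    using assms(9) by blast
  have "bar_map (q i \<circ> \<epsilon>) d = bar_diff (A i) w"
    using w(2) by (simp add: d(2)[symmetric] bar_map_bar_map comp_def)
  then obtain v where v: "Poly_Mapping.keys v \<subseteq> bar_lists (Suc n) (free_Abelian_group S)"
      "d = bar_diff (free_Abelian_group S) v"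
    using injective_hom_boundary[OF A(1,2) S h i d(1) d0 w(1)] by blast
  have "c = bar_diff L (bar_map \<epsilon> v)"
    using bar_diff_bar_map[OF \<epsilon>(1) order_trans[OF v(1) bar_lists_subset]] v(2) d(2) by simp
  moreover have "Poly_Mapping.keys (bar_map \<epsilon> v) \<subseteq> bar_lists (Suc n) L"
    by (rule keys_bar_map[OF _ v(1)]) (rule hom_carrier[OF \<epsilon>(1)])
  ultimately show ?thesis by blast
qed

subsection \<open>Homology classes of bar cycles\<close>

lemma carrier_bar_chain_group: "carrier (bar_chain_group n G) = {c. Poly_Mapping.keys c \<subseteq> bar_lists n G}"
  by (simp add: set_eq_iff bar_chain_group_def bar_lists_def)

lemma mult_bar_chain_group [simp]: "x \<otimes>\<^bsub>bar_chain_group n G\<^esub> y = x + y"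
  by (simp add: bar_chain_group_def)

lemma one_bar_chain_group [simp]: "\<one>\<^bsub>bar_chain_group n G\<^esub> = 0"
  by (simp add: bar_chain_group_def)

lemma bar_cycles_eq: "bar_cycles n G = {c. Poly_Mapping.keys c \<subseteq> bar_lists n G \<and> bar_diff G c = 0}"
  by (auto simp: bar_cycles_def carrier_bar_chain_group bar_boundary_eq_bar_diff)

lemma bar_boundaries_eq: "bar_boundaries n G = bar_diff G ` {w. Poly_Mapping.keys w \<subseteq> bar_lists (Suc n) G}"
  unfolding bar_boundaries_def carrier_bar_chain_group
  by (rule image_cong) (auto simp: bar_boundary_eq_bar_diff)

definition cycle_group :: "nat \<Rightarrow> ('a, 'm) monoid_scheme \<Rightarrow> ('a list \<Rightarrow>\<^sub>0 int) monoid"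
  where "cycle_group n G = (bar_chain_group n G)\<lparr>carrier := bar_cycles n G\<rparr>"

definition homology_class :: "nat \<Rightarrow> ('a, 'm) monoid_scheme \<Rightarrow> ('a list \<Rightarrow>\<^sub>0 int) \<Rightarrow> ('a list \<Rightarrow>\<^sub>0 int) set"
  where "homology_class n G c = bar_boundaries n G #>\<^bsub>bar_chain_group n G\<^esub> c"

lemma cycle_group_simps [simp]:
  "carrier (cycle_group n G) = bar_cycles n G"
  "x \<otimes>\<^bsub>cycle_group n G\<^esub> y = x + y"
  "\<one>\<^bsub>cycle_group n G\<^esub> = 0"
  by (simp_all add: cycle_group_def)

lemma comm_group_cycle_group: "comm_group (cycle_group n G)"
proof (rule comm_groupI)
  fix x assume x: "x \<in> carrier (cycle_group n G)"
  then show "\<exists>y\<in>carrier (cycle_group n G). y \<otimes>\<^bsub>cycle_group n G\<^esub> x = \<one>\<^bsub>cycle_group n G\<^esub>"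
    by (intro bexI[of _ "- x"]) (auto simp: bar_cycles_eq bar_diff_minus)
qed (auto simp: bar_cycles_eq bar_diff_add algebra_simps dest: subsetD[OF keys_add])

lemma bar_boundaries_subset:
  assumes "monoid G"
  shows "bar_boundaries n G \<subseteq> bar_cycles n G"
proof
  fix b assume "b \<in> bar_boundaries n G"
  then obtain w where w: "Poly_Mapping.keys w \<subseteq> bar_lists (Suc n) G" "b = bar_diff G w"
    by (auto simp: bar_boundaries_eq)
  then show "b \<in> bar_cycles n G"
    using keys_bar_diff[OF assms w(1)]
      monoid.bar_diff_bar_diff[OF assms order_trans[OF w(1) bar_lists_subset]]
    by (simp add: bar_cycles_eq)
qed

lemma bar_boundaries_diff:
  assumes "a \<in> bar_boundaries n G" "b \<in> bar_boundaries n G"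
  shows "a - b \<in> bar_boundaries n G"
proof -
  obtain v w where "Poly_Mapping.keys v \<subseteq> bar_lists (Suc n) G" "a = bar_diff G v"
      "Poly_Mapping.keys w \<subseteq> bar_lists (Suc n) G" "b = bar_diff G w"
    using assms by (auto simp: bar_boundaries_eq)
  then show ?thesis unfolding bar_boundaries_eq
    by (intro image_eqI[of _ _ "v - w"]) (auto simp: bar_diff_diff dest: subsetD[OF keys_diff])
qed

lemma zero_bar_boundaries: "0 \<in> bar_boundaries n G"
  unfolding bar_boundaries_eq by (intro image_eqI[of _ _ 0]) auto

lemma subgroup_bar_boundaries:
  assumes "monoid G"
  shows "subgroup (bar_boundaries n G) (cycle_group n G)"
proof -
  interpret comm_group "cycle_group n G" by (rule comm_group_cycle_group)
  have neg: "- b \<in> bar_boundaries n G" if "b \<in> bar_boundaries n G" for b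
    using bar_boundaries_diff[OF zero_bar_boundaries that] by simp
  show ?thesis
  proof (rule subgroupI)
    fix b assume b: "b \<in> bar_boundaries n G"
    have "inv\<^bsub>cycle_group n G\<^esub> b = - b"
      using b neg[OF b] bar_boundaries_subset[OF assms] by (intro inv_equality) auto
    then show "inv\<^bsub>cycle_group n G\<^esub> b \<in> bar_boundaries n G" using neg[OF b] by simp
    fix a assume "a \<in> bar_boundaries n G"
    from bar_boundaries_diff[OF this neg[OF b]] show "a \<otimes>\<^bsub>cycle_group n G\<^esub> b \<in> bar_boundaries n G" by simp
  next
    show "bar_boundaries n G \<noteq> {}" using zero_bar_boundaries by blast
  qed (use bar_boundaries_subset[OF assms] in simp)
qed

lemma group_homology_eq: "group_homology n G = cycle_group n G Mod bar_boundaries n G"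
  by (simp add: group_homology_def cycle_group_def)

lemma homology_class_eq_coset: "homology_class n G c = bar_boundaries n G #>\<^bsub>cycle_group n G\<^esub> c"
  by (simp add: homology_class_def r_coset_def)

lemma comm_group_group_homology: "monoid G \<Longrightarrow> comm_group (group_homology n G)"
  unfolding group_homology_eq
  by (rule comm_group.abelian_FactGroup[OF comm_group_cycle_group subgroup_bar_boundaries])

lemma carrier_group_homology: "carrier (group_homology n G) = homology_class n G ` bar_cycles n G"
  unfolding group_homology_eq carrier_FactGroup homology_class_eq_coset[abs_def] by simp

lemma homology_class_hom:
  assumes "monoid G"
  shows "homology_class n G \<in> hom (cycle_group n G) (group_homology n G)"
proof -
  interpret comm_group "cycle_group n G" by (rule comm_group_cycle_group)
  have "bar_boundaries n G \<lhd> cycle_group n G"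
    by (rule subgroup_imp_normal[OF subgroup_bar_boundaries[OF assms]])
  from normal.r_coset_hom_Mod[OF this] show ?thesis
    by (simp add: group_homology_eq homology_class_eq_coset[abs_def])
qed

lemma homology_class_mult:
  assumes "monoid G" "c \<in> bar_cycles n G" "d \<in> bar_cycles n G"
  shows "homology_class n G c \<otimes>\<^bsub>group_homology n G\<^esub> homology_class n G d = homology_class n G (c + d)"
  using hom_mult[OF homology_class_hom[OF assms(1)], of c n d] assms by simp

lemma mem_homology_class: "d \<in> homology_class n G c \<longleftrightarrow> d - c \<in> bar_boundaries n G"
  by (auto simp: homology_class_def r_coset_def image_iff) (metis diff_add_cancel)

lemma homology_class_eq_iff:
  "homology_class n G c = homology_class n G d \<longleftrightarrow> c - d \<in> bar_boundaries n G"
proof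
  assume "homology_class n G c = homology_class n G d"
  moreover have "c \<in> homology_class n G c" by (simp add: mem_homology_class zero_bar_boundaries)
  ultimately show "c - d \<in> bar_boundaries n G" by (simp add: mem_homology_class)
next
  assume cd: "c - d \<in> bar_boundaries n G"
  have "x - c \<in> bar_boundaries n G \<longleftrightarrow> x - d \<in> bar_boundaries n G" for x
  proof
    assume "x - c \<in> bar_boundaries n G"
    from bar_boundaries_diff[OF this bar_boundaries_diff[OF zero_bar_boundaries cd]]
    show "x - d \<in> bar_boundaries n G" by simp
  next
    assume "x - d \<in> bar_boundaries n G"
    from bar_boundaries_diff[OF this cd] show "x - c \<in> bar_boundaries n G" by simp
  qed
  then show "homology_class n G c = homology_class n G d" by (auto simp: mem_homology_class)
qed

lemma bar_map_cycle:
  assumes "f \<in> hom G H" "c \<in> bar_cycles n G"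
  shows "bar_map f c \<in> bar_cycles n H"
proof -
  have c: "Poly_Mapping.keys c \<subseteq> bar_lists n G" "bar_diff G c = 0" using assms(2) by (auto simp: bar_cycles_eq)
  show ?thesis
    using keys_bar_map[OF hom_carrier[OF assms(1)] c(1)]
      bar_diff_bar_map[OF assms(1) order_trans[OF c(1) bar_lists_subset]] c(2)
    by (simp add: bar_cycles_eq bar_map_eq)
qed

lemma bar_map_boundary:
  assumes "f \<in> hom G H" "b \<in> bar_boundaries n G"
  shows "bar_map f b \<in> bar_boundaries n H"
proof -
  obtain w where w: "Poly_Mapping.keys w \<subseteq> bar_lists (Suc n) G" "b = bar_diff G w"
    using assms(2) by (auto simp: bar_boundaries_eq)
  then show ?thesis
    using keys_bar_map[OF hom_carrier[OF assms(1)] w(1)]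
      bar_diff_bar_map[OF assms(1) order_trans[OF w(1) bar_lists_subset]]
    by (auto simp: bar_boundaries_eq intro!: image_eqI[of _ _ "bar_map f w"])
qed

text \<open>Boundaries map to boundaries, so the induced map may be computed on any one
  representative.\<close>

lemma group_homology_map_class:
  assumes "f \<in> hom G H"
  shows "group_homology_map n H f (homology_class n G c) = homology_class n H (bar_map f c)"
proof -
  have "homology_class n H (bar_map f d) = homology_class n H (bar_map f c)"
    if "d \<in> homology_class n G c" for d
    using bar_map_boundary[OF assms] that
    by (simp add: homology_class_eq_iff mem_homology_class bar_map_eq frag_map_diff[symmetric])
  moreover have "c \<in> homology_class n G c" by (simp add: mem_homology_class zero_bar_boundaries)
  ultimately show ?thesis unfolding group_homology_map_def homology_class_def[of n H, symmetric] by blast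
qed

lemma group_homology_map_hom:
  assumes "monoid G" "monoid H" "f \<in> hom G H"
  shows "group_homology_map n H f \<in> hom (group_homology n G) (group_homology n H)"
proof (rule homI)
  fix X Y assume "X \<in> carrier (group_homology n G)" "Y \<in> carrier (group_homology n G)"
  then obtain c d where c: "c \<in> bar_cycles n G" "X = homology_class n G c"
    and d: "d \<in> bar_cycles n G" "Y = homology_class n G d"
    by (auto simp: carrier_group_homology)
  show "group_homology_map n H f X \<in> carrier (group_homology n H)"
    using bar_map_cycle[OF assms(3) c(1)] c by (simp add: group_homology_map_class[OF assms(3)] carrier_group_homology)
  show "group_homology_map n H f (X \<otimes>\<^bsub>group_homology n G\<^esub> Y)
      = group_homology_map n H f X \<otimes>\<^bsub>group_homology n H\<^esub> group_homology_map n H f Y"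
    using bar_map_cycle[OF assms(3) c(1)] bar_map_cycle[OF assms(3) d(1)] c d
    by (simp add: group_homology_map_class[OF assms(3)] homology_class_mult assms bar_map_eq frag_map_add)
qed

subsection \<open>Inverse limits and the first derived limit\<close>

lemma inverse_limit_simps [simp]:
  "carrier (inverse_limit A p) = {x. (\<forall>i. x i \<in> carrier (A i)) \<and> (\<forall>i. p i (x (Suc i)) = x i)}"
  "x \<otimes>\<^bsub>inverse_limit A p\<^esub> y = (\<lambda>i. x i \<otimes>\<^bsub>A i\<^esub> y i)"
  "\<one>\<^bsub>inverse_limit A p\<^esub> = (\<lambda>i. \<one>\<^bsub>A i\<^esub>)"
  by (auto simp: inverse_limit_def PiE_iff restrict_def)

lemma comm_group_inverse_limit:
  assumes "tower A p"
  shows "comm_group (inverse_limit A p)"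
proof -
  have A: "comm_group (A i)" and p: "p i \<in> hom (A (Suc i)) (A i)" for i
    using assms by (auto simp: tower_def)
  have G: "group (A i)" for i using A comm_group.axioms by blast
  have M: "comm_monoid (A i)" for i using A comm_group.axioms by blast
  have M': "monoid (A i)" for i using G group.is_monoid by blast
  show ?thesis
  proof (rule comm_groupI)
    fix x assume x: "x \<in> carrier (inverse_limit A p)"
    have "p i (inv\<^bsub>A (Suc i)\<^esub> x (Suc i)) = inv\<^bsub>A i\<^esub> x i" for i
      using group_hom.hom_inv[of "A (Suc i)" "A i" "p i" "x (Suc i)"] x p[of i] G
      by (simp add: group_hom_def group_hom_axioms_def)
    then show "\<exists>y\<in>carrier (inverse_limit A p). y \<otimes>\<^bsub>inverse_limit A p\<^esub> x = \<one>\<^bsub>inverse_limit A p\<^esub>"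
      using x G by (intro bexI[of _ "\<lambda>i. inv\<^bsub>A i\<^esub> x i"]) (auto simp: group.l_inv)
  next
    fix x y assume "x \<in> carrier (inverse_limit A p)" "y \<in> carrier (inverse_limit A p)"
    then show "x \<otimes>\<^bsub>inverse_limit A p\<^esub> y \<in> carrier (inverse_limit A p)"
      using p M' by (auto simp: hom_def monoid.m_closed)
    show "x \<otimes>\<^bsub>inverse_limit A p\<^esub> y = y \<otimes>\<^bsub>inverse_limit A p\<^esub> x"
      using \<open>x \<in> _\<close> \<open>y \<in> _\<close> M by (auto simp: comm_monoid.m_comm)
  next
    show "\<one>\<^bsub>inverse_limit A p\<^esub> \<in> carrier (inverse_limit A p)"
      using hom_one[OF p G G] M' by (auto simp: monoid.one_closed)
  qed (use M' in \<open>auto simp: monoid.m_assoc monoid.l_one\<close>)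
qed

text \<open>A compatible family through \<open>a\<close> is built from level \<open>k\<close> in
  both directions: upwards by chosen preimages, downwards by the maps \<open>p\<close>. Thus
  \<open>down d\<close> lives at level \<open>k - d\<close>.\<close>

lemma inverse_limit_projection_epi:
  assumes "\<And>i. p i \<in> epi (A (Suc i)) (A i)"
  shows "(\<lambda>x. x k) \<in> epi (inverse_limit A p) (A k)"
proof -
  have p: "p i ` carrier (A (Suc i)) = carrier (A i)" for i using assms by (auto simp: epi_def)
  have "\<exists>x\<in>carrier (inverse_limit A p). x k = a" if a: "a \<in> carrier (A k)" for a
  proof -
    define s where "s i b = inv_into (carrier (A (Suc i))) (p i) b" for i b
    have s: "s i b \<in> carrier (A (Suc i))" "p i (s i b) = b" if "b \<in> carrier (A i)" for i b
      using that p[of i] by (auto simp: s_def intro!: inv_into_into f_inv_into_f)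
    define up where "up = rec_nat a (\<lambda>d b. s (k + d) b)"
    have up: "up d \<in> carrier (A (k + d))" for d
      by (induction d) (auto simp: up_def a s)
    have up_step: "p (k + d) (up (Suc d)) = up d" for d
      using s(2)[OF up] by (simp add: up_def)
    define down where "down = rec_nat a (\<lambda>d b. p (k - Suc d) b)"
    have down: "down d \<in> carrier (A (k - d))" if "d \<le> k" for d
      using that
    proof (induction d)
      case (Suc d)
      then have "down d \<in> carrier (A (Suc (k - Suc d)))" by (simp add: Suc_diff_Suc)
      then show ?case using p[of "k - Suc d"] by (auto simp: down_def)
    qed (simp add: down_def a)
    define x where "x i = (if k \<le> i then up (i - k) else down (k - i))" for i
    have "x i \<in> carrier (A i)" for i
      using up[of "i - k"] down[of "k - i"] by (auto simp: x_def)
    moreover have "p i (x (Suc i)) = x i" for i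
    proof (cases "k \<le> i")
      case True
      then show ?thesis using up_step[of "i - k"] by (simp add: x_def Suc_diff_le)
    next
      case False
      \<comment> \<open>At \<open>Suc i = k\<close> the upward branch applies; both recursions start
        at \<open>a\<close>, so they agree there.\<close>
      have "x (Suc i) = down (k - Suc i)"
        using False by (cases "k = Suc i") (auto simp: x_def up_def down_def)
      moreover have "x i = p i (down (k - Suc i))"
        using False by (auto simp: x_def down_def Suc_diff_Suc[symmetric])
      ultimately show ?thesis by simp
    qed
    moreover have "x k = a" by (simp add: x_def up_def)
    ultimately show ?thesis by auto
  qed
  then show ?thesis by (fastforce simp: epi_def hom_def)
qed

lemma (in comm_group) div_div_cancel:
  assumes "x \<in> carrier G" "y \<in> carrier G" "z \<in> carrier G"
  shows "(x \<otimes> inv y) \<otimes> inv (x \<otimes> inv z) = z \<otimes> inv y"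
proof -
  have "(x \<otimes> inv y) \<otimes> inv (x \<otimes> inv z) = (x \<otimes> inv y) \<otimes> (inv x \<otimes> z)"
    using assms by (simp add: inv_mult)
  also have "\<dots> = (x \<otimes> inv x) \<otimes> (z \<otimes> inv y)"
    by (simp only: m_ac assms inv_closed m_closed)
  finally show ?thesis using assms by simp
qed

text \<open>
  The tower of kernels \<open>ker (q i)\<close> embeds in the constant tower \<open>G\<close>, whose derived limit vanishes. A
  family \<open>x\<close> of elements of the kernels is sent to the compatible family of the \<open>q i\<close>-images of
  \<open>x\<^sub>0\<^sup>-\<^sup>1 \<cdots> x\<^bsub>i-1\<^esub>\<^sup>-\<^sup>1\<close>.
\<close>

theorem cokernel_to_limit_cotorsion:
  fixes G :: "('g, 'k) monoid_scheme" and H :: "nat \<Rightarrow> ('h, 'm) monoid_scheme"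
  assumes G: "comm_group G" and H: "tower H P" and q: "\<And>i. q i \<in> epi G (H i)"
    and compat: "\<And>i x. x \<in> carrier G \<Longrightarrow> P i (q (Suc i) x) = q i x"
  shows "cotorsion_group (cokernel G (inverse_limit H P) (\<lambda>x i. q i x))"
proof -
  interpret G: comm_group G by (rule G)
  have Hi: "comm_group (H i)" for i using H by (simp add: tower_def)
  have Gi: "group (H i)" for i using Hi comm_group.axioms by blast
  have q_hom: "q i \<in> hom G (H i)" and q_onto: "q i ` carrier G = carrier (H i)" for i
    using q by (auto simp: epi_def)
  have Q: "group_hom G (H i) (q i)" for i
    using q_hom Gi by (simp add: group_hom_def group_hom_axioms_def)
  have q_mult: "q i (x \<otimes>\<^bsub>G\<^esub> y) = q i x \<otimes>\<^bsub>H i\<^esub> q i y" if "x \<in> carrier G" "y \<in> carrier G" for i x y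
    using group_hom.hom_mult[OF Q] that by blast
  have q_inv: "q i (inv\<^bsub>G\<^esub> x) = inv\<^bsub>H i\<^esub> q i x" if "x \<in> carrier G" for i x
    using group_hom.hom_inv[OF Q] that by blast
  have q_closed: "q i x \<in> carrier (H i)" if "x \<in> carrier G" for i x
    using group_hom.hom_closed[OF Q] that by blast
  let ?LH = "inverse_limit H P"
  interpret LH: comm_group ?LH by (rule comm_group_inverse_limit[OF H])
  define M where "M x = (\<lambda>i. q i x)" for x
  have M_hom: "M \<in> hom G ?LH"
    by (rule homI) (auto simp: M_def q_mult q_closed compat)
  define I where "I = M ` carrier G"
  have I: "subgroup I ?LH"
    using group_hom.img_is_subgroup[of G ?LH M] M_hom
    by (simp add: I_def group_hom_def group_hom_axioms_def LH.is_group)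
  have I_normal: "I \<lhd> ?LH" by (rule LH.subgroup_imp_normal[OF I])
  define K where "K i = kernel G (H i) (q i)" for i
  have K: "subgroup (K i) G" for i unfolding K_def by (rule group_hom.subgroup_kernel[OF Q])
  define L where "L i = G\<lparr>carrier := K i\<rparr>" for i
  have L_group: "comm_group (L i)" for i
  proof (rule group.group_comm_groupI)
    show "group (L i)" unfolding L_def by (rule subgroup.subgroup_is_group[OF K G.is_group])
    show "x \<otimes>\<^bsub>L i\<^esub> y = y \<otimes>\<^bsub>L i\<^esub> x" if "x \<in> carrier (L i)" "y \<in> carrier (L i)" for x y
      using that subgroup.mem_carrier[OF K] by (simp add: L_def G.m_comm)
  qed
  have memK: "x \<in> K i \<longleftrightarrow> x \<in> carrier G \<and> q i x = \<one>\<^bsub>H i\<^esub>" for x i by (simp add: K_def kernel_def)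
  have P_one: "P i \<one>\<^bsub>H (Suc i)\<^esub> = \<one>\<^bsub>H i\<^esub>" for i
    using hom_one[of "P i" "H (Suc i)" "H i"] H Gi by (simp add: tower_def)
  have K_decr: "x \<in> K i" if "x \<in> K (Suc i)" for x i
    using that compat[of x i] P_one by (auto simp: memK)
  have L: "tower L (\<lambda>i x. x)"
    using L_group K_decr by (auto simp: tower_def hom_def L_def)
  have inv_L: "inv\<^bsub>L i\<^esub> x = inv\<^bsub>G\<^esub> x" if "x \<in> K i" for i x
    unfolding L_def using G.m_inv_consistent[OF K that] by simp
  let ?PL = "product_group UNIV L"
  interpret PL: comm_group ?PL by (rule comm_group_product_group[OF L_group])
  have memPL: "x \<in> carrier ?PL \<longleftrightarrow> (\<forall>i. x i \<in> K i)" for x by (auto simp: L_def PiE_iff)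
  note carrier_product_group [simp del]
  have tower_diff_L: "tower_diff L (\<lambda>i x. x) z i = z i \<otimes>\<^bsub>G\<^esub> inv\<^bsub>G\<^esub> z (Suc i)" if "z \<in> carrier ?PL" for z i
  proof -
    have "z (Suc i) \<in> K i" using that K_decr memPL by blast
    then show ?thesis unfolding tower_diff_def inv_L[OF \<open>z (Suc i) \<in> K i\<close>] by (simp add: L_def)
  qed
  define g where "g x = rec_nat \<one>\<^bsub>G\<^esub> (\<lambda>i a. a \<otimes>\<^bsub>G\<^esub> inv\<^bsub>G\<^esub> x i)" for x :: "nat \<Rightarrow> 'g"
  have g_0: "g x 0 = \<one>\<^bsub>G\<^esub>" and g_Suc: "g x (Suc i) = g x i \<otimes>\<^bsub>G\<^esub> inv\<^bsub>G\<^esub> x i" for x i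
    by (simp_all add: g_def)
  have xG: "x i \<in> carrier G" if "x \<in> carrier ?PL" for x i using that memPL memK by blast
  have g_closed: "g x i \<in> carrier G" if "x \<in> carrier ?PL" for x i
    by (induction i) (use xG[OF that] in \<open>auto simp: g_0 g_Suc\<close>)
  define y where "y x = (\<lambda>i. q i (g x i))" for x
  have y_hom: "y \<in> hom ?PL ?LH"
  proof (rule homI)
    fix x assume x: "x \<in> carrier ?PL"
    have "P i (q (Suc i) (g x (Suc i))) = q i (g x i)" for i
    proof -
      interpret Hi: group "H i" by (rule Gi)
      \<comment> \<open>The factor that enters between \<open>g x i\<close> and
        \<open>g x (Suc i)\<close> dies in \<open>H i\<close>; this gives the compatibility of
        \<open>y x\<close>.\<close>
      have "q i (x i) = \<one>\<^bsub>H i\<^esub>" using x memPL memK by blast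
      then have "q i (g x (Suc i)) = q i (g x i)"
        using g_closed[OF x] xG[OF x] by (simp add: g_Suc q_mult q_inv q_closed)
      then show ?thesis using compat[OF g_closed[OF x]] by simp
    qed
    then show "y x \<in> carrier ?LH" using g_closed[OF x] by (simp add: y_def q_closed)
  next
    fix x x' assume x: "x \<in> carrier ?PL" and x': "x' \<in> carrier ?PL"
    have "g (x \<otimes>\<^bsub>?PL\<^esub> x') i = g x i \<otimes>\<^bsub>G\<^esub> g x' i" for i
    proof (induction i)
      case (Suc i)
      have "(x \<otimes>\<^bsub>?PL\<^esub> x') i = x i \<otimes>\<^bsub>G\<^esub> x' i" by (simp add: L_def)
      then show ?case using Suc xG[OF x] xG[OF x'] g_closed[OF x] g_closed[OF x']
        by (simp add: g_Suc G.inv_mult G.m_ac del: mult_product_group)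
    qed (simp add: g_0)
    then show "y (x \<otimes>\<^bsub>?PL\<^esub> x') = y x \<otimes>\<^bsub>?LH\<^esub> y x'"
      using g_closed[OF x] g_closed[OF x'] by (simp add: y_def q_mult del: mult_product_group)
  qed
  define h where "h x = I #>\<^bsub>?LH\<^esub> y x" for x
  have h_hom: "h \<in> hom ?PL (?LH Mod I)"
    using Group.hom_compose[OF y_hom normal.r_coset_hom_Mod[OF I_normal]] by (simp add: h_def[abs_def] comp_def)
  interpret h: group_hom ?PL "?LH Mod I" h
    using h_hom by (simp add: group_hom_def group_hom_axioms_def PL.is_group normal.factorgroup_is_group[OF I_normal])
  have y_closed: "y x \<in> carrier ?LH" if "x \<in> carrier ?PL" for x using y_hom that by (rule hom_in_carrier)
  have "kernel ?PL (?LH Mod I) h = tower_diff L (\<lambda>i x. x) ` carrier ?PL"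
  proof (intro equalityI subsetI)
    fix x assume "x \<in> kernel ?PL (?LH Mod I) h"
    then have x: "x \<in> carrier ?PL" and "h x = I" by (simp_all add: kernel_def)
    then have "y x \<in> I" using LH.rcos_self[OF y_closed[OF x] I] by (simp add: h_def)
    then obtain a where a: "a \<in> carrier G" "\<And>i. q i (g x i) = q i a"
      by (auto simp: I_def M_def y_def fun_eq_iff)
    \<comment> \<open>\<open>g x i\<close> and \<open>a\<close> have the same image under
      \<open>q i\<close>, so the quotient lies in \<open>K i\<close>. The constant \<open>a\<close>
      cancels in the quotient of consecutive terms, which leaves \<open>x i\<close>.\<close>
    define z where "z = (\<lambda>i. g x i \<otimes>\<^bsub>G\<^esub> inv\<^bsub>G\<^esub> a)"
    have z: "z \<in> carrier ?PL" unfolding memPL memK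
    proof (intro allI conjI)
      fix i
      interpret Hi: group "H i" by (rule Gi)
      show "z i \<in> carrier G" using g_closed[OF x] a by (simp add: z_def)
      show "q i (z i) = \<one>\<^bsub>H i\<^esub>" using g_closed[OF x] a q_closed by (simp add: z_def q_mult q_inv)
    qed
    have "tower_diff L (\<lambda>i x. x) z i = x i" for i
    proof -
      have "z (Suc i) = (z i \<otimes>\<^bsub>G\<^esub> inv\<^bsub>G\<^esub> x i)"
        using g_closed[OF x] a(1) xG[OF x] by (simp add: z_def g_Suc G.m_ac)
      then have "z i \<otimes>\<^bsub>G\<^esub> inv\<^bsub>G\<^esub> z (Suc i) = x i"
        using G.div_div_cancel[of "z i" "\<one>\<^bsub>G\<^esub>" "x i"] xG[OF x] xG[OF z] by simp
      then show ?thesis using tower_diff_L[OF z] by simp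
    qed
    then have "x = tower_diff L (\<lambda>i x. x) z" by auto
    then show "x \<in> tower_diff L (\<lambda>i x. x) ` carrier ?PL" using z by blast
  next
    fix x assume "x \<in> tower_diff L (\<lambda>i x. x) ` carrier ?PL"
    then obtain z where z: "z \<in> carrier ?PL" "x = tower_diff L (\<lambda>i x. x) z" by blast
    have x: "x \<in> carrier ?PL" using tower_diff_hom[OF L] z by (auto simp: hom_def)
    \<comment> \<open>The product telescopes. As \<open>z i\<close> dies in \<open>H i\<close>, the
      family \<open>y x\<close> is the image of the single element inverse to
      \<open>z 0\<close>.\<close>
    have g: "g x i = z i \<otimes>\<^bsub>G\<^esub> inv\<^bsub>G\<^esub> z 0" for i
    proof (induction i)
      case (Suc i)
      then show ?case
        using G.div_div_cancel[of "z i" "z 0" "z (Suc i)"] xG[OF z(1)] z(2) tower_diff_L[OF z(1)]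
        by (simp add: g_Suc)
    qed (use xG[OF z(1)] in \<open>simp add: g_0\<close>)
    have "y x = M (inv\<^bsub>G\<^esub> z 0)"
    proof
      fix i
      interpret Hi: group "H i" by (rule Gi)
      have "q i (z i) = \<one>\<^bsub>H i\<^esub>" using z memPL memK by blast
      then show "y x i = M (inv\<^bsub>G\<^esub> z 0) i"
        using xG[OF z(1)] q_closed by (simp add: y_def M_def g q_mult)
    qed
    then have "y x \<in> I" using xG[OF z(1)] by (simp add: I_def)
    then have "h x = I" unfolding h_def by (rule LH.coset_join2[OF y_closed[OF x] I])
    then show "x \<in> kernel ?PL (?LH Mod I) h" using x by (simp add: kernel_def)
  qed
  moreover have "h ` carrier ?PL = carrier (?LH Mod I)"
  proof
    show "h ` carrier ?PL \<subseteq> carrier (?LH Mod I)" using h.hom_closed by blast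
    show "carrier (?LH Mod I) \<subseteq> h ` carrier ?PL"
    proof
      fix X assume "X \<in> carrier (?LH Mod I)"
      then obtain v where v: "v \<in> carrier ?LH" "X = I #>\<^bsub>?LH\<^esub> v" by (auto simp: carrier_FactGroup)
      define a where "a i = inv_into (carrier G) (q i) (v i)" for i
      have "v i \<in> q i ` carrier G" for i using v(1) q_onto[of i] by simp
      then have a: "a i \<in> carrier G" "q i (a i) = v i" for i
        unfolding a_def by (rule inv_into_into, rule f_inv_into_f)
      \<comment> \<open>By compatibility of \<open>v\<close>, both \<open>a i\<close> and
        \<open>a (Suc i)\<close> map to \<open>v i\<close> under \<open>q i\<close>, so their
        quotient lies in \<open>K i\<close>. The products telescope to \<open>a i\<close> divided by
        \<open>a 0\<close>, hence \<open>y x\<close> is \<open>v\<close> up to the image of an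
        element of \<open>G\<close>.\<close>
      define x where "x = (\<lambda>i. a i \<otimes>\<^bsub>G\<^esub> inv\<^bsub>G\<^esub> a (Suc i))"
      have x: "x \<in> carrier ?PL" unfolding memPL memK
      proof (intro allI conjI)
        fix i
        interpret Hi: group "H i" by (rule Gi)
        show "x i \<in> carrier G" using a by (simp add: x_def)
        have "q i (a (Suc i)) = v i" using compat[OF a(1), of i "Suc i"] a(2) v(1) by simp
        then show "q i (x i) = \<one>\<^bsub>H i\<^esub>" using a v(1) by (simp add: x_def q_mult q_inv)
      qed
      have g: "g x i = a i \<otimes>\<^bsub>G\<^esub> inv\<^bsub>G\<^esub> a 0" for i
      proof (induction i)
        case (Suc i)
        then show ?case
          using G.div_div_cancel[of "a i" "a 0" "a (Suc i)"] a(1) by (simp add: g_Suc x_def)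
      qed (use a(1) in \<open>simp add: g_0\<close>)
      have Ma: "M (inv\<^bsub>G\<^esub> a 0) \<in> I" using a(1) by (simp add: I_def)
      have "y x = M (inv\<^bsub>G\<^esub> a 0) \<otimes>\<^bsub>?LH\<^esub> v"
      proof
        fix i
        interpret Hi: comm_group "H i" by (rule Hi)
        show "y x i = (M (inv\<^bsub>G\<^esub> a 0) \<otimes>\<^bsub>?LH\<^esub> v) i"
          using a v(1) q_closed by (simp add: y_def M_def g q_mult Hi.m_comm)
      qed
      then have "y x \<in> I #>\<^bsub>?LH\<^esub> v" using Ma by (auto simp: r_coset_def)
      then have "X = h x" unfolding h_def v(2) by (rule LH.repr_independence[OF _ v(1) I])
      then show "X \<in> h ` carrier ?PL" using x by blast
    qed
  qed
  ultimately have iso: "lim1 L (\<lambda>i x. x) \<cong> ?LH Mod I"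
    using h.FactGroup_iso by (simp add: lim1_def cokernel_def)
  have "group (lim1 L (\<lambda>i x. x))" using comm_group_lim1[OF L] by (rule comm_group.axioms)
  then have "?LH Mod I \<cong> lim1 L (\<lambda>i x. x)" using iso by (rule group.iso_sym)
  moreover have "comm_group (?LH Mod I)" by (rule LH.abelian_FactGroup[OF I])
  ultimately have "cotorsion_group (?LH Mod I)" using L by (rule cotorsion_groupI[rotated 2])
  then show ?thesis by (simp add: cokernel_def I_def M_def[abs_def])
qed

theorem theorem2:
  fixes A :: "nat \<Rightarrow> ('a, 'm) monoid_scheme" and p :: "nat \<Rightarrow> 'a \<Rightarrow> 'a" and n :: nat
  assumes "tower A p"
    and "\<And>i. torsion_free_group (A i)"
    and "\<And>i. p i \<in> epi (A (Suc i)) (A i)"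
  shows "homology_limit_map n A
      \<in> mon (group_homology n (inverse_limit A p))
            (inverse_limit (\<lambda>i. group_homology n (A i))
                           (\<lambda>i. group_homology_map n (A i) (p i)))
    \<and> cotorsion_group
        (cokernel (group_homology n (inverse_limit A p))
                  (inverse_limit (\<lambda>i. group_homology n (A i))
                                 (\<lambda>i. group_homology_map n (A i) (p i)))
                  (homology_limit_map n A))"
proof -
  let ?A = "inverse_limit A p"
  define H where "H i = group_homology n (A i)" for i
  define P where "P i = group_homology_map n (A i) (p i)" for i
  define q where "q i = group_homology_map n (A i) (\<lambda>x. x i)" for i :: nat
  have A: "comm_group (A i)" and p: "p i \<in> hom (A (Suc i)) (A i)" for i
    using assms(1) by (auto simp: tower_def)
  have Gi: "group (A i)" for i using A comm_group.axioms by blast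
  have Mi: "monoid (A i)" for i using Gi group.is_monoid by blast
  interpret L: comm_group ?A by (rule comm_group_inverse_limit[OF assms(1)])
  have proj: "(\<lambda>x. x i) \<in> epi ?A (A i)" for i by (rule inverse_limit_projection_epi) (rule assms(3))
  then have proj_hom: "(\<lambda>x. x i) \<in> hom ?A (A i)" for i by (simp add: epi_def)
  have tower: "tower H P"
    unfolding tower_def H_def P_def
    using comm_group_group_homology[OF Mi] group_homology_map_hom[OF Mi Mi p] by blast
  have q_class: "q i (homology_class n ?A c) = homology_class n (A i) (bar_map (\<lambda>x. x i) c)" for i c
    unfolding q_def by (rule group_homology_map_class[OF proj_hom])
  have q_epi: "q i \<in> epi (group_homology n ?A) (H i)" for i
  proof -
    have "q i \<in> hom (group_homology n ?A) (H i)"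
      unfolding q_def H_def by (rule group_homology_map_hom[OF L.monoid_axioms Mi proj_hom])
    moreover have "Y \<in> q i ` carrier (group_homology n ?A)" if Y: "Y \<in> carrier (H i)" for Y
    proof -
      obtain c where c: "Poly_Mapping.keys c \<subseteq> bar_lists n (A i)" "bar_diff (A i) c = 0"
          "Y = homology_class n (A i) c"
        using Y by (auto simp: H_def carrier_group_homology bar_cycles_eq)
      obtain c' where "Poly_Mapping.keys c' \<subseteq> bar_lists n ?A" "bar_diff ?A c' = 0" "bar_map (\<lambda>x. x i) c' = c"
        using cycle_lift[OF L.comm_group_axioms A assms(2) proj c(1,2)] by blast
      then show ?thesis
        using q_class[of i c'] c(3) by (auto simp: carrier_group_homology bar_cycles_eq)
    qed
    ultimately show ?thesis by (auto simp: epi_def dest: hom_in_carrier)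
  qed
  then have q_hom: "q i \<in> hom (group_homology n ?A) (H i)" for i by (simp add: epi_def)
  have compat: "P i (q (Suc i) X) = q i X" if X: "X \<in> carrier (group_homology n ?A)" for i X
  proof -
    obtain c where c: "Poly_Mapping.keys c \<subseteq> bar_lists n ?A" "X = homology_class n ?A c"
      using X by (auto simp: carrier_group_homology bar_cycles_eq)
    have "bar_map (p i) (bar_map (\<lambda>x. x (Suc i)) c) = bar_map (\<lambda>x. x i) c"
      unfolding bar_map_bar_map
      by (rule bar_map_cong[OF order_trans[OF c(1) bar_lists_subset]]) simp
    then show ?thesis
      by (simp add: c(2) q_class) (simp add: P_def group_homology_map_class[OF p])
  qed
  have map_eq: "homology_limit_map n A = (\<lambda>X i. q i X)"
    by (simp add: homology_limit_map_def q_def fun_eq_iff)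
  have "(\<lambda>X i. q i X) \<in> hom (group_homology n ?A) (inverse_limit H P)"
  proof (rule homI)
    fix X Y assume X: "X \<in> carrier (group_homology n ?A)" and Y: "Y \<in> carrier (group_homology n ?A)"
    show "(\<lambda>i. q i X) \<in> carrier (inverse_limit H P)"
      using hom_in_carrier[OF q_hom X] compat[OF X] by simp
    show "(\<lambda>i. q i (X \<otimes>\<^bsub>group_homology n ?A\<^esub> Y)) = (\<lambda>i. q i X) \<otimes>\<^bsub>inverse_limit H P\<^esub> (\<lambda>i. q i Y)"
      using hom_mult[OF q_hom X Y] by simp
  qed
  moreover have "inj_on (\<lambda>X i. q i X) (carrier (group_homology n ?A))"
  proof (rule inj_onI)
    fix X Y assume X: "X \<in> carrier (group_homology n ?A)" and Y: "Y \<in> carrier (group_homology n ?A)"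
      and eq: "(\<lambda>i. q i X) = (\<lambda>i. q i Y)"
    obtain c d where c: "c \<in> bar_cycles n ?A" "X = homology_class n ?A c"
      and d: "d \<in> bar_cycles n ?A" "Y = homology_class n ?A d"
      using X Y by (auto simp: carrier_group_homology)
    have cd: "Poly_Mapping.keys (c - d) \<subseteq> bar_lists n ?A" "bar_diff ?A (c - d) = 0"
      using c d keys_diff_subset[of c "bar_lists n ?A" d] by (auto simp: bar_cycles_eq bar_diff_diff)
    have bdry: "\<exists>w. Poly_Mapping.keys w \<subseteq> bar_lists (Suc n) (A i) \<and> bar_map (\<lambda>x. x i) (c - d) = bar_diff (A i) w" for i
    proof -
      have "homology_class n (A i) (bar_map (\<lambda>x. x i) c) = homology_class n (A i) (bar_map (\<lambda>x. x i) d)"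
        using fun_cong[OF eq, of i] by (simp add: c d q_class)
      then have "bar_map (\<lambda>x. x i) (c - d) \<in> bar_boundaries n (A i)"
        by (simp add: homology_class_eq_iff bar_map_eq frag_map_diff)
      then show ?thesis by (auto simp: bar_boundaries_eq)
    qed
    \<comment> \<open>The kernels of the projections decrease because each \<open>p i\<close>
      preserves the unit, and they meet trivially because elements of the limit are determined by
      their components.\<close>
    have "x i = \<one>\<^bsub>A i\<^esub>" if "x \<in> carrier ?A" "x (Suc i) = \<one>\<^bsub>A (Suc i)\<^esub>" for i x
    proof -
      have "x i = p i (x (Suc i))" using that(1) by simp
      then show ?thesis using that(2) hom_one[OF p Gi Gi, of i] by simp
    qed
    moreover have "x = \<one>\<^bsub>?A\<^esub>" if "x \<in> carrier ?A" "\<And>i. x i = \<one>\<^bsub>A i\<^esub>" for x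
      using that by auto
    ultimately have "\<exists>w. Poly_Mapping.keys w \<subseteq> bar_lists (Suc n) ?A \<and> c - d = bar_diff ?A w"
      using boundary_if_boundary_in_quotients[where q = "\<lambda>i x. x i" and A = A, OF L.comm_group_axioms A assms(2) proj_hom _ _ cd bdry]
      by blast
    then have "c - d \<in> bar_boundaries n ?A" by (auto simp: bar_boundaries_eq)
    then show "X = Y" by (simp add: c d homology_class_eq_iff)
  qed
  moreover have "cotorsion_group (cokernel (group_homology n ?A) (inverse_limit H P) (\<lambda>X i. q i X))"
    by (rule cokernel_to_limit_cotorsion[OF comm_group_group_homology[OF L.monoid_axioms] tower q_epi compat])
  ultimately show ?thesis
    unfolding map_eq mon_def H_def[abs_def] P_def[abs_def] by blast
qed

end
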